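(* The ideals of $P=\operatorname{Reg}(\mathcal M_{mn}^J)$ are precisely the sets $$I_s^J=D_0^J\cup\cdots\cup D_s^J=\{X\in P:\operatorname{rank}(X)\leq s\}\qquad\text{for }0\leq s\leq r,$$ and they form a chain $I_0^J\subseteq\cdots\subseteq I_r^J$. If $0\leq s<r$, then $I_s^J$ is generated (as a semigroup under $\star$) by the idempotents $E_J(D_s^J)$ in its top $\mathcal D^J$-class $D_s^J$, and if $|\mathbb F|=q<\infty$, then $$\operatorname{rank}(I_s^J)=\operatorname{idrank}(I_s^J)=q^{s(L-r)}\begin{bmatrix}r\\ s\end{bmatrix}_q,\qquad\text{where }L=\max(m,n).$$
   Context: Let $\mathbb F$ be a field, $m,n\geq1$ integers, and $0\leq r\leq\min(m,n)$. $\mathcal M_{kl}$ denotes the set of all $k\times l$ matrices over $\mathbb F$. Let $J=\begin{bmatrix}I_r&O\\O&O\end{bmatrix}\in\mathcal M_{nm}$ (an $n\times m$ matrix), and let $\mathcal M_{mn}^J$ be the semigroup with underlying set $\mathcal M_{mn}$ and operation $X\star Y=XJY$. $P=\operatorname{Reg}(\mathcal M_{mn}^J)$ is the subsemigroup of all regular elements (those $X$ with $X=X\star Y\star X$ for some $Y$). For $0\leq s\leq r$, $D_s^J=\{X\in P:\operatorname{rank}(X)=s\}$; these are the $\mathcal D^J$-classes of $P$, where $\mathcal D^J$ is Green's $\mathcal D$-relation on $P$. For $\Omega\subseteq\mathcal M_{mn}$, $E_J(\Omega)=\{X\in\Omega:X=X\star X\}$. Ideals are non-empty two-sided semigroup ideals.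 For a semigroup $S$, $\operatorname{rank}(S)$ is the minimum size of a generating set for $S$ (as a semigroup); for an idempotent generated semigroup $S$, $\operatorname{idrank}(S)$ is the minimum size of a generating set for $S$ consisting of idempotents. $[s]_q!=\prod_{i=1}^s(1+q+\cdots+q^{i-1})$, and $\begin{bmatrix}k\\ s\end{bmatrix}_q=\frac{[k]_q!}{[s]_q!\,[k-s]_q!}$ is the $q$-binomial coefficient. *)

theory Defs
  imports "Jordan_Normal_Form.DL_Rank"
begin

text \<open>Semigroups are given by a carrier set S together with a binary operation f on the
  ambient type, under which S is closed in all uses.\<close>

definition regular_elements :: "'b set \<Rightarrow> ('b \<Rightarrow> 'b \<Rightarrow> 'b) \<Rightarrow> 'b set" where
  "regular_elements S f = {x \<in> S. \<exists>y\<in>S. x = f (f x y) x}"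

definition idempotents_in :: "('b \<Rightarrow> 'b \<Rightarrow> 'b) \<Rightarrow> 'b set \<Rightarrow> 'b set" where
  "idempotents_in f A = {x \<in> A. x = f x x}"

definition sg_ideal :: "'b set \<Rightarrow> ('b \<Rightarrow> 'b \<Rightarrow> 'b) \<Rightarrow> 'b set \<Rightarrow> bool" where
  "sg_ideal S f A \<longleftrightarrow> A \<noteq> {} \<and> A \<subseteq> S \<and> (\<forall>x\<in>A. \<forall>s\<in>S. f s x \<in> A \<and> f x s \<in> A)"

inductive_set sg_generated :: "('b \<Rightarrow> 'b \<Rightarrow> 'b) \<Rightarrow> 'b set \<Rightarrow> 'b set"
  for f :: "'b \<Rightarrow> 'b \<Rightarrow> 'b" and A :: "'b set" where
  base: "x \<in> A \<Longrightarrow> x \<in> sg_generated f A"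
| mult: "x \<in> sg_generated f A \<Longrightarrow> y \<in> sg_generated f A \<Longrightarrow> f x y \<in> sg_generated f A"

text \<open>The two ranks are natural numbers, so they are meaningful only for semigroups having a
  finite generating set (respectively, a finite generating set of idempotents). This covers
  all finite (respectively, finite idempotent generated) semigroups.\<close>

definition sg_rank :: "'b set \<Rightarrow> ('b \<Rightarrow> 'b \<Rightarrow> 'b) \<Rightarrow> nat" where
  "sg_rank S f = (LEAST k. \<exists>G. G \<subseteq> S \<and> finite G \<and> card G = k \<and> sg_generated f G = S)"

definition sg_idrank :: "'b set \<Rightarrow> ('b \<Rightarrow> 'b \<Rightarrow> 'b) \<Rightarrow> nat" where
  "sg_idrank S f =
    (LEAST k. \<exists>G. G \<subseteq> idempotents_in f S \<and> finite G \<and> card G = k \<and> sg_generated f G = S)"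

text \<open>Green's relations. The \<open>insert x\<close> terms account for the adjoined identity,
  so that for instance \<open>left_princ S f x\<close> is the left ideal usually
  written \<open>S\<^sup>1 x\<close>. The relation D is the composition of L and R, with the
  intermediate element taken in S.\<close>

definition left_princ :: "'b set \<Rightarrow> ('b \<Rightarrow> 'b \<Rightarrow> 'b) \<Rightarrow> 'b \<Rightarrow> 'b set" where
  "left_princ S f x = insert x ((\<lambda>s. f s x) ` S)"

definition right_princ :: "'b set \<Rightarrow> ('b \<Rightarrow> 'b \<Rightarrow> 'b) \<Rightarrow> 'b \<Rightarrow> 'b set" where
  "right_princ S f x = insert x ((\<lambda>s. f x s) ` S)"

definition two_sided_princ :: "'b set \<Rightarrow> ('b \<Rightarrow> 'b \<Rightarrow> 'b) \<Rightarrow> 'b \<Rightarrow> 'b set" where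
  "two_sided_princ S f x = (\<Union>y \<in> left_princ S f x. right_princ S f y)"

definition green_L :: "'b set \<Rightarrow> ('b \<Rightarrow> 'b \<Rightarrow> 'b) \<Rightarrow> 'b rel" where
  "green_L S f = {(x, y) \<in> S \<times> S. left_princ S f x = left_princ S f y}"

definition green_R :: "'b set \<Rightarrow> ('b \<Rightarrow> 'b \<Rightarrow> 'b) \<Rightarrow> 'b rel" where
  "green_R S f = {(x, y) \<in> S \<times> S. right_princ S f x = right_princ S f y}"

definition green_D :: "'b set \<Rightarrow> ('b \<Rightarrow> 'b \<Rightarrow> 'b) \<Rightarrow> 'b rel" where
  "green_D S f = green_L S f O green_R S f"

text \<open>D-classes are ordered by inclusion of the principal two-sided ideals generated by their
  elements; the top class of an ideal A of S is the greatest D-class contained in A.\<close>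

definition top_D_class :: "'b set \<Rightarrow> ('b \<Rightarrow> 'b \<Rightarrow> 'b) \<Rightarrow> 'b set \<Rightarrow> 'b set \<Rightarrow> bool" where
  "top_D_class S f A D \<longleftrightarrow> D \<in> S // green_D S f \<and> D \<subseteq> A \<and>
    (\<forall>x\<in>A. \<forall>y\<in>D. two_sided_princ S f x \<subseteq> two_sided_princ S f y)"

definition J_mat :: "nat \<Rightarrow> nat \<Rightarrow> nat \<Rightarrow> 'a::field mat" where
  "J_mat m n r =
    four_block_mat (1\<^sub>m r) (0\<^sub>m r (m - r)) (0\<^sub>m (n - r) r) (0\<^sub>m (n - r) (m - r))"

definition sandwich :: "nat \<Rightarrow> nat \<Rightarrow> nat \<Rightarrow> 'a::field mat \<Rightarrow> 'a mat \<Rightarrow> 'a mat" where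
  "sandwich m n r X Y = X * J_mat m n r * Y"

definition RegJ :: "nat \<Rightarrow> nat \<Rightarrow> nat \<Rightarrow> 'a::field mat set" where
  "RegJ m n r = regular_elements (carrier_mat m n) (sandwich m n r)"

text \<open>The first argument of \<open>vec_space.rank\<close> is the number of rows.\<close>

definition DJ :: "nat \<Rightarrow> nat \<Rightarrow> nat \<Rightarrow> nat \<Rightarrow> 'a::field mat set" where
  "DJ m n r s = {X \<in> RegJ m n r. vec_space.rank m X = s}"

definition IJ :: "nat \<Rightarrow> nat \<Rightarrow> nat \<Rightarrow> nat \<Rightarrow> 'a::field mat set" where
  "IJ m n r s = (\<Union>t\<le>s. DJ m n r t)"

definition q_fact :: "nat \<Rightarrow> nat \<Rightarrow> nat" where
  "q_fact q s = (\<Prod>i=1..s. \<Sum>j<i. q ^ j)"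

text \<open>Only used for \<open>s \<le> k\<close>, because of the truncated subtraction.\<close>

definition q_binomial :: "nat \<Rightarrow> nat \<Rightarrow> nat \<Rightarrow> rat" where
  "q_binomial q k s = of_nat (q_fact q k) / of_nat (q_fact q s * q_fact q (k - s))"

end

theory Submission
  imports Defs "Jordan_Normal_Form.Column_Operations" "HOL-Library.FuncSet"
begin

text \<open>The overview leaves open where the constant comes from. In a left factor G only the top
  r rows are constrained: \<open>V * G\<close> must have full column rank. Modulo the general linear
  group of size s these rows amount to an s-dimensional subspace of F^r, which gives the q-binomial,
  and the other m - r rows are free, which gives q^(s(m - r)). Right factors give the same
  expression with n for m, so the larger side of the graph belongs to max m n. The obstacle for the
  upper bound is that one set of that size has to meet all R-classes and all L-classes, consist of
  idempotents, and still generate. The degrees of the graph turn out to be q^(s(n - s)) and q^(s(m -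
  s)); being powers of the same q, one divides the other, which is what lets Hall's theorem
  distribute the larger side evenly over the smaller one. The condition s < r supplies a spare basis
  vector through which images can be moved. For s = r the idempotents are the products K L, and K L
  \<star> K' L' = K L', so that they never produce anything but idempotents.\<close>

text \<open>
  Every regular element has the form K A L, where K has an identity block on top, L has one on the left
  and A is an arbitrary r x r matrix; products become \<open>K A L \<star> K' B L' = K (A B) L'\<close>. Ideals, Green's
  relations and idempotent generation are thereby read off from the monoid of r x r matrices, in which
  every matrix of rank at most s < r is a product of idempotents of rank s.

  An element of the top class of rank s is a product G H of an m x s and an s x n matrix, unique up to
  the general linear group of size s; its R-class is the class of G and its L-class is the class of H. The product of
  G H and G' H' stays in the class iff H J G' is invertible. A generating set has to meet every R-class
  and every L-class, which gives the lower bound for the rank. For the upper bound join an R-class and an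
  L-class by an edge if they meet in a group H-class. This bipartite graph is biregular with one degree
  dividing the other, and connected because the top class is idempotent generated. By Hall's theorem it
  has a set of edges, as numerous as the larger side, that covers all vertices, and counting edges shows
  that products of the corresponding idempotents reach every H-class. By finiteness they then
  generate every idempotent of the top class.
\<close>

section \<open>Invertible matrices and the rank normal form\<close>

text \<open>The side conditions use \<open>dim_row\<close> and \<open>dim_col\<close> so that the
  simplifier can discharge them; the premises of \<open>assoc_mult_mat\<close> mention dimensions
  that do not occur in its conclusion.\<close>

lemma mult_assoc_dim:
  fixes A B C :: "'a::semiring_0 mat"
  shows "dim_col A = dim_row B \<Longrightarrow> dim_col B = dim_row C \<Longrightarrow> A * B * C = A * (B * C)"
  by (rule assoc_mult_mat[of A "dim_row A" "dim_row B" B "dim_row C" C "dim_col C"]) auto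

text \<open>Once products are nested to the right, an inverse pair shows up as A * (B * C). This
  rule removes it there.\<close>

lemma mult_cancel_one:
  fixes A B C :: "'a::semiring_1 mat"
  assumes "A * B = 1\<^sub>m k" "dim_col A = dim_row B" "dim_row C = k"
  shows "A * (B * C) = C"
proof -
  have "dim_col B = k" using arg_cong[OF assms(1), of dim_col] by simp
  then have "A * B * C = A * (B * C)" using assms by (intro mult_assoc_dim) auto
  then show ?thesis using assms by (simp add: left_mult_one_mat')
qed

lemma left_mult_one_dim: "dim_row A = n \<Longrightarrow> 1\<^sub>m n * (A::'a::semiring_1 mat) = A"
  by (simp add: left_mult_one_mat')

lemma right_mult_one_dim: "dim_col A = n \<Longrightarrow> (A::'a::semiring_1 mat) * 1\<^sub>m n = A"
  by (simp add: right_mult_one_mat')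

lemmas mat_assoc = mult_assoc_dim left_mult_one_dim right_mult_one_dim

text \<open>Rectangular, so that one family contains the rank normal forms, the sandwich matrix J,
  its two factors, and the standard embeddings and projections between F^r and the larger
  spaces.\<close>

definition partial_id :: "nat \<Rightarrow> nat \<Rightarrow> nat \<Rightarrow> 'a::field mat" where
  "partial_id n m t = mat n m (\<lambda>(i, j). if i = j \<and> j < t then 1 else 0)"

lemma partial_id_dim [simp]: "dim_row (partial_id n m t) = n" "dim_col (partial_id n m t) = m"
  "partial_id n m t \<in> carrier_mat n m"
  by (auto simp: partial_id_def)

text \<open>The hypothesis ensures that every surviving diagonal position passes through the inner
  dimension.\<close>

lemma partial_id_mult:
  assumes "min t u \<le> b"
  shows "partial_id a b t * partial_id b c u = (partial_id a c (min t u) :: 'a::field mat)"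
proof (rule eq_matI)
  fix i j assume "i < dim_row (partial_id a c (min t u) :: 'a mat)" "j < dim_col (partial_id a c (min t u) :: 'a mat)"
  then have ij: "i < a" "j < c" by auto
  have "(partial_id a b t * partial_id b c u :: 'a mat) $$ (i, j)
      = (\<Sum>k\<in>{0..<b}. (if i = k \<and> k < t then 1 else 0) * (if k = j \<and> j < u then 1 else 0))"
    using ij by (simp add: partial_id_def scalar_prod_def)
  also have "\<dots> = (\<Sum>k\<in>{0..<b}. if k = i then (if i < t \<and> i = j \<and> j < u then 1 else 0) else 0)"
    by (rule sum.cong) auto
  also have "\<dots> = (partial_id a c (min t u) :: 'a mat) $$ (i, j)"
    using ij assms by (auto simp: partial_id_def sum.delta)
  finally show "(partial_id a b t * partial_id b c u :: 'a mat) $$ (i, j) = (partial_id a c (min t u) :: 'a mat) $$ (i, j)" .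
qed auto

lemma partial_id_one [simp]: "partial_id n n n = 1\<^sub>m n"
  by (rule eq_matI) (auto simp: partial_id_def)

lemma partial_id_zero: "partial_id n m 0 = 0\<^sub>m n m"
  by (rule eq_matI) (auto simp: partial_id_def)

lemma J_mat_partial_id:
  assumes "r \<le> min m n"
  shows "J_mat m n r = partial_id n m r"
  unfolding J_mat_def partial_id_def by (rule eq_matI) (use assms in auto)

text \<open>A right inverse suffices: for square matrices over a field it is two-sided.\<close>

definition GL :: "nat \<Rightarrow> 'a::field mat set" where
  "GL n = {A \<in> carrier_mat n n. \<exists>B\<in>carrier_mat n n. A * B = 1\<^sub>m n}"

lemma GL_carrier: "A \<in> GL n \<Longrightarrow> A \<in> carrier_mat n n"
  by (simp add: GL_def)

lemma GL_E:
  assumes "A \<in> GL n"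
  obtains B where "B \<in> GL n" "dim_row A = n" "dim_col A = n" "dim_row B = n" "dim_col B = n"
    "A * B = 1\<^sub>m n" "B * A = 1\<^sub>m n"
proof -
  obtain B where B: "B \<in> carrier_mat n n" "A * B = 1\<^sub>m n" and A: "A \<in> carrier_mat n n"
    using assms by (auto simp: GL_def)
  have "B * A = 1\<^sub>m n" using mat_mult_left_right_inverse[OF A B] .
  then show ?thesis using that[of B] A B by (auto simp: GL_def)
qed

lemma GL_I: "A \<in> carrier_mat n n \<Longrightarrow> B \<in> carrier_mat n n \<Longrightarrow> A * B = 1\<^sub>m n \<Longrightarrow> A \<in> GL n"
  by (auto simp: GL_def)

lemma GL_I2: "A \<in> carrier_mat n n \<Longrightarrow> B \<in> carrier_mat n n \<Longrightarrow> B * A = 1\<^sub>m n \<Longrightarrow> A \<in> GL n"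
  using mat_mult_left_right_inverse by (blast intro: GL_I)

lemma GL_mult:
  assumes "A \<in> GL n" "B \<in> GL n"
  shows "A * B \<in> GL n"
proof -
  obtain A' where A: "dim_row A = n" "dim_col A = n" "dim_row A' = n" "dim_col A' = n" "A * A' = 1\<^sub>m n"
    using assms(1) by (rule GL_E)
  obtain B' where B: "dim_row B = n" "dim_col B = n" "dim_row B' = n" "dim_col B' = n" "B * B' = 1\<^sub>m n"
    using assms(2) by (rule GL_E)
  have "A * B * (B' * A') = 1\<^sub>m n"
    using A B by (simp add: mat_assoc mult_cancel_one[OF B(5)])
  then show ?thesis using A B by (intro GL_I[of _ _ "B' * A'"]) auto
qed

lemma one_GL: "1\<^sub>m n \<in> GL n"
  by (rule GL_I[of _ _ "1\<^sub>m n"]) auto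

lemma GL_det: "A \<in> GL n \<longleftrightarrow> A \<in> carrier_mat n n \<and> det A \<noteq> 0"
proof
  assume "A \<in> GL n"
  then obtain B where "A \<in> carrier_mat n n" "B \<in> carrier_mat n n" "A * B = 1\<^sub>m n"
    by (auto simp: GL_def)
  then show "A \<in> carrier_mat n n \<and> det A \<noteq> 0"
    using det_mult[of A n B] by auto
next
  assume A: "A \<in> carrier_mat n n \<and> det A \<noteq> 0"
  then have "A \<in> Units (ring_mat TYPE('a) n ())"
    using det_non_zero_imp_unit[of A n "()"] by auto
  then show "A \<in> GL n"
    by (auto simp: Units_def ring_mat_def GL_def)
qed

lemma swaprows_mat_GL: "k < n \<Longrightarrow> l < n \<Longrightarrow> swaprows_mat n k l \<in> GL n"
  by (rule GL_I[OF _ _ swaprows_mat_inv]) auto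

section \<open>Existence of the rank normal form by block elimination\<close>

definition one_plus :: "'a::field mat \<Rightarrow> 'a mat" where
  "one_plus A = four_block_mat (1\<^sub>m 1) (0\<^sub>m 1 (dim_col A)) (0\<^sub>m (dim_row A) 1) A"

lemma one_plus_dim [simp]: "dim_row (one_plus A) = Suc (dim_row A)" "dim_col (one_plus A) = Suc (dim_col A)"
  by (simp_all add: one_plus_def)

lemma one_plus_mult:
  assumes "dim_col A = dim_row B"
  shows "one_plus (A * B) = one_plus A * one_plus B"
  unfolding one_plus_def
  by (subst mult_four_block_mat[of _ 1 1 _ "dim_col A" _ "dim_row A"]) (use assms in auto)

lemma one_plus_one: "one_plus (1\<^sub>m n) = 1\<^sub>m (Suc n)"
  by (rule eq_matI) (auto simp: one_plus_def)

lemma one_plus_partial_id: "one_plus (partial_id n m t) = partial_id (Suc n) (Suc m) (Suc t)"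
  by (rule eq_matI) (auto simp: partial_id_def one_plus_def)

lemma one_plus_GL:
  assumes "A \<in> GL n"
  shows "one_plus A \<in> GL (Suc n)"
proof -
  obtain B where B: "dim_row A = n" "dim_col A = n" "dim_row B = n" "dim_col B = n" "A * B = 1\<^sub>m n"
    using assms by (rule GL_E)
  then have "one_plus A * one_plus B = 1\<^sub>m (Suc n)"
    using one_plus_mult[of A B] by (simp add: one_plus_one)
  then show ?thesis using B by (intro GL_I[where B = "one_plus B"]) auto
qed

text \<open>Block elimination with the top left entry a as pivot: D = d - c a^(-1) b is the Schur
  complement, S restores the first column, and T, with determinant a, carries the pivot row.\<close>

lemma block_normal_step:
  fixes B :: "'a::field mat"
  assumes B: "B \<in> carrier_mat (Suc n) (Suc m)" and B0: "B $$ (0, 0) \<noteq> 0"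
  obtains S T D where "S \<in> GL (Suc n)" "T \<in> GL (Suc m)" "D \<in> carrier_mat n m"
    "B = S * one_plus D * T"
proof -
  obtain a b c d where sp: "split_block B 1 1 = (a, b, c, d)" by (cases "split_block B 1 1")
  have ca: "a \<in> carrier_mat 1 1" "b \<in> carrier_mat 1 m" "c \<in> carrier_mat n 1" "d \<in> carrier_mat n m"
    and Beq: "B = four_block_mat a b c d"
    using split_block[OF sp, of n m] B by auto
  have a00: "a $$ (0,0) \<noteq> 0" using sp B B0 by (auto simp: split_block_def Let_def)
  define a' where "a' = mat 1 1 (\<lambda>_. 1 / a $$ (0,0))"
  have a': "a' \<in> carrier_mat 1 1" by (simp add: a'_def)
  have aa: "a' * a = 1\<^sub>m 1"
    by (rule eq_matI) (use ca a00 in \<open>auto simp: a'_def scalar_prod_def\<close>)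
  define D where "D = d - c * a' * b"
  have D: "D \<in> carrier_mat n m" using ca a' by (auto simp: D_def)
  define S where "S = four_block_mat (1\<^sub>m 1) (0\<^sub>m 1 n) (c * a') (1\<^sub>m n)"
  define T where "T = four_block_mat a b (0\<^sub>m m 1) (1\<^sub>m m)"
  have "det S = 1"
    unfolding S_def using ca a' by (subst det_four_block_mat_upper_right_zero[of _ 1 _ n]) auto
  then have S: "S \<in> GL (Suc n)"
    unfolding GL_det using four_block_carrier_mat[of "1\<^sub>m 1" 1 1 "1\<^sub>m n" n n] by (auto simp: S_def)
  have "det T = a $$ (0,0)"
    unfolding T_def using ca by (subst det_four_block_mat_lower_left_zero[of _ 1 _ m]) (auto simp: det_single)
  then have T: "T \<in> GL (Suc m)"
    unfolding GL_det using four_block_carrier_mat[of a 1 1 "1\<^sub>m m" m m] ca a00 by (auto simp: T_def)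
  have "S * one_plus D = four_block_mat (1\<^sub>m 1) (0\<^sub>m 1 m) (c * a') D"
    unfolding S_def one_plus_def using ca a' D by (subst mult_four_block_mat[of _ 1 1 _ n _ n]) auto
  also have "\<dots> * T = four_block_mat a b (c * a' * a) (c * a' * b + D)"
    unfolding T_def using ca a' D by (subst mult_four_block_mat[of _ 1 1 _ m _ n]) auto
  also have "c * a' * a = c" using ca a' aa by (simp add: mat_assoc)
  also have "c * a' * b + D = d" unfolding D_def using ca a' by (intro eq_matI) auto
  finally show ?thesis using that[OF S T D] Beq by simp
qed

text \<open>Row and column swaps move a nonzero entry to the corner, and the induction continues
  with the Schur complement. That t is the rank is a separate matter, settled by
  \<open>rank_partial_id_form\<close>.\<close>

lemma rank_normal_form_ex:
  fixes A :: "'a::field mat"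
  assumes "A \<in> carrier_mat n m"
  shows "\<exists>S\<in>GL n. \<exists>T\<in>GL m. \<exists>t\<le>min n m. A = S * partial_id n m t * T"
  using assms
proof (induction n arbitrary: m A)
  case 0
  then have "A = 1\<^sub>m 0 * partial_id 0 m 0 * 1\<^sub>m m" by (intro eq_matI) auto
  then show ?case using one_GL by blast
next
  case (Suc n)
  show ?case
  proof (cases "A = 0\<^sub>m (Suc n) m")
    case True
    then have "A = 1\<^sub>m (Suc n) * partial_id (Suc n) m 0 * 1\<^sub>m m" by (simp add: partial_id_zero mat_assoc)
    then show ?thesis using one_GL by (metis le0)
  next
    case False
    then obtain i j where ij: "i < Suc n" "j < m" "A $$ (i, j) \<noteq> 0"
      using Suc.prems by (metis eq_matI carrier_matD(1,2) index_zero_mat(1-3))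
    then obtain m' where m: "m = Suc m'" by (cases m) auto
    let ?P = "swaprows_mat (Suc n) 0 i :: 'a mat" and ?Q = "swaprows_mat m 0 j :: 'a mat"
    define B where "B = ?P * A * ?Q"
    have B: "B \<in> carrier_mat (Suc n) (Suc m')" using Suc.prems by (auto simp: B_def m)
    have "B = swapcols 0 j (swaprows 0 i A)"
      unfolding B_def using Suc.prems ij m
      by (subst swaprows_mat[symmetric, of _ "Suc n" m]) (auto intro!: swapcols_mat[symmetric, of _ "Suc n"])
    then have "B $$ (0,0) = A $$ (i, j)" using Suc.prems ij m by auto
    then obtain S T D where ST: "S \<in> GL (Suc n)" "T \<in> GL (Suc m')" and D: "D \<in> carrier_mat n m'"
      and Beq: "B = S * one_plus D * T"
      using block_normal_step[OF B] ij(3) by metis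
    obtain S' T' t where IH: "S' \<in> GL n" "T' \<in> GL m'" "t \<le> min n m'" "D = S' * partial_id n m' t * T'"
      using Suc.IH[OF D] by blast
    have c: "S' \<in> carrier_mat n n" "T' \<in> carrier_mat m' m'" "S \<in> carrier_mat (Suc n) (Suc n)"
       "T \<in> carrier_mat (Suc m') (Suc m')"
      using IH ST GL_carrier by auto
    have "one_plus D = one_plus S' * partial_id (Suc n) m (Suc t) * one_plus T'"
      using c IH(4) by (simp add: one_plus_mult one_plus_partial_id m)
    then have "B = (S * one_plus S') * partial_id (Suc n) m (Suc t) * (one_plus T' * T)"
      using Beq c by (simp add: mat_assoc m)
    moreover have PP: "?P * ?P = 1\<^sub>m (Suc n)" "?Q * ?Q = 1\<^sub>m m"
      using ij swaprows_mat_inv[of 0 "Suc n" i] swaprows_mat_inv[of 0 m j] by auto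
    moreover have dd: "dim_row ?P = Suc n" "dim_col ?P = Suc n" "dim_row ?Q = m" "dim_col ?Q = m"
      by (auto simp: swaprows_mat_def)
    moreover have "A = ?P * B * ?Q"
      unfolding B_def using Suc.prems dd PP
      by (simp add: mat_assoc mult_cancel_one[OF PP(1)])
    ultimately have "A = (?P * (S * one_plus S')) * partial_id (Suc n) m (Suc t) * ((one_plus T' * T) * ?Q)"
      using c by (simp add: mat_assoc m)
    moreover have "?P * (S * one_plus S') \<in> GL (Suc n)" "(one_plus T' * T) * ?Q \<in> GL m"
      using ST IH ij c m one_plus_GL[of S' n] one_plus_GL[of T' m']
      by (auto intro!: GL_mult swaprows_mat_GL)
    moreover have "Suc t \<le> min (Suc n) m" using IH m by auto
    ultimately show ?thesis by blast
  qed
qed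

section \<open>Rank by means of full-rank factorizations\<close>

lemma rank_left_invertible:
  fixes G C :: "'a::field mat"
  assumes G: "G \<in> carrier_mat n t" and C: "C \<in> carrier_mat t n" and CG: "C * G = 1\<^sub>m t"
  shows "vec_space.rank n G = t"
proof -
  interpret vec_space "TYPE('a)" n .
  have inj: "C *\<^sub>v (G *\<^sub>v v) = v" if "v \<in> carrier_vec t" for v
    using assoc_mult_mat_vec[OF C G that] CG that by simp
  \<comment> \<open>Linear independence speaks of the set of columns, which would not notice a
    repeated column.\<close>
  have "distinct (cols G)"
  proof (unfold distinct_conv_nth, intro allI impI)
    fix i j assume ij: "i < length (cols G)" "j < length (cols G)" "i \<noteq> j"
    then have b: "i < t" "j < t" using G by auto
    have "C *\<^sub>v col G k = unit_vec t k" if "k < t" for k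
      using col_mult2[OF C G that] CG that by simp
    then show "cols G ! i \<noteq> cols G ! j" using ij b G unit_vec_eq[of i t j] by (metis carrier_matD(2) cols_nth)
  qed
  moreover have "lin_indpt (set (cols G))"
  proof
    assume "lin_dep (set (cols G))"
    from lin_depE[OF G this \<open>distinct (cols G)\<close>] obtain v where
      v: "v \<in> carrier_vec t" "v \<noteq> 0\<^sub>v t" "G *\<^sub>v v = 0\<^sub>v n" .
    then show False using inj[of v] C by auto
  qed
  ultimately show ?thesis using lin_indpt_full_rank[OF G] by simp
qed

text \<open>The right inverse D makes H surjective, so G H and G have the same column space.\<close>

lemma rank_eq_inner_dim:
  fixes G H C D :: "'a::field mat"
  assumes G: "G \<in> carrier_mat n t" and H: "H \<in> carrier_mat t m"
    and C: "C \<in> carrier_mat t n" and D: "D \<in> carrier_mat m t"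
    and CG: "C * G = 1\<^sub>m t" and HD: "H * D = 1\<^sub>m t"
  shows "vec_space.rank n (G * H) = t"
proof -
  interpret vec_space "TYPE('a)" n .
  have GH: "G * H \<in> carrier_mat n m" using G H by auto
  have "(\<exists>x\<in>carrier_vec m. G * H *\<^sub>v x = y) \<longleftrightarrow> (\<exists>x\<in>carrier_vec t. G *\<^sub>v x = y)" for y
  proof
    assume "\<exists>x\<in>carrier_vec m. G * H *\<^sub>v x = y"
    then obtain x where x: "x \<in> carrier_vec m" "G * H *\<^sub>v x = y" by blast
    then have "G *\<^sub>v (H *\<^sub>v x) = y" "H *\<^sub>v x \<in> carrier_vec t"
      using assoc_mult_mat_vec[OF G H x(1)] H by auto
    then show "\<exists>x\<in>carrier_vec t. G *\<^sub>v x = y" by blast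
  next
    assume "\<exists>x\<in>carrier_vec t. G *\<^sub>v x = y"
    then obtain x where x: "x \<in> carrier_vec t" "G *\<^sub>v x = y" by blast
    have Dx: "D *\<^sub>v x \<in> carrier_vec m" using D x(1) by (rule mult_mat_vec_carrier)
    have "G * H *\<^sub>v (D *\<^sub>v x) = G *\<^sub>v (H *\<^sub>v (D *\<^sub>v x))" by (rule assoc_mult_mat_vec[OF G H Dx])
    also have "H *\<^sub>v (D *\<^sub>v x) = x" using assoc_mult_mat_vec[OF H D x(1)] HD x by simp
    finally show "\<exists>x\<in>carrier_vec m. G * H *\<^sub>v x = y" using Dx x(2) by blast
  qed
  then have "col_space (G * H) = col_space G"
    using G H by (simp add: col_space_eq[OF GH] col_space_eq[OF G])
  then have "rank (G * H) = rank G" unfolding rank_def col_space_def by simp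
  then show ?thesis using rank_left_invertible[OF G C CG] by simp
qed

text \<open>X has a right inverse, hence rank a, and the rank is at most the number b of
  columns.\<close>

lemma one_mult_dim_le:
  fixes X Y :: "'a::field mat"
  assumes "X \<in> carrier_mat a b" "Y \<in> carrier_mat b a" "X * Y = 1\<^sub>m a"
  shows "a \<le> b"
proof -
  have "vec_space.rank a (1\<^sub>m a * X) = a"
    by (rule rank_eq_inner_dim[where C = "1\<^sub>m a" and D = Y and m = b]) (use assms in auto)
  then show ?thesis using vec_space.rank_le_nc[OF assms(1)] assms(1) by simp
qed

text \<open>Splitting the partial identity at the inner dimension t gives a full-rank factorization.
  The one-sided inverses C and D are the form in which full rank is used from here on.\<close>

lemma partial_id_form_factor:
  fixes S T :: "'a::field mat"
  assumes "S \<in> GL n" "T \<in> GL m" "t \<le> min n m"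
  obtains G H C D where
    "dim_row G = n" "dim_col G = t" "dim_row H = t" "dim_col H = m"
    "dim_row C = t" "dim_col C = n" "dim_row D = m" "dim_col D = t"
    "S * partial_id n m t * T = G * H" "C * G = 1\<^sub>m t" "H * D = (1\<^sub>m t :: 'a mat)"
proof -
  obtain S' where S: "dim_row S = n" "dim_col S = n" "dim_row S' = n" "dim_col S' = n" "S' * S = 1\<^sub>m n"
    using assms(1) by (rule GL_E)
  obtain T' where T: "dim_row T = m" "dim_col T = m" "dim_row T' = m" "dim_col T' = m" "T * T' = 1\<^sub>m m"
    using assms(2) by (rule GL_E)
  have "partial_id n m t = partial_id n t t * (partial_id t m t :: 'a mat)" by (simp add: partial_id_mult)
  then have "S * partial_id n m t * T = (S * partial_id n t t) * (partial_id t m t * T)"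
    using S T by (simp add: mat_assoc)
  moreover have "(partial_id t n t * S') * (S * partial_id n t t) = 1\<^sub>m t"
    using S assms(3) by (simp add: mat_assoc mult_cancel_one[OF S(5)] partial_id_mult)
  moreover have "(partial_id t m t * T) * (T' * partial_id m t t) = 1\<^sub>m t"
    using T assms(3) by (simp add: mat_assoc mult_cancel_one[OF T(5)] partial_id_mult)
  ultimately show ?thesis
    using that[of "S * partial_id n t t" "partial_id t m t * T" "partial_id t n t * S'" "T' * partial_id m t t"] S T by simp
qed

lemma rank_partial_id_form:
  fixes S T :: "'a::field mat"
  assumes "S \<in> GL n" "T \<in> GL m" "t \<le> min n m"
  shows "vec_space.rank n (S * partial_id n m t * T) = t"
proof -
  obtain G H C D where f: "dim_row G = n" "dim_col G = t" "dim_row H = t" "dim_col H = m"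
    "dim_row C = t" "dim_col C = n" "dim_row D = m" "dim_col D = t"
    "S * partial_id n m t * T = G * H" "C * G = 1\<^sub>m t" "H * D = (1\<^sub>m t :: 'a mat)"
    using partial_id_form_factor[OF assms] .
  show ?thesis unfolding f(9)
    by (rule rank_eq_inner_dim[where C = C and D = D and m = m]) (use f in auto)
qed

lemma rank_normal_form:
  fixes A :: "'a::field mat"
  assumes "A \<in> carrier_mat n m"
  obtains S T where "S \<in> GL n" "T \<in> GL m" "vec_space.rank n A \<le> min n m"
    "A = S * partial_id n m (vec_space.rank n A) * T"
  using rank_normal_form_ex[OF assms] rank_partial_id_form by metis

lemma rank_factor:
  fixes A :: "'a::field mat"
  assumes "A \<in> carrier_mat n m" "vec_space.rank n A = t"
  obtains G H C D where
    "dim_row G = n" "dim_col G = t" "dim_row H = t" "dim_col H = m"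
    "dim_row C = t" "dim_col C = n" "dim_row D = m" "dim_col D = t"
    "A = G * H" "C * G = 1\<^sub>m t" "H * D = (1\<^sub>m t :: 'a mat)"
  using rank_normal_form[OF assms(1)] partial_id_form_factor assms(2) by metis

text \<open>If u is the rank of X A Y, one-sided inverses of its full-rank factors turn it into the
  identity of size u; a full-rank factorization of A writes this identity as a product through
  dimension t, so u is at most t.\<close>

lemma rank_mult_le:
  fixes A X Y :: "'a::field mat"
  assumes A: "A \<in> carrier_mat n m" and X: "X \<in> carrier_mat k n" and Y: "Y \<in> carrier_mat m l"
  shows "vec_space.rank k (X * A * Y) \<le> vec_space.rank n A"
proof -
  define t where "t = vec_space.rank n A"
  obtain G H where f: "dim_row G = n" "dim_col G = t" "dim_row H = t" "dim_col H = m" "A = G * H"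
    using rank_factor[OF A] t_def by metis
  define u where "u = vec_space.rank k (X * A * Y)"
  have B: "X * A * Y \<in> carrier_mat k l" using A X Y by auto
  obtain G' H' C D where g: "dim_row G' = k" "dim_col G' = u" "dim_row H' = u" "dim_col H' = l"
    "dim_row C = u" "dim_col C = k" "dim_row D = l" "dim_col D = u"
    "X * A * Y = G' * H'" "C * G' = 1\<^sub>m u" "H' * D = 1\<^sub>m u"
    using rank_factor[OF B] u_def by metis
  have "C * (X * A * Y) * D = 1\<^sub>m u"
    unfolding g(9) using g by (simp add: mat_assoc mult_cancel_one[OF g(10)])
  moreover have "C * (X * A * Y) * D = (C * X * G) * (H * Y * D)"
    unfolding f(5) using f(1-4) g(1-8) X Y by (simp add: mat_assoc)
  moreover have "C * X * G \<in> carrier_mat u t" "H * Y * D \<in> carrier_mat t u"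
    using f(1-4) g(1-8) X Y by auto
  ultimately have "u \<le> t" by (metis one_mult_dim_le)
  then show ?thesis by (simp add: u_def t_def)
qed

lemma rank_left_mult_le:
  fixes A X :: "'a::field mat"
  assumes "A \<in> carrier_mat n m" "X \<in> carrier_mat k n"
  shows "vec_space.rank k (X * A) \<le> vec_space.rank n A"
  using rank_mult_le[OF assms, of "1\<^sub>m m" m] assms by simp

lemma rank_right_mult_le:
  fixes A Y :: "'a::field mat"
  assumes "A \<in> carrier_mat n m" "Y \<in> carrier_mat m l"
  shows "vec_space.rank n (A * Y) \<le> vec_space.rank n A"
  using rank_mult_le[OF assms(1) one_carrier_mat assms(2)] assms by simp

lemma rank_le_row:
  fixes A :: "'a::field mat"
  assumes "A \<in> carrier_mat n m"
  shows "vec_space.rank n A \<le> n"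
  using rank_normal_form[OF assms] by (metis min.bounded_iff)

lemma full_rank_GL:
  fixes A :: "'a::field mat"
  assumes "A \<in> carrier_mat n n" "vec_space.rank n A \<ge> n"
  shows "A \<in> GL n"
  using assms vec_space.det_rank_iff[OF assms(1)] rank_le_row[OF assms(1)]
  by (simp add: GL_det)

text \<open>For a full-rank factorization A = G H with C G = 1 and H D = 1 take B = D C.\<close>

lemma generalized_inverse:
  fixes A :: "'a::field mat"
  assumes A: "A \<in> carrier_mat n m"
  obtains B where "B \<in> carrier_mat m n" "A * B * A = A"
proof -
  obtain G H C D where f: "dim_row G = n" "dim_col G = vec_space.rank n A"
    "dim_row H = vec_space.rank n A" "dim_col H = m"
    "dim_row C = vec_space.rank n A" "dim_col C = n" "dim_row D = m" "dim_col D = vec_space.rank n A"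
    "A = G * H" "C * G = 1\<^sub>m (vec_space.rank n A)" "H * D = (1\<^sub>m (vec_space.rank n A) :: 'a mat)"
    using rank_factor[OF A refl] .
  have "G * H * (D * C) * (G * H) = G * H"
    using f(1-8) by (simp add: mat_assoc mult_cancel_one[OF f(10)] mult_cancel_one[OF f(11)])
  then show ?thesis using that[of "D * C"] f(1-8) unfolding f(9)[symmetric] by (metis carrier_matI index_mult_mat(2,3))
qed

lemma equal_rank_equivalent:
  fixes A B :: "'a::field mat"
  assumes A: "A \<in> carrier_mat n m" and B: "B \<in> carrier_mat n m"
    and eq: "vec_space.rank n A = vec_space.rank n B"
  obtains S T where "S \<in> GL n" "T \<in> GL m" "B = S * A * T"
proof -
  define t where "t = vec_space.rank n B"
  obtain S T where ST: "S \<in> GL n" "T \<in> GL m" "A = S * partial_id n m t * T"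
    using rank_normal_form[OF A] eq t_def by metis
  obtain S' where S': "S' \<in> GL n" "dim_row S = n" "dim_col S = n" "dim_row S' = n" "dim_col S' = n" "S' * S = 1\<^sub>m n"
    using ST(1) by (rule GL_E)
  obtain T' where T': "T' \<in> GL m" "dim_row T = m" "dim_col T = m" "dim_row T' = m" "dim_col T' = m" "T * T' = 1\<^sub>m m"
    using ST(2) by (rule GL_E)
  obtain P Q where PQ: "P \<in> GL n" "Q \<in> GL m" "B = P * partial_id n m t * Q"
    using rank_normal_form[OF B] t_def by metis
  have d: "dim_row P = n" "dim_col P = n" "dim_row Q = m" "dim_col Q = m"
    using PQ GL_carrier by auto
  have "(P * S') * A * (T' * Q) = B"
    unfolding ST(3) PQ(3) using S'(2-5) T'(2-5) d
    by (simp add: mat_assoc mult_cancel_one[OF S'(6)] mult_cancel_one[OF T'(6)])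
  then show ?thesis using that[of "P * S'" "T' * Q"] S' T' PQ by (auto intro: GL_mult)
qed

lemma GL_dim: "A \<in> GL n \<Longrightarrow> dim_row A = n" "A \<in> GL n \<Longrightarrow> dim_col A = n"
  by (auto simp: GL_def)

section \<open>Singular matrices as products of idempotents\<close>

definition replace_col :: "nat \<Rightarrow> nat \<Rightarrow> 'a::field vec \<Rightarrow> 'a mat" where
  "replace_col n j x = mat n n (\<lambda>(a, b). if b = j then x $ a else if a = b then 1 else 0)"

lemma replace_col_dim [simp]: "dim_row (replace_col n j x) = n" "dim_col (replace_col n j x) = n"
  "replace_col n j x \<in> carrier_mat n n"
  by (auto simp: replace_col_def)

lemma replace_col_mult_index:
  assumes "j < n" "a < n" "b < dim_col A" "dim_row A = n"
  shows "(replace_col n j x * A) $$ (a, b) = (if a = j then 0 else A $$ (a, b)) + x $ a * A $$ (j, b)"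
proof -
  have "(replace_col n j x * A) $$ (a, b)
      = (\<Sum>k\<in>{0..<n}. (if k = j then x $ a else if a = k then 1 else 0) * A $$ (k, b))"
    using assms by (simp add: replace_col_def scalar_prod_def)
  also have "\<dots> = (\<Sum>k\<in>{0..<n}. (if k = a then (if a = j then 0 else A $$ (a, b)) else 0)
      + (if k = j then x $ a * A $$ (j, b) else 0))"
    by (rule sum.cong) auto
  also have "\<dots> = (if a = j then 0 else A $$ (a, b)) + x $ a * A $$ (j, b)"
    using assms by (simp add: sum.distrib sum.delta)
  finally show ?thesis .
qed

text \<open>For x with nonzero j-th entry, left multiplication scales row j and adds multiples of it
  to the other rows. The inverse operation has the same form, so elimination never leaves this one
  family of matrices.\<close>

lemma replace_col_inverse:
  fixes x :: "'a::field vec"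
  assumes "j < n" "x $ j \<noteq> 0"
  obtains x' where "x' $ j \<noteq> 0" "replace_col n j x * replace_col n j x' = 1\<^sub>m n"
    "replace_col n j x' * replace_col n j x = 1\<^sub>m n"
proof -
  define x' where "x' = vec n (\<lambda>a. if a = j then 1 / x $ j else - x $ a / x $ j)"
  have "replace_col n j x * replace_col n j x' = 1\<^sub>m n"
  proof (rule eq_matI)
    fix a b assume "a < dim_row (1\<^sub>m n :: 'a mat)" "b < dim_col (1\<^sub>m n :: 'a mat)"
    then show "(replace_col n j x * replace_col n j x') $$ (a, b) = 1\<^sub>m n $$ (a, b)"
      using assms by (subst replace_col_mult_index) (auto simp: replace_col_def x'_def)
  qed auto
  moreover have "replace_col n j x' * replace_col n j x = 1\<^sub>m n"
    by (rule mat_mult_left_right_inverse[OF _ _ calculation]) auto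
  moreover have "x' $ j \<noteq> 0" using assms by (simp add: x'_def)
  ultimately show ?thesis using that by blast
qed

text \<open>Words in the elementary matrices, growing on the left. Induction over them transports
  idempotent products from the partial identity to its left multiples by invertible
  matrices.\<close>

inductive_set col_products :: "nat \<Rightarrow> 'a::field mat set" for n where
  one: "1\<^sub>m n \<in> col_products n"
| step: "X \<in> col_products n \<Longrightarrow> j < n \<Longrightarrow> x $ j \<noteq> 0 \<Longrightarrow> replace_col n j x * X \<in> col_products n"

text \<open>Gauss elimination: the first k columns are already reduced.\<close>

lemma GL_col_products_aux:
  fixes X :: "'a::field mat"
  assumes "k \<le> n" "X \<in> GL n" "\<And>a b. b < k \<Longrightarrow> a < n \<Longrightarrow> X $$ (a, b) = (if a = b then 1 else 0)"
  shows "X \<in> col_products n"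
  using assms
proof (induction k arbitrary: X rule: inc_induct)
  case base
  then have "X = 1\<^sub>m n" using GL_carrier[of X n] by (intro eq_matI) auto
  then show ?case using col_products.one by simp
next
  case (step k)
  \<comment> \<open>With a nonzero pivot, the matrix that replaces column k by
    \<open>col X k\<close> is invertible and takes the k-th unit vector to that column, so its
    inverse turns the column into a unit vector.\<close>
  have pivot: "X \<in> col_products n"
    if X: "X \<in> GL n" "\<And>a b. b < k \<Longrightarrow> a < n \<Longrightarrow> X $$ (a, b) = (if a = b then 1 else 0)"
      and nz: "X $$ (k, k) \<noteq> 0" for X :: "'a mat"
  proof -
    have d: "dim_row X = n" "dim_col X = n" using X(1) by (simp_all add: GL_dim)
    have kn: "k < n" "(col X k) $ k \<noteq> 0" using step.hyps nz d by auto
    obtain x' where x': "x' $ k \<noteq> 0" "replace_col n k (col X k) * replace_col n k x' = 1\<^sub>m n"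
        "replace_col n k x' * replace_col n k (col X k) = 1\<^sub>m n"
      using replace_col_inverse[OF kn] .
    let ?Y = "replace_col n k x' * X"
    have "?Y $$ (a, b) = (if a = b then 1 else 0)" if "b < Suc k" "a < n" for a b
    proof (cases "b = k")
      case True
      have "?Y $$ (a, b) = (replace_col n k x' * replace_col n k (col X k)) $$ (a, b)"
        using True that kn d
          replace_col_mult_index[of k n a k X x'] replace_col_mult_index[of k n a k "replace_col n k (col X k)" x']
        by (simp del: index_mult_mat(1)) (simp add: replace_col_def)
      then show ?thesis unfolding x'(3) using True that kn by simp
    next
      \<comment> \<open>An earlier column is a unit vector with a zero in row k, and only multiples
        of row k are added.\<close>
      case False
      then have "b < k" using that by simp
      then show ?thesis using that kn d X by (simp add: replace_col_mult_index del: index_mult_mat(1))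
    qed
    moreover have "?Y \<in> GL n"
      by (rule GL_mult[OF _ X(1)]) (rule GL_I[OF _ _ x'(3)]; simp)
    ultimately have "?Y \<in> col_products n" using step.IH by blast
    then have "replace_col n k (col X k) * ?Y \<in> col_products n" using kn by (rule col_products.step)
    then show ?thesis using d by (simp add: mult_cancel_one[OF x'(2)])
  qed
  show ?case
  proof (cases "X $$ (k, k) = 0")
    case False
    then show ?thesis using pivot step.prems by blast
  next
    case True
    have d: "dim_row X = n" "dim_col X = n" using step.prems(1) by (simp_all add: GL_dim)
    have "\<exists>i<n. i > k \<and> X $$ (i, k) \<noteq> 0"
    proof (rule ccontr)
      assume "\<not> (\<exists>i<n. i > k \<and> X $$ (i, k) \<noteq> 0)"
      with True have z: "X $$ (i, k) = 0" if "k \<le> i" "i < n" for i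
        using that by (cases "i = k") auto
      \<comment> \<open>The columns before k are unit vectors. If column k vanishes from row k on,
        it is their combination with its own entries as coefficients; v records this
        dependence.\<close>
      define v where "v = vec n (\<lambda>a. if a < k then X $$ (a, k) else if a = k then - 1 else 0)"
      have "X *\<^sub>v v = 0\<^sub>v n"
      proof (rule eq_vecI)
        fix b assume "b < dim_vec (0\<^sub>v n :: 'a vec)"
        then have b: "b < n" by simp
        have "(X *\<^sub>v v) $ b = (\<Sum>a\<in>{0..<n}. X $$ (b, a) * v $ a)"
          using b d by (simp add: scalar_prod_def v_def)
        also have "\<dots> = (\<Sum>a\<in>{0..<n}. (if a = b then (if b < k then X $$ (b, k) else 0) else 0)
            + (if a = k then - X $$ (b, k) else 0))"
          using step.prems b step.hyps by (intro sum.cong) (auto simp: v_def)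
        also have "\<dots> = 0" using b step.hyps z by (simp add: sum.distrib sum.delta)
        finally show "(X *\<^sub>v v) $ b = 0\<^sub>v n $ b" using b by simp
      qed (use d in simp)
      moreover have "v \<noteq> 0\<^sub>v n"
      proof
        assume "v = 0\<^sub>v n"
        then have "v $ k = 0" using step.hyps by simp
        then show False using step.hyps by (simp add: v_def)
      qed
      moreover have "v \<in> carrier_vec n" by (simp add: v_def)
      ultimately have "det X = 0"
        using det_0_iff_vec_prod_zero_field[of X n] step.prems GL_carrier by blast
      then show False using step.prems GL_det by blast
    qed
    then obtain i where i: "i < n" "k < i" "X $$ (i, k) \<noteq> 0" by blast
    \<comment> \<open>Left multiplication by \<open>replace_col n i x\<close> adds row i to row k,
      which makes the entry (k, k) equal to the nonzero entry (i, k).\<close>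
    define x where "x = unit_vec n i + (unit_vec n k :: 'a vec)"
    have "x $ i \<noteq> 0" using i step.hyps by (simp add: x_def)
    obtain x' where x': "x' $ i \<noteq> 0" "replace_col n i x * replace_col n i x' = 1\<^sub>m n"
        "replace_col n i x' * replace_col n i x = 1\<^sub>m n"
      using replace_col_inverse[OF i(1) \<open>x $ i \<noteq> 0\<close>] .
    have "replace_col n i x * X \<in> col_products n"
    proof (rule pivot)
      show "replace_col n i x * X \<in> GL n"
        by (rule GL_mult[OF _ step.prems(1)]) (rule GL_I[OF _ _ x'(2)]; simp)
      show "(replace_col n i x * X) $$ (a, b) = (if a = b then 1 else 0)" if "b < k" "a < n" for a b
        using that i d step by (simp add: replace_col_mult_index del: index_mult_mat(1))
      show "(replace_col n i x * X) $$ (k, k) \<noteq> 0"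
        using True i d step.hyps by (simp add: replace_col_mult_index x_def del: index_mult_mat(1))
    qed
    then have "replace_col n i x' * (replace_col n i x * X) \<in> col_products n" using i(1) x'(1) by (rule col_products.step)
    then show ?thesis using d by (simp add: mult_cancel_one[OF x'(3)])
  qed
qed

lemma GL_col_products: "X \<in> GL n \<Longrightarrow> X \<in> col_products n"
  using GL_col_products_aux[of 0] by simp

section \<open>Matrices of partial maps on indices, whose products are decided by composing the
  maps\<close>

definition partial_map_mat :: "nat \<Rightarrow> (nat \<Rightarrow> nat option) \<Rightarrow> 'a::field mat" where
  "partial_map_mat n \<phi> = mat n n (\<lambda>(a, b). if \<phi> b = Some a then 1 else 0)"

lemma partial_map_mat_dim [simp]: "dim_row (partial_map_mat n \<phi>) = n" "dim_col (partial_map_mat n \<phi>) = n"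
  "partial_map_mat n \<phi> \<in> carrier_mat n n"
  by (auto simp: partial_map_mat_def)

lemma mult_partial_map_mat_index:
  fixes A :: "'a::field mat"
  assumes "a < dim_row A" "b < n" "dim_col A = n" "\<And>c. \<phi> b = Some c \<Longrightarrow> c < n"
  shows "(A * partial_map_mat n \<phi>) $$ (a, b) = (case \<phi> b of None \<Rightarrow> 0 | Some c \<Rightarrow> A $$ (a, c))"
proof -
  have "(A * partial_map_mat n \<phi>) $$ (a, b) = (\<Sum>k\<in>{0..<n}. A $$ (a, k) * (if \<phi> b = Some k then 1 else 0))"
    using assms by (simp add: partial_map_mat_def scalar_prod_def)
  also have "\<dots> = (case \<phi> b of None \<Rightarrow> 0 | Some c \<Rightarrow> A $$ (a, c))"
  proof (cases "\<phi> b")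
    case (Some c)
    then have "(\<Sum>k\<in>{0..<n}. A $$ (a, k) * (if \<phi> b = Some k then 1 else 0))
        = (\<Sum>k\<in>{0..<n}. if k = c then A $$ (a, c) else 0)"
      by (intro sum.cong) auto
    then show ?thesis using Some assms(4) by (simp add: sum.delta)
  qed simp
  finally show ?thesis .
qed

lemma partial_map_mat_mult:
  assumes "\<And>b c. b < n \<Longrightarrow> \<psi> b = Some c \<Longrightarrow> c < n"
  shows "partial_map_mat n \<phi> * partial_map_mat n \<psi> = (partial_map_mat n (\<phi> \<circ>\<^sub>m \<psi>) :: 'a::field mat)"
proof (rule eq_matI)
  fix a b assume "a < dim_row (partial_map_mat n (\<phi> \<circ>\<^sub>m \<psi>) :: 'a mat)" "b < dim_col (partial_map_mat n (\<phi> \<circ>\<^sub>m \<psi>) :: 'a mat)"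
  then have "a < n" "b < n" by auto
  then show "(partial_map_mat n \<phi> * partial_map_mat n \<psi> :: 'a mat) $$ (a, b) = partial_map_mat n (\<phi> \<circ>\<^sub>m \<psi>) $$ (a, b)"
    using assms by (subst mult_partial_map_mat_index) (auto simp: partial_map_mat_def map_comp_def split: option.split)
qed auto

lemma partial_id_partial_map_mat: "partial_id n n s = partial_map_mat n (\<lambda>b. if b < s then Some b else None)"
  unfolding partial_id_def partial_map_mat_def by (rule cong_mat) (simp_all split: if_split)

lemma partial_map_mat_cong: "(\<And>b. b < n \<Longrightarrow> \<phi> b = \<psi> b) \<Longrightarrow> partial_map_mat n \<phi> = partial_map_mat n \<psi>"
  by (rule eq_matI) (auto simp: partial_map_mat_def)

text \<open>The map never takes the value j, so the replaced column has no influence on the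
  product.\<close>

lemma replace_col_mult_partial_map_mat:
  fixes x :: "'a::field vec"
  assumes "\<And>b c. b < n \<Longrightarrow> \<phi> b = Some c \<Longrightarrow> c < n \<and> c \<noteq> j"
  shows "replace_col n j x * partial_map_mat n \<phi> = partial_map_mat n \<phi>"
proof (rule eq_matI)
  fix a b assume "a < dim_row (partial_map_mat n \<phi> :: 'a mat)" "b < dim_col (partial_map_mat n \<phi> :: 'a mat)"
  then have "a < n" "b < n" by auto
  then show "(replace_col n j x * partial_map_mat n \<phi>) $$ (a, b) = partial_map_mat n \<phi> $$ (a, b)"
    using assms by (subst mult_partial_map_mat_index) (auto simp: partial_map_mat_def replace_col_def split: option.split)
qed auto

lemma rank_eqI:
  fixes A B :: "'a::field mat"
  assumes "A \<in> carrier_mat n n" "B \<in> carrier_mat n n"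
    "X \<in> carrier_mat n n" "Y \<in> carrier_mat n n" "X' \<in> carrier_mat n n" "Y' \<in> carrier_mat n n"
    "A = X * B * Y" "B = X' * A * Y'"
  shows "vec_space.rank n A = vec_space.rank n B"
  using rank_mult_le[OF assms(1,5,6)] rank_mult_le[OF assms(2,3,4)]
  unfolding assms(7,8)[symmetric] by simp

lemma rank_partial_id: "s \<le> n \<Longrightarrow> vec_space.rank n (partial_id n n s :: 'a::field mat) = s"
  using rank_partial_id_form[OF one_GL one_GL, of s n n] by (simp add: mat_assoc)

section \<open>Singular matrices generated by idempotents of one rank\<close>

definition rank_idem :: "nat \<Rightarrow> nat \<Rightarrow> 'a::field mat set" where
  "rank_idem n s = {E \<in> carrier_mat n n. E * E = E \<and> vec_space.rank n E = s}"

lemma sg_generated_carrier: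
  "A \<in> sg_generated (*) (rank_idem n s) \<Longrightarrow> A \<in> carrier_mat n n"
proof (induction rule: sg_generated.induct)
  case (base E)
  then show ?case by (simp add: rank_idem_def)
next
  case (mult A B)
  show ?case using mult.IH(1) mult.IH(2) by (rule mult_carrier_mat)
qed

text \<open>Conjugation is multiplicative and preserves idempotency and rank. It is the only way in
  which invertible matrices, themselves outside the generated semigroup when s < n, can be brought
  into play.\<close>

lemma sg_generated_conj:
  fixes X X' :: "'a::field mat"
  assumes "A \<in> sg_generated (*) (rank_idem n s)"
    and X: "X \<in> carrier_mat n n" "X' \<in> carrier_mat n n" "X' * X = 1\<^sub>m n"
  shows "X * A * X' \<in> sg_generated (*) (rank_idem n s)"
  using assms(1)
proof induction
  case (base E)
  have d: "dim_row X = n" "dim_col X = n" "dim_row X' = n" "dim_col X' = n"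
    "dim_row E = n" "dim_col E = n" and e: "E * E = E" "vec_space.rank n E = s"
    using base X by (auto simp: rank_idem_def)
  have ee: "E * (E * Y) = E * Y" if "dim_row Y = n" for Y
    using mult_assoc_dim[of E E Y] d e that by simp
  have "(X * E * X') * (X * E * X') = X * E * X'"
    using d by (simp add: mat_assoc mult_cancel_one[OF X(3)] ee)
  moreover have XEX: "X * E * X' \<in> carrier_mat n n" using d by (intro carrier_matI) simp_all
  moreover have "vec_space.rank n (X * E * X') = vec_space.rank n E"
  proof (rule rank_eqI[OF XEX _ X(1,2,2,1) refl])
    show "E = X' * (X * E * X') * X"
      using d by (simp add: mat_assoc mult_cancel_one[OF X(3)] X(3))
  qed (use d in \<open>intro carrier_matI; simp\<close>)
  then have "vec_space.rank n (X * E * X') = s" by (simp only: e)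
  ultimately show ?case by (intro sg_generated.base) (simp add: rank_idem_def)
next
  case (mult A B)
  have d: "dim_row X = n" "dim_col X = n" "dim_row X' = n" "dim_col X' = n"
    "dim_row A = n" "dim_col A = n" "dim_row B = n" "dim_col B = n"
    using X mult.hyps[THEN sg_generated_carrier] by simp_all
  have "X * (A * B) * X' = (X * A * X') * (X * B * X')"
    using d by (simp add: mat_assoc mult_cancel_one[OF X(3)])
  then show ?case using mult.IH by (simp add: sg_generated.mult)
qed

text \<open>The image of column j is first moved out of the span of the other columns, to the s-th
  unit vector (this needs s < n), and from there to its destination x.\<close>

lemma replace_col_mult_partial_id_generated:
  fixes x :: "'a::field vec"
  assumes s: "s < n" and j: "j < n" "x $ j \<noteq> 0"
  shows "replace_col n j x * partial_id n n s \<in> sg_generated (*) (rank_idem n s)"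
proof -
  let ?e = "partial_id n n s :: 'a mat"
  have ee: "?e * ?e = ?e" using s by (simp add: partial_id_mult)
  have e: "?e \<in> rank_idem n s"
    using s ee by (simp add: rank_idem_def rank_partial_id)
  show ?thesis
  proof (cases "j < s")
    case False
    then have "replace_col n j x * ?e = ?e"
      unfolding partial_id_partial_map_mat using s by (intro replace_col_mult_partial_map_mat) (auto split: if_splits)
    then show ?thesis using e sg_generated.base by metis
  next
    case True
    \<comment> \<open>Both are idempotent partial maps fixing the indices below s other than j: h
      fixes j and sends s to j, g fixes s and sends j to s. Hence h undoes g on the image of
      \<open>?e\<close>.\<close>
    define h where "h = (partial_map_mat n (\<lambda>b. if b < s then Some b else if b = s then Some j else None) :: 'a mat)"
    define g where "g = (partial_map_mat n (\<lambda>b. if b = j \<or> b = s then Some s else if b < s then Some b else None) :: 'a mat)"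
    have [simp]: "dim_row h = n" "dim_col h = n" "dim_row g = n" "dim_col g = n"
      "h \<in> carrier_mat n n" "g \<in> carrier_mat n n"
      by (auto simp: h_def g_def)
    have hh: "h * h = h" "h * ?e = ?e" "?e * h = h"
      unfolding h_def partial_id_partial_map_mat using s True j
      by (subst partial_map_mat_mult; auto simp: map_comp_def split: if_splits intro!: partial_map_mat_cong)+
    have gg: "g * g = g" "h * (g * ?e) = ?e"
      unfolding h_def g_def partial_id_partial_map_mat using s True j
      by ((subst partial_map_mat_mult)+; auto simp: map_comp_def split: if_splits intro!: partial_map_mat_cong)+
    have "vec_space.rank n h = vec_space.rank n ?e"
      using hh ee by (intro rank_eqI[of _ _ _ ?e h "1\<^sub>m n" ?e]) (auto simp: mat_assoc)
    then have h: "h \<in> rank_idem n s" using hh s by (simp add: rank_idem_def rank_partial_id)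
    have "g = partial_map_mat n (\<lambda>b. if b = j then Some s else Some b) * ?e
        * partial_map_mat n (\<lambda>b. if b = s then Some j else if b < s then Some b else None)"
      unfolding g_def partial_id_partial_map_mat using s True j
      by (subst partial_map_mat_mult; auto simp: map_comp_def split: if_splits intro!: partial_map_mat_cong)+
    moreover have "?e = partial_map_mat n (\<lambda>b. if b = s then Some j else Some b) * g * ?e"
      unfolding g_def partial_id_partial_map_mat using s True j
      by (subst partial_map_mat_mult; auto simp: map_comp_def split: if_splits intro!: partial_map_mat_cong)+
    ultimately have "vec_space.rank n g = vec_space.rank n ?e"
      by (rule rank_eqI[rotated 6]) simp_all
    then have g: "g \<in> rank_idem n s" using gg s by (simp add: rank_idem_def rank_partial_id)
    obtain x' where x': "x' $ j \<noteq> 0" "replace_col n j x * replace_col n j x' = 1\<^sub>m n"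
        "replace_col n j x' * replace_col n j x = 1\<^sub>m n"
      using replace_col_inverse[OF j] .
    \<comment> \<open>Writing R for the replacement matrix, its inverse fixes g e because the image
      of g e avoids the j-th unit vector. So the conjugate of h by R, applied to g e, yields R h g e
      = R e.\<close>
    have "replace_col n j x' * (g * ?e) = g * ?e"
    proof -
      have ge: "g * ?e = partial_map_mat n (\<lambda>b. if b < s then if b = j then Some s else Some b else None)"
        unfolding g_def partial_id_partial_map_mat using s True j
        by (subst partial_map_mat_mult; auto simp: map_comp_def split: if_splits intro!: partial_map_mat_cong)
      show ?thesis unfolding ge
        using s True by (intro replace_col_mult_partial_map_mat) (auto split: if_splits)
    qed
    then have "(replace_col n j x * h * replace_col n j x') * (g * ?e) = replace_col n j x * ?e"
      using gg by (simp add: mat_assoc)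
    moreover have "replace_col n j x * h * replace_col n j x' \<in> sg_generated (*) (rank_idem n s)"
      using sg_generated_conj[OF sg_generated.base[OF h]] x'(3) by simp
    moreover have "g * ?e \<in> sg_generated (*) (rank_idem n s)"
      using g e by (intro sg_generated.mult sg_generated.base)
    ultimately show ?thesis using sg_generated.mult by metis
  qed
qed

text \<open>Let e be the partial identity of rank s. If X e is generated and R is a column
  replacement, then (R (X e) R^(-1)) (R e) = R X e is generated as well, so S e is generated for all
  invertible S. A matrix S e T is the conjugate of T S e by the inverse of T.\<close>

lemma rank_eq_generated:
  fixes A :: "'a::field mat"
  assumes s: "s < n" and A: "A \<in> carrier_mat n n" "vec_space.rank n A = s"
  shows "A \<in> sg_generated (*) (rank_idem n s)"
proof -
  let ?e = "partial_id n n s :: 'a mat" and ?T = "sg_generated (*) (rank_idem n s) :: 'a mat set"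
  have ee: "?e * ?e = ?e" using s by (simp add: partial_id_mult)
  have left: "S * ?e \<in> ?T" if "S \<in> col_products n" for S
    using that
  proof induction
    case one
    have "?e \<in> rank_idem n s" using s ee by (simp add: rank_idem_def rank_partial_id)
    then show ?case using sg_generated.base by (simp add: mat_assoc)
  next
    case (step X j x)
    obtain x' where x': "replace_col n j x' * replace_col n j x = 1\<^sub>m n"
      using replace_col_inverse[OF step.hyps(2,3)] by metis
    have d: "dim_row X = n" "dim_col X = n"
      using step.hyps(1) by (induction) auto
    have "replace_col n j x * (X * ?e) * replace_col n j x' \<in> ?T"
      using sg_generated_conj[OF step.IH] x' by simp
    then have "(replace_col n j x * (X * ?e) * replace_col n j x') * (replace_col n j x * ?e) \<in> ?T"
      using replace_col_mult_partial_id_generated[OF s step.hyps(2,3)] by (rule sg_generated.mult)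
    also have "(replace_col n j x * (X * ?e) * replace_col n j x') * (replace_col n j x * ?e) = replace_col n j x * X * ?e"
      using d by (simp add: mat_assoc mult_cancel_one[OF x'] ee)
    finally show ?case .
  qed
  obtain S T where ST: "S \<in> GL n" "T \<in> GL n" "A = S * ?e * T"
    using rank_normal_form[OF A(1)] A(2) by metis
  obtain T' where T': "T' \<in> GL n" "dim_row T = n" "dim_col T = n" "dim_row T' = n" "dim_col T' = n" "T * T' = 1\<^sub>m n" "T' * T = 1\<^sub>m n"
    using ST(2) by (rule GL_E)
  have d: "dim_row S = n" "dim_col S = n" using ST(1,2) by (simp_all add: GL_dim)
  have "T * S * ?e \<in> ?T" using left GL_col_products GL_mult ST by metis
  then have "T' * (T * S * ?e) * T \<in> ?T" using sg_generated_conj T'(1,6) ST(2) GL_carrier by metis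
  also have "T' * (T * S * ?e) * T = A"
    unfolding ST(3) using T' d by (simp add: mat_assoc mult_cancel_one[OF T'(7)])
  finally show ?thesis .
qed

text \<open>Descending induction on the rank t: below s, a matrix of rank t is a product of two
  matrices of rank t + 1.\<close>

theorem rank_le_generated:
  fixes A :: "'a::field mat"
  assumes s: "s < n" and A: "A \<in> carrier_mat n n" "vec_space.rank n A \<le> s"
  shows "A \<in> sg_generated (*) (rank_idem n s)"
proof -
  let ?T = "sg_generated (*) (rank_idem n s) :: 'a mat set"
  have "\<forall>A\<in>carrier_mat n n. vec_space.rank n A = t \<longrightarrow> A \<in> ?T" if "t \<le> s" for t
    using that
  proof (induction t rule: inc_induct)
    case base
    then show ?case using rank_eq_generated[OF s] by blast
  next
    case (step t)
    show ?case
    proof (intro ballI impI)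
      fix A :: "'a mat" assume A: "A \<in> carrier_mat n n" "vec_space.rank n A = t"
      obtain S T where ST: "S \<in> GL n" "T \<in> GL n" "A = S * partial_id n n t * T"
        using rank_normal_form[OF A(1)] A(2) by metis
      have d: "dim_row S = n" "dim_col S = n" "dim_row T = n" "dim_col T = n" using ST(1,2) by (simp_all add: GL_dim)
      \<comment> \<open>N fixes the indices below t and moves t to t + 1, where the partial identity
        of rank t + 1 kills it; M moves it back, which shows that N has rank t + 1. The index t + 1
        exists because t < s < n.\<close>
      define N where "N = (partial_map_mat n (\<lambda>b. if b < t then Some b else if b = t then Some (Suc t) else None) :: 'a mat)"
      define M where "M = (partial_map_mat n (\<lambda>b. if b = Suc t then Some t else if b < t then Some b else None) :: 'a mat)"
      have [simp]: "dim_row N = n" "dim_col N = n" "dim_row M = n" "dim_col M = n"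
        "N \<in> carrier_mat n n" "M \<in> carrier_mat n n"
        by (auto simp: N_def M_def)
      have t: "Suc t < n" using step.hyps s by simp
      have eN: "partial_id n n t = partial_id n n (Suc t) * N" and NN: "N = N * partial_id n n (Suc t)" and MN: "partial_id n n (Suc t) = M * N"
        unfolding N_def M_def partial_id_partial_map_mat using t
        by (subst partial_map_mat_mult; auto simp: map_comp_def split: if_splits intro!: partial_map_mat_cong)+
      obtain T' where T': "T' \<in> GL n" "dim_row T' = n" "dim_col T' = n" "T * T' = 1\<^sub>m n"
        using ST(2) by (rule GL_E)
      have "vec_space.rank n (N * T) = vec_space.rank n (partial_id n n (Suc t) :: 'a mat)"
      proof (rule rank_eqI[of _ _ _ N T M T'])
        show "N * T = N * partial_id n n (Suc t) * T" using NN by metis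
        show "partial_id n n (Suc t) = M * (N * T) * T'"
          using T' d MN by (simp add: mat_assoc)
      qed (use d T' in auto)
      then have "vec_space.rank n (N * T) = Suc t" using t by (simp add: rank_partial_id)
      moreover have "N * T \<in> carrier_mat n n" using d by (intro carrier_matI) simp_all
      ultimately have "N * T \<in> ?T" using step.IH by simp
      moreover have "S * partial_id n n (Suc t) * 1\<^sub>m n \<in> ?T"
      proof -
        have "S * partial_id n n (Suc t) * 1\<^sub>m n \<in> carrier_mat n n" using d by (intro carrier_matI) simp_all
        then show ?thesis using step.IH rank_partial_id_form[OF ST(1) one_GL, of "Suc t"] t by auto
      qed
      ultimately have "(S * partial_id n n (Suc t) * 1\<^sub>m n) * (N * T) \<in> ?T" by (metis sg_generated.mult)
      also have "(S * partial_id n n (Suc t) * 1\<^sub>m n) * (N * T) = A"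
        unfolding ST(3) eN using d by (simp add: mat_assoc)
      finally show "A \<in> ?T" .
    qed
  qed
  from this[OF A(2)] A(1) show ?thesis by simp
qed

lemma mult_add_minus_distrib:
  fixes A :: "'a::ring mat"
  assumes "A \<in> carrier_mat p q" "B \<in> carrier_mat q t" "C \<in> carrier_mat q t" "D \<in> carrier_mat q t"
  shows "A * (B + (C - D)) = A * B + (A * C - A * D)"
proof -
  have "C - D \<in> carrier_mat q t" using assms by auto
  then show ?thesis
    using mult_add_distrib_mat[OF assms(1,2)] mult_minus_distrib_mat[OF assms(1,3,4)] by simp
qed

lemma add_minus_mult_distrib:
  fixes A :: "'a::ring mat"
  assumes "B \<in> carrier_mat p q" "C \<in> carrier_mat p q" "D \<in> carrier_mat p q" "A \<in> carrier_mat q t"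
  shows "(B + (C - D)) * A = B * A + (C * A - D * A)"
proof -
  have "C - D \<in> carrier_mat p q" using assms by auto
  then show ?thesis
    using add_mult_distrib_mat[OF assms(1) _ assms(4)] minus_mult_distrib_mat[OF assms(2,3,4)] by simp
qed

section \<open>The regular elements of the sandwich semigroup\<close>

locale sandwich_dims =
  fixes m n r :: nat
  assumes r_le: "r \<le> m" "r \<le> n"
begin

abbreviation star :: "'a::field mat \<Rightarrow> 'a mat \<Rightarrow> 'a mat" (infixl "\<star>" 70) where
  "X \<star> Y \<equiv> sandwich m n r X Y"

abbreviation U :: "'a::field mat" where "U \<equiv> partial_id n r r"
abbreviation V :: "'a::field mat" where "V \<equiv> partial_id r m r"

text \<open>The matrices with an identity block on top, respectively on the left: \<open>V\<close> and \<open>U\<close> satisfy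
  J = U V and cut out these blocks.\<close>

definition top_unit :: "'a::field mat set" where
  "top_unit = {K \<in> carrier_mat m r. V * K = 1\<^sub>m r}"

definition left_unit :: "'a::field mat set" where
  "left_unit = {L \<in> carrier_mat r n. L * U = 1\<^sub>m r}"

lemma top_unit_dim: "K \<in> top_unit \<Longrightarrow> dim_row K = m" "K \<in> top_unit \<Longrightarrow> dim_col K = r"
  by (auto simp: top_unit_def)

lemma left_unit_dim: "L \<in> left_unit \<Longrightarrow> dim_row L = r" "L \<in> left_unit \<Longrightarrow> dim_col L = n"
  by (auto simp: left_unit_def)

lemma VK: "K \<in> top_unit \<Longrightarrow> V * K = 1\<^sub>m r"
  by (simp add: top_unit_def)

lemma LU: "L \<in> left_unit \<Longrightarrow> L * U = 1\<^sub>m r"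
  by (simp add: left_unit_def)

lemma partial_id_top_unit: "partial_id m r r \<in> top_unit"
  using r_le by (simp add: top_unit_def partial_id_mult)

lemma partial_id_left_unit: "partial_id r n r \<in> left_unit"
  using r_le by (simp add: left_unit_def partial_id_mult)

lemma star_eq:
  assumes "dim_col X = n" "dim_row Y = m"
  shows "X \<star> Y = X * (U * (V * Y))"
proof -
  have "J_mat m n r = U * (V :: 'a mat)"
    using r_le by (simp add: J_mat_partial_id partial_id_mult)
  then show ?thesis using assms by (simp add: sandwich_def mat_assoc)
qed

lemma star_dim [simp]: "dim_row (X \<star> Y) = dim_row X" "dim_col (X \<star> Y) = dim_col Y"
  by (simp_all add: sandwich_def)

lemma star_assoc:
  assumes "dim_col X = n" "dim_row Y = m" "dim_col Y = n" "dim_row Z = m"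
  shows "X \<star> Y \<star> Z = X \<star> (Y \<star> Z)"
  using assms by (simp add: star_eq mat_assoc)

lemma star_KAL:
  assumes "K \<in> top_unit" "L \<in> left_unit" "K' \<in> top_unit" "L' \<in> left_unit" "A \<in> carrier_mat r r" "B \<in> carrier_mat r r"
  shows "(K * A * L) \<star> (K' * B * L') = K * (A * B) * L'"
  using assms by (simp add: star_eq top_unit_dim left_unit_dim mat_assoc mult_cancel_one[OF VK] mult_cancel_one[OF LU])

lemma KAL_carrier: "K \<in> top_unit \<Longrightarrow> L \<in> left_unit \<Longrightarrow> K * A * L \<in> carrier_mat m n"
  by (intro carrier_matI) (simp_all add: top_unit_dim left_unit_dim)

lemma RegJ_carrier: "X \<in> RegJ m n r \<Longrightarrow> X \<in> carrier_mat m n"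
  by (simp add: RegJ_def regular_elements_def)

lemma RegJ_I:
  fixes A :: "'a::field mat"
  assumes "K \<in> top_unit" "L \<in> left_unit" "A \<in> carrier_mat r r"
  shows "K * A * L \<in> RegJ m n r"
proof -
  obtain B where B: "B \<in> carrier_mat r r" "A * B * A = A" using generalized_inverse[OF assms(3)] .
  have "(K * A * L) \<star> (K * B * L) \<star> (K * A * L) = K * (A * B * A) * L"
    using assms B(1) by (simp add: star_KAL)
  then have "K * A * L = (K * A * L) \<star> (K * B * L) \<star> (K * A * L)" unfolding B(2) ..
  then show ?thesis
    using KAL_carrier[OF assms(1,2)] unfolding RegJ_def regular_elements_def by blast
qed

text \<open>With A = V X U and B = V Y U, regularity says X U B V X = X, hence A B A = A. The
  standard embeddings are corrected so that K A = X U and A L = V X, while V K = 1 and L U = 1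
  persist. Then K A L = K A B A L = X U B V X = X.\<close>

lemma RegJ_E:
  fixes X :: "'a::field mat"
  assumes "X \<in> RegJ m n r"
  obtains K A L where "K \<in> top_unit" "L \<in> left_unit" "A \<in> carrier_mat r r" "X = K * A * L"
proof -
  obtain Y where X: "X \<in> carrier_mat m n" and Y: "Y \<in> carrier_mat m n" and XYX: "X \<star> Y \<star> X = X"
    using assms by (auto simp: RegJ_def regular_elements_def)
  have d: "dim_row X = m" "dim_col X = n" "dim_row Y = m" "dim_col Y = n" using X Y by auto
  define A where "A = V * X * U"
  define B where "B = V * Y * U"
  have dA: "dim_row A = r" "dim_col A = r" "dim_row B = r" "dim_col B = r"
    by (simp_all add: A_def B_def)
  have XB: "X * (U * (B * (V * X))) = X"
    using XYX d unfolding B_def by (simp add: star_eq mat_assoc)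
  have ABA: "A * B * A = A"
  proof -
    have "A * B * A = V * (X * (U * (B * (V * X)))) * U"
      using d dA unfolding A_def by (simp add: mat_assoc)
    then show ?thesis unfolding XB A_def .
  qed
  let ?K0 = "partial_id m r r :: 'a mat" and ?L0 = "partial_id r n r :: 'a mat"
  define K where "K = ?K0 + (X * U * B - ?K0 * A * B)"
  define L where "L = ?L0 + (B * V * X - B * A * ?L0)"
  have c: "X * U * B \<in> carrier_mat m r" "?K0 * A * B \<in> carrier_mat m r"
    "B * V * X \<in> carrier_mat r n" "B * A * ?L0 \<in> carrier_mat r n" "X * U \<in> carrier_mat m r"
    "V * X \<in> carrier_mat r n" "A \<in> carrier_mat r r" "B \<in> carrier_mat r r"
    using d dA by (intro carrier_matI; simp)+
  have V0: "V * ?K0 = 1\<^sub>m r" and U0: "?L0 * U = 1\<^sub>m r" using VK[OF partial_id_top_unit] LU[OF partial_id_left_unit] .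
  have "V * K = V * ?K0 + (V * (X * U * B) - V * (?K0 * A * B))"
    unfolding K_def by (rule mult_add_minus_distrib[OF partial_id_dim(3) partial_id_dim(3) c(1,2)])
  also have "V * (X * U * B) = A * B" unfolding A_def using d dA by (simp add: mat_assoc)
  also have "V * (?K0 * A * B) = A * B" using dA by (simp add: mat_assoc mult_cancel_one[OF V0])
  finally have K: "K \<in> top_unit" using c V0 by (auto simp: top_unit_def K_def intro!: eq_matI)
  have "L * U = ?L0 * U + (B * V * X * U - B * A * ?L0 * U)"
    unfolding L_def by (rule add_minus_mult_distrib[OF partial_id_dim(3) c(3,4) partial_id_dim(3)])
  also have "B * V * X * U = B * A" unfolding A_def using d dA by (simp add: mat_assoc)
  also have "B * A * ?L0 * U = B * A" using dA by (simp add: mat_assoc U0)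
  finally have L: "L \<in> left_unit" using c U0 by (auto simp: left_unit_def L_def intro!: eq_matI)
  have "K * A = ?K0 * A + (X * U * B * A - ?K0 * A * B * A)"
    unfolding K_def by (rule add_minus_mult_distrib[OF partial_id_dim(3) c(1,2,7)])
  also have "?K0 * A * B * A = ?K0 * A" using ABA dA by (simp add: mat_assoc)
  also have "X * U * B * A = X * (U * (B * (V * X))) * U"
    unfolding A_def using d dA by (simp add: mat_assoc)
  also have "\<dots> = X * U" unfolding XB ..
  also have "?K0 * A + (X * U - ?K0 * A) = X * U"
    using d dA by (intro eq_matI) auto
  finally have KA: "K * A = X * U" .
  have "A * L = A * ?L0 + (A * (B * V * X) - A * (B * A * ?L0))"
    unfolding L_def by (rule mult_add_minus_distrib[OF c(7) partial_id_dim(3) c(3,4)])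
  also have "A * (B * A * ?L0) = A * B * A * ?L0" using dA by (simp add: mat_assoc)
  also have "\<dots> = A * ?L0" unfolding ABA ..
  also have "A * (B * V * X) = V * (X * (U * (B * (V * X))))"
    unfolding A_def using d dA by (simp add: mat_assoc)
  also have "\<dots> = V * X" unfolding XB ..
  also have "A * ?L0 + (V * X - A * ?L0) = V * X"
    using d dA by (intro eq_matI) auto
  finally have AL: "A * L = V * X" .
  have "K * A * L = K * (A * B * A) * L" unfolding ABA ..
  also have "\<dots> = (K * A) * B * (A * L)"
    using K L dA by (simp add: mat_assoc top_unit_dim left_unit_dim)
  also have "\<dots> = X * (U * (B * (V * X)))"
    unfolding KA AL using d dA by (simp add: mat_assoc)
  finally show ?thesis using that[OF K L c(7)] XB by simp
qed

text \<open>V and U undo K and L, so A and K A L divide each other.\<close>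

lemma rank_KAL:
  fixes A :: "'a::field mat"
  assumes "K \<in> top_unit" "L \<in> left_unit" "A \<in> carrier_mat r r"
  shows "vec_space.rank m (K * A * L) = vec_space.rank r A"
proof (rule antisym)
  show "vec_space.rank m (K * A * L) \<le> vec_space.rank r A"
    using assms by (intro rank_mult_le) (auto simp: top_unit_def left_unit_def)
  have "vec_space.rank r (V * (K * A * L) * U) \<le> vec_space.rank m (K * A * L)"
    using KAL_carrier[OF assms(1,2)] by (intro rank_mult_le[of _ m n _ r _ r]) simp_all
  also have "V * (K * A * L) * U = A"
    using assms by (simp add: top_unit_dim left_unit_dim mat_assoc mult_cancel_one[OF VK] LU)
  finally show "vec_space.rank r A \<le> vec_space.rank m (K * A * L)" .
qed

lemma RegJ_star: "X \<in> RegJ m n r \<Longrightarrow> Y \<in> RegJ m n r \<Longrightarrow> X \<star> Y \<in> RegJ m n r"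
  by (elim RegJ_E) (simp add: star_KAL RegJ_I)

lemma rank_star_left:
  assumes "X \<in> carrier_mat m n" "Y \<in> carrier_mat m n"
  shows "vec_space.rank m (X \<star> Y) \<le> vec_space.rank m X"
proof -
  have "U * (V * Y) \<in> carrier_mat n n" using assms by (intro carrier_matI) simp_all
  from rank_right_mult_le[OF assms(1) this] show ?thesis using assms by (simp add: star_eq)
qed

lemma rank_star_right:
  assumes "X \<in> carrier_mat m n" "Y \<in> carrier_mat m n"
  shows "vec_space.rank m (X \<star> Y) \<le> vec_space.rank m Y"
proof -
  have "X * U * V \<in> carrier_mat m m" using assms by (intro carrier_matI) simp_all
  from rank_left_mult_le[OF assms(2) this] show ?thesis using assms by (simp add: star_eq mat_assoc)
qed

lemma IJ_eq: "IJ m n r s = {X \<in> RegJ m n r. vec_space.rank m X \<le> s}"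
  by (auto simp: IJ_def DJ_def)

lemma IJ_star_left: "X \<in> IJ m n r s \<Longrightarrow> Y \<in> RegJ m n r \<Longrightarrow> X \<star> Y \<in> IJ m n r s"
  using rank_star_left[of X Y] by (auto simp: IJ_eq RegJ_star RegJ_carrier)

lemma IJ_star_right: "X \<in> IJ m n r s \<Longrightarrow> Y \<in> RegJ m n r \<Longrightarrow> Y \<star> X \<in> IJ m n r s"
  using rank_star_right[of Y X] by (auto simp: IJ_eq RegJ_star RegJ_carrier)

lemma RegJ_rank_le: "X \<in> RegJ m n r \<Longrightarrow> vec_space.rank m X \<le> r"
  by (elim RegJ_E) (simp add: rank_KAL rank_le_row)

lemma DJ_nonempty: "s \<le> r \<Longrightarrow> partial_id m r r * partial_id r r s * partial_id r n r \<in> DJ m n r s"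
  by (simp add: DJ_def RegJ_I rank_KAL partial_id_top_unit partial_id_left_unit rank_partial_id)

text \<open>Divisibility is decided on the r x r middle factors: the partial identity of rank a is
  its own product with any partial identity of rank b, where a is at most b.\<close>

lemma RegJ_divides:
  fixes X Y :: "'a::field mat"
  assumes X: "X \<in> RegJ m n r" and Y: "Y \<in> RegJ m n r"
    and le: "vec_space.rank m X \<le> vec_space.rank m Y"
  obtains S T where "S \<in> RegJ m n r" "T \<in> RegJ m n r" "X = S \<star> Y \<star> T"
proof -
  obtain K A L where 1: "K \<in> top_unit" "L \<in> left_unit" "A \<in> carrier_mat r r" "X = K * A * L" using RegJ_E[OF X] .
  obtain K' B L' where 2: "K' \<in> top_unit" "L' \<in> left_unit" "B \<in> carrier_mat r r" "Y = K' * B * L'" using RegJ_E[OF Y] .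
  let ?a = "vec_space.rank r A" and ?b = "vec_space.rank r B"
  have ab: "?a \<le> ?b" using le 1 2 by (simp add: rank_KAL)
  obtain P Q where PQ: "P \<in> GL r" "Q \<in> GL r" "?a \<le> min r r" "A = P * partial_id r r ?a * Q"
    using rank_normal_form[OF 1(3)] .
  obtain P' Q' where PQ': "P' \<in> GL r" "Q' \<in> GL r" "?b \<le> min r r" "B = P' * partial_id r r ?b * Q'"
    using rank_normal_form[OF 2(3)] .
  obtain Pi where Pi: "dim_row Pi = r" "dim_col Pi = r" "Pi * P' = 1\<^sub>m r" using PQ'(1) by (rule GL_E)
  obtain Qi where Qi: "dim_row Qi = r" "dim_col Qi = r" "Q' * Qi = 1\<^sub>m r" using PQ'(2) by (rule GL_E)
  define S where "S = P * partial_id r r ?a * Pi"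
  define T where "T = Qi * Q"
  have ST: "S \<in> carrier_mat r r" "T \<in> carrier_mat r r"
    using Pi Qi PQ by (auto intro!: carrier_matI simp: S_def T_def GL_dim)
  have "S * (P' * partial_id r r ?b * Q') * T = P * (partial_id r r ?a * partial_id r r ?b) * Q"
    unfolding S_def T_def using PQ(1,2) PQ'(1,2) Pi(1,2) Qi(1,2)
    by (simp add: mat_assoc GL_dim mult_cancel_one[OF Pi(3)] mult_cancel_one[OF Qi(3)])
  also have "partial_id r r ?a * partial_id r r ?b = (partial_id r r ?a :: 'a mat)"
    using ab PQ(3) by (simp add: partial_id_mult)
  finally have "A = S * B * T" using PQ(4) PQ'(4) by simp
  then have "X = (K * S * partial_id r n r) \<star> Y \<star> (partial_id m r r * T * L)"
    using 1 2 ST by (simp add: star_KAL partial_id_top_unit partial_id_left_unit)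
  then show ?thesis using that RegJ_I 1 ST partial_id_top_unit partial_id_left_unit by blast
qed

lemma sg_ideal_IJ:
  assumes "s \<le> r"
  shows "sg_ideal (RegJ m n r) star (IJ m n r s :: 'a::field mat set)"
  unfolding sg_ideal_def
proof (intro conjI)
  show "IJ m n r s \<noteq> ({} :: 'a mat set)"
    using DJ_nonempty[OF assms] by (auto simp: IJ_def)
qed (auto simp: IJ_star_left IJ_star_right, simp add: IJ_eq)

text \<open>An ideal is determined by an element of maximal rank in it, because this element divides
  every regular element of no larger rank.\<close>

lemma sg_ideal_eq_IJ:
  fixes A :: "'a::field mat set"
  assumes "sg_ideal (RegJ m n r) star A"
  obtains s where "s \<le> r" "A = IJ m n r s"
proof -
  have A: "A \<noteq> {}" "A \<subseteq> RegJ m n r"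
    "\<And>x y. x \<in> A \<Longrightarrow> y \<in> RegJ m n r \<Longrightarrow> y \<star> x \<in> A \<and> x \<star> y \<in> A"
    using assms by (auto simp: sg_ideal_def)
  let ?R = "vec_space.rank m ` A"
  have "?R \<subseteq> {..r}" using A(2) RegJ_rank_le by auto
  then have fin: "finite ?R" using finite_subset by blast
  define s where "s = Max ?R"
  have sR: "s \<in> ?R" unfolding s_def using fin A(1) by (intro Max_in) auto
  then obtain Y where Y: "Y \<in> A" "vec_space.rank m Y = s" by auto
  have "A = IJ m n r s"
  proof
    show "A \<subseteq> IJ m n r s" using A(2) fin by (auto simp: IJ_eq s_def)
    show "IJ m n r s \<subseteq> A"
    proof
      fix X :: "'a mat" assume "X \<in> IJ m n r s"
      then have X: "X \<in> RegJ m n r" "vec_space.rank m X \<le> vec_space.rank m Y" using Y by (auto simp: IJ_eq)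
      obtain S T where "S \<in> RegJ m n r" "T \<in> RegJ m n r" "X = S \<star> Y \<star> T"
        using RegJ_divides[OF X(1) _ X(2)] A(2) Y by blast
      then show "X \<in> A" using A(3) Y by blast
    qed
  qed
  moreover have "s \<le> r" using sR \<open>?R \<subseteq> {..r}\<close> by auto
  ultimately show ?thesis using that by blast
qed

section \<open>Green's relations and the top class\<close>

lemma left_princ_rank:
  "Z \<in> left_princ (RegJ m n r) star Z' \<Longrightarrow> Z' \<in> RegJ m n r \<Longrightarrow> vec_space.rank m Z \<le> vec_space.rank m Z'"
  using rank_star_right[OF RegJ_carrier RegJ_carrier] by (auto simp: left_princ_def)

lemma right_princ_rank:
  "Z \<in> right_princ (RegJ m n r) star Z' \<Longrightarrow> Z' \<in> RegJ m n r \<Longrightarrow> vec_space.rank m Z \<le> vec_space.rank m Z'"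
  using rank_star_left[OF RegJ_carrier RegJ_carrier] by (auto simp: right_princ_def)

lemma green_D_class:
  fixes X :: "'a::field mat"
  assumes X: "X \<in> DJ m n r s"
  shows "green_D (RegJ m n r) star `` {X} = DJ m n r s"
proof (intro equalityI subsetI)
  have XR: "X \<in> RegJ m n r" "vec_space.rank m X = s" using X by (auto simp: DJ_def)
  have left: "vec_space.rank m Z = vec_space.rank m Z'"
    if "(Z, Z') \<in> green_L (RegJ m n r) star" for Z Z' :: "'a mat"
  proof -
    have "Z \<in> left_princ (RegJ m n r) star Z'" "Z' \<in> left_princ (RegJ m n r) star Z"
      "Z \<in> RegJ m n r" "Z' \<in> RegJ m n r"
      using that by (auto simp: green_L_def left_princ_def)
    then show ?thesis by (intro antisym left_princ_rank)
  qed
  have right: "vec_space.rank m Z = vec_space.rank m Z'"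
    if "(Z, Z') \<in> green_R (RegJ m n r) star" for Z Z' :: "'a mat"
  proof -
    have "Z \<in> right_princ (RegJ m n r) star Z'" "Z' \<in> right_princ (RegJ m n r) star Z"
      "Z \<in> RegJ m n r" "Z' \<in> RegJ m n r"
      using that by (auto simp: green_R_def right_princ_def)
    then show ?thesis by (intro antisym right_princ_rank)
  qed
  fix Y assume "Y \<in> green_D (RegJ m n r) star `` {X}"
  then obtain Z where "(X, Z) \<in> green_L (RegJ m n r) star" "(Z, Y) \<in> green_R (RegJ m n r) star"
    by (auto simp: green_D_def)
  moreover then have "Y \<in> RegJ m n r" by (auto simp: green_R_def)
  ultimately show "Y \<in> DJ m n r s" using left right XR by (auto simp: DJ_def)
next
  fix Y :: "'a mat" assume Y: "Y \<in> DJ m n r s"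
  have XR: "X \<in> RegJ m n r" "vec_space.rank m X = s" using X by (auto simp: DJ_def)
  have YR: "Y \<in> RegJ m n r" "vec_space.rank m Y = s" using Y by (auto simp: DJ_def)
  obtain K A L where 1: "K \<in> top_unit" "L \<in> left_unit" "A \<in> carrier_mat r r" "X = K * A * L" using RegJ_E[OF XR(1)] .
  obtain K' B L' where 2: "K' \<in> top_unit" "L' \<in> left_unit" "B \<in> carrier_mat r r" "Y = K' * B * L'" using RegJ_E[OF YR(1)] .
  have "vec_space.rank r A = vec_space.rank r B" using XR(2) YR(2) 1 2 by (simp add: rank_KAL)
  then obtain S T where ST: "S \<in> GL r" "T \<in> GL r" "B = S * A * T"
    using equal_rank_equivalent[OF 1(3) 2(3)] by blast
  obtain Si where Si: "Si \<in> GL r" "Si * S = 1\<^sub>m r" using ST(1) by (rule GL_E)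
  obtain Ti where Ti: "Ti \<in> GL r" "T * Ti = 1\<^sub>m r" using ST(2) by (rule GL_E)
  have c: "S \<in> carrier_mat r r" "T \<in> carrier_mat r r" "Si \<in> carrier_mat r r" "Ti \<in> carrier_mat r r"
    "S * A \<in> carrier_mat r r"
    using ST Si Ti 1(3) GL_carrier by (blast intro: mult_carrier_mat)+
  \<comment> \<open>For X = K A L and Y = K' S A T L' the intermediate element keeps L from X and K'
    S A from Y. It is reached from X on the left through S and from Y on the right through the
    inverse of T, and both ways are reversible.\<close>
  define Z where "Z = K' * (S * A) * L"
  have ZR: "Z \<in> RegJ m n r" unfolding Z_def using 1 2 c by (intro RegJ_I) auto
  let ?L = "partial_id r n r :: 'a mat" and ?K = "partial_id m r r :: 'a mat"
  have e1: "Z = (K' * S * ?L) \<star> X" unfolding Z_def 1(4) using 1 2 c by (simp add: star_KAL partial_id_left_unit)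
  have e2: "X = (K * Si * ?L) \<star> Z"
  proof -
    have "(K * Si * ?L) \<star> Z = K * (Si * (S * A)) * L"
      unfolding Z_def using 1 2 c by (simp add: star_KAL partial_id_left_unit)
    also have "Si * (S * A) = A" using Si 1(3) c by (simp add: mult_cancel_one[OF Si(2)])
    finally show ?thesis using 1(4) by simp
  qed
  have e3: "Y = Z \<star> (?K * T * L')" unfolding Z_def 2(4) ST(3) using 1 2 c by (simp add: star_KAL partial_id_top_unit)
  have e4: "Z = Y \<star> (?K * Ti * L)"
  proof -
    have "Y \<star> (?K * Ti * L) = K' * (B * Ti) * L"
      unfolding 2(4) using 1 2 c by (simp add: star_KAL partial_id_top_unit)
    also have "B * Ti = S * A" unfolding ST(3) using c 1(3) by (simp add: mat_assoc Ti(2))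
    finally show ?thesis by (simp add: Z_def)
  qed
  have q: "K' * S * ?L \<in> RegJ m n r" "K * Si * ?L \<in> RegJ m n r"
    "?K * T * L' \<in> RegJ m n r" "?K * Ti * L \<in> RegJ m n r"
    using 1 2 c partial_id_top_unit partial_id_left_unit by (blast intro: RegJ_I)+
  have sub1: "left_princ (RegJ m n r) star (A \<star> C) \<subseteq> left_princ (RegJ m n r) star C"
    if "A \<in> RegJ m n r" "C \<in> RegJ m n r" for A C :: "'a mat"
  proof -
    have "s \<star> (A \<star> C) = (s \<star> A) \<star> C" if "s \<in> RegJ m n r" for s
      using that \<open>A \<in> _\<close> \<open>C \<in> _\<close> RegJ_carrier star_assoc[of s A C] by fastforce
    then show ?thesis using that RegJ_star by (force simp: left_princ_def)
  qed
  have sub2: "right_princ (RegJ m n r) star (C \<star> A) \<subseteq> right_princ (RegJ m n r) star C"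
    if "A \<in> RegJ m n r" "C \<in> RegJ m n r" for A C :: "'a mat"
  proof -
    have "(C \<star> A) \<star> s = C \<star> (A \<star> s)" if "s \<in> RegJ m n r" for s
      using that \<open>A \<in> _\<close> \<open>C \<in> _\<close> RegJ_carrier star_assoc[of C A s] by fastforce
    then show ?thesis using that RegJ_star by (force simp: right_princ_def)
  qed
  have "(X, Z) \<in> green_L (RegJ m n r) star"
    using sub1[OF q(1) XR(1)] sub1[OF q(2) ZR] XR(1) ZR
    unfolding e1[symmetric] e2[symmetric] green_L_def by blast
  moreover have "(Z, Y) \<in> green_R (RegJ m n r) star"
    using sub2[OF q(3) ZR] sub2[OF q(4) YR(1)] YR(1) ZR
    unfolding e3[symmetric] e4[symmetric] green_R_def by blast
  ultimately show "Y \<in> green_D (RegJ m n r) star `` {X}" by (auto simp: green_D_def)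
qed

lemma two_sided_princ_mono:
  fixes X Y :: "'a::field mat"
  assumes X: "X \<in> RegJ m n r" and Y: "Y \<in> RegJ m n r" and le: "vec_space.rank m X \<le> vec_space.rank m Y"
  shows "two_sided_princ (RegJ m n r) star X \<subseteq> two_sided_princ (RegJ m n r) star Y"
proof
  fix Z assume "Z \<in> two_sided_princ (RegJ m n r) star X"
  moreover have XI: "X \<in> IJ m n r (vec_space.rank m X)" using X by (simp add: IJ_eq)
  ultimately have "Z \<in> IJ m n r (vec_space.rank m X)"
    unfolding two_sided_princ_def left_princ_def right_princ_def
    using IJ_star_left IJ_star_right by blast
  then have Z: "Z \<in> RegJ m n r" "vec_space.rank m Z \<le> vec_space.rank m Y" using le by (auto simp: IJ_eq)
  obtain S T where "S \<in> RegJ m n r" "T \<in> RegJ m n r" "Z = S \<star> Y \<star> T"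
    using RegJ_divides[OF Z(1) Y Z(2)] .
  then show "Z \<in> two_sided_princ (RegJ m n r) star Y"
    by (auto simp: two_sided_princ_def left_princ_def right_princ_def)
qed

lemma top_D_class_DJ:
  assumes "s \<le> r"
  shows "top_D_class (RegJ m n r) star (IJ m n r s) (DJ m n r s :: 'a::field mat set)"
  unfolding top_D_class_def
proof (intro conjI ballI)
  let ?X = "partial_id m r r * partial_id r r s * partial_id r n r :: 'a mat"
  have "?X \<in> DJ m n r s" using DJ_nonempty[OF assms] .
  then show "DJ m n r s \<in> RegJ m n r // green_D (RegJ m n r) (star :: 'a mat \<Rightarrow> _)"
    using quotientI[of ?X "RegJ m n r" "green_D (RegJ m n r) star"] green_D_class[of ?X s]
    by (simp add: DJ_def)
  show "DJ m n r s \<subseteq> (IJ m n r s :: 'a mat set)" by (auto simp: IJ_def)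
  show "two_sided_princ (RegJ m n r) star X \<subseteq> two_sided_princ (RegJ m n r) star Y"
    if "X \<in> IJ m n r s" "Y \<in> DJ m n r s" for X Y :: "'a mat"
    using that by (intro two_sided_princ_mono) (simp_all add: IJ_eq DJ_def)
qed

lemma idempotents_generate:
  assumes "s < r"
  shows "sg_generated star (idempotents_in star (DJ m n r s)) = (IJ m n r s :: 'a::field mat set)"
    (is "?G = _")
proof (intro equalityI subsetI)
  fix X assume "X \<in> ?G"
  then show "X \<in> IJ m n r s"
  proof induction
    case (base X)
    then show ?case by (auto simp: idempotents_in_def DJ_def IJ_eq)
  next
    case (mult X Y)
    then show ?case by (intro IJ_star_left) (auto simp: IJ_eq)
  qed
next
  \<comment> \<open>K and L must be arbitrary in the induction: a product A B is split as (K A L0)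
    \<star> (K0 B L), with the standard embeddings at the inner ends.\<close>
  have gen: "K * A * L \<in> ?G"
    if "A \<in> sg_generated (*) (rank_idem r s)" "K \<in> top_unit" "L \<in> left_unit" for K A L :: "'a mat"
    using that
  proof (induction arbitrary: K L rule: sg_generated.induct)
    case (base E)
    then show ?case
      by (intro sg_generated.base)
        (simp add: idempotents_in_def DJ_def rank_idem_def RegJ_I rank_KAL star_KAL)
  next
    case (mult A B)
    have "K * (A * B) * L = (K * A * partial_id r n r) \<star> (partial_id m r r * B * L)"
      using mult.prems mult.hyps[THEN sg_generated_carrier] by (simp add: star_KAL partial_id_top_unit partial_id_left_unit)
    then show ?case
      using sg_generated.mult[OF mult.IH(1)[OF mult.prems(1) partial_id_left_unit] mult.IH(2)[OF partial_id_top_unit mult.prems(2)]]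
      by simp
  qed
  fix X :: "'a mat" assume X: "X \<in> IJ m n r s"
  then have "X \<in> RegJ m n r" by (simp add: IJ_eq)
  then obtain K A L where 1: "K \<in> top_unit" "L \<in> left_unit" "A \<in> carrier_mat r r" "X = K * A * L"
    by (rule RegJ_E)
  then have "vec_space.rank r A \<le> s" using X by (simp add: IJ_eq rank_KAL)
  then show "X \<in> ?G" using gen rank_le_generated[OF assms 1(3)] 1 by blast
qed

end

section \<open>Covers of biregular bipartite graphs\<close>

text \<open>If every nonempty proper subfamily has a surplus, any choice for one index leaves Hall's
  condition intact. Otherwise some subfamily J is tight; J and its complement, the latter with the
  neighbours of J removed, are matched separately.\<close>

theorem hall_marriage:
  fixes A :: "'i \<Rightarrow> 'b set"
  assumes "finite I" "\<And>i. i \<in> I \<Longrightarrow> finite (A i)"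
    "\<And>J. J \<subseteq> I \<Longrightarrow> card J \<le> card (\<Union>i\<in>J. A i)"
  shows "\<exists>f. inj_on f I \<and> (\<forall>i\<in>I. f i \<in> A i)"
  using assms
proof (induction I arbitrary: A rule: finite_psubset_induct)
  case (psubset I)
  note finA = psubset.prems(1) and H = psubset.prems(2)
  have finU: "finite (\<Union>i\<in>J. A i)" if "J \<subseteq> I" for J
    using that finA psubset.hyps finite_subset by blast
  consider "I = {}" | "I \<noteq> {}" "\<forall>J. J \<subset> I \<and> J \<noteq> {} \<longrightarrow> card J < card (\<Union>i\<in>J. A i)"
    | J where "J \<subset> I" "J \<noteq> {}" "card J = card (\<Union>i\<in>J. A i)"
    using H le_neq_implies_less by blast
  then show ?case
  proof cases
    case 1
    then show ?thesis by simp
  next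
    case 2
    then obtain i where i: "i \<in> I" by blast
    have "card {i} \<le> card (\<Union>j\<in>{i}. A j)" using H[of "{i}"] i by blast
    then obtain x where x: "x \<in> A i" by fastforce
    have "\<exists>f. inj_on f (I - {i}) \<and> (\<forall>j\<in>I - {i}. f j \<in> A j - {x})"
    proof (rule psubset.IH)
      fix J assume J: "J \<subseteq> I - {i}"
      show "card J \<le> card (\<Union>j\<in>J. A j - {x})"
      proof (cases "J = {}")
        case False
        then have "card J < card (\<Union>j\<in>J. A j)" using 2 J i by blast
        also have "card (\<Union>j\<in>J. A j) \<le> Suc (card ((\<Union>j\<in>J. A j) - {x}))"
          using card_Suc_Diff1[of "\<Union>j\<in>J. A j" x] finU[of J] J by (cases "x \<in> (\<Union>j\<in>J. A j)") auto
        also have "(\<Union>j\<in>J. A j) - {x} = (\<Union>j\<in>J. A j - {x})" by blast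
        finally show ?thesis by simp
      qed simp
    qed (use i finA in auto)
    then obtain f where f: "inj_on f (I - {i})" "\<forall>j\<in>I - {i}. f j \<in> A j - {x}" by blast
    then have "inj_on (f(i := x)) I" by (auto simp: inj_on_def)
    moreover have "\<forall>j\<in>I. (f(i := x)) j \<in> A j" using f x by auto
    ultimately show ?thesis by blast
  next
    case (3 J)
    let ?N = "\<Union>i\<in>J. A i"
    have "\<exists>f. inj_on f J \<and> (\<forall>j\<in>J. f j \<in> A j)"
      using 3 finA H by (intro psubset.IH) auto
    then obtain f where f: "inj_on f J" "\<forall>j\<in>J. f j \<in> A j" by blast
    have "\<exists>g. inj_on g (I - J) \<and> (\<forall>j\<in>I - J. g j \<in> A j - ?N)"
    proof (rule psubset.IH)
      fix K assume K: "K \<subseteq> I - J"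
      have "finite K" "finite J" using K 3 psubset.hyps finite_subset by blast+
      then have "card K + card J = card (K \<union> J)" using K by (intro card_Un_disjoint[symmetric]) auto
      also have "\<dots> \<le> card (\<Union>i\<in>K \<union> J. A i)" using K 3 by (intro H) auto
      also have "(\<Union>i\<in>K \<union> J. A i) = (\<Union>j\<in>K. A j - ?N) \<union> ?N" by blast
      also have "card \<dots> \<le> card (\<Union>j\<in>K. A j - ?N) + card ?N" by (rule card_Un_le)
      finally show "card K \<le> card (\<Union>j\<in>K. A j - ?N)" using 3 by simp
    qed (use 3 finA in auto)
    then obtain g where g: "inj_on g (I - J)" "\<forall>j\<in>I - J. g j \<in> A j - ?N" by blast
    let ?h = "\<lambda>i. if i \<in> J then f i else g i"
    have "inj_on ?h I"
    proof (rule inj_onI)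
      fix x y assume xy: "x \<in> I" "y \<in> I" "?h x = ?h y"
      have ne: "f u \<noteq> g v" if "u \<in> J" "v \<in> I - J" for u v
      proof -
        have "f u \<in> ?N" using f(2) that(1) by blast
        moreover have "g v \<notin> ?N" using g(2) that(2) by simp
        ultimately show ?thesis by metis
      qed
      show "x = y"
      proof (cases "x \<in> J"; cases "y \<in> J")
        assume "x \<in> J" "y \<in> J"
        then show ?thesis using xy(3) inj_onD[OF f(1)] by simp
      next
        assume "x \<in> J" "y \<notin> J"
        then show ?thesis using xy ne[of x y] by simp
      next
        assume "x \<notin> J" "y \<in> J"
        then show ?thesis using xy ne[of y x] by simp
      next
        assume "x \<notin> J" "y \<notin> J"
        then show ?thesis using xy inj_onD[OF g(1)] by simp
      qed
    qed
    moreover have "\<forall>i\<in>I. ?h i \<in> A i" using f g by auto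
    ultimately show ?thesis by blast
  qed
qed

text \<open>If (c, d) stands for the H-class in the R-class c and the L-class d, and E for the group H-classes,
  these are the H-classes reached by products of elements of the H-classes in F.\<close>

inductive alt_reach :: "('i \<times> 'l) set \<Rightarrow> ('i \<times> 'l) set \<Rightarrow> 'i \<Rightarrow> 'l \<Rightarrow> bool" for F E where
  edge: "(c, d) \<in> F \<Longrightarrow> alt_reach F E c d"
| comp: "alt_reach F E c d \<Longrightarrow> (c', d) \<in> E \<Longrightarrow> alt_reach F E c' d' \<Longrightarrow> alt_reach F E c d'"

text \<open>A walk read backwards is a walk in the converse graph; this lets the two sides of the
  graph change roles.\<close>

lemma alt_reach_converse: "alt_reach (F\<inverse>) (E\<inverse>) d c \<Longrightarrow> alt_reach F E c d"
  by (induction rule: alt_reach.induct) (auto intro: alt_reach.intros)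

text \<open>Connectedness as the absence of proper unions of components. In this form it follows
  from idempotent generation by induction on products, and the covering argument applies it to one
  explicit pair of vertex sets.\<close>

definition bip_connected :: "'i set \<Rightarrow> 'l set \<Rightarrow> ('i \<times> 'l) set \<Rightarrow> bool" where
  "bip_connected I \<Lambda> E \<longleftrightarrow> (\<forall>Y Z. Y \<subseteq> I \<and> Z \<subseteq> \<Lambda> \<and> (\<forall>(c, d)\<in>E. c \<in> Y \<longleftrightarrow> d \<in> Z)
     \<longrightarrow> (Y \<noteq> {} \<longrightarrow> Y = I) \<and> (Z \<noteq> {} \<longrightarrow> Z = \<Lambda>))"

lemma bip_connected_converse:
  assumes "bip_connected I \<Lambda> E"
  shows "bip_connected \<Lambda> I (E\<inverse>)"
  unfolding bip_connected_def
proof (intro allI impI)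
  fix Y Z assume "Y \<subseteq> \<Lambda> \<and> Z \<subseteq> I \<and> (\<forall>(d, c)\<in>E\<inverse>. d \<in> Y \<longleftrightarrow> c \<in> Z)"
  then have "Z \<subseteq> I" "Y \<subseteq> \<Lambda>" "\<forall>(c, d)\<in>E. c \<in> Z \<longleftrightarrow> d \<in> Y" by auto
  with assms have "(Z \<noteq> {} \<longrightarrow> Z = I) \<and> (Y \<noteq> {} \<longrightarrow> Y = \<Lambda>)" unfolding bip_connected_def by simp
  then show "(Y \<noteq> {} \<longrightarrow> Y = \<Lambda>) \<and> (Z \<noteq> {} \<longrightarrow> Z = I)" by simp
qed

text \<open>Hall gives a map \<open>p\<close> along edges with fibres of size at most k. If \<open>X\<close> is the set of left vertices
  reached from c0, then every edge at \<open>p ` X\<close> ends in \<open>X\<close>; counting edges, every edge at \<open>X\<close>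
  ends in \<open>p ` X\<close>, so \<open>X\<close> and \<open>p ` X\<close> form a union of components.\<close>

lemma alternating_cover_aux:
  fixes I :: "'i set" and \<Lambda> :: "'l set"
  assumes fin: "finite I" "finite \<Lambda>" and E: "E \<subseteq> I \<times> \<Lambda>"
    and degI: "\<And>c. c \<in> I \<Longrightarrow> card {d. (c, d) \<in> E} = a"
    and degL: "\<And>d. d \<in> \<Lambda> \<Longrightarrow> card {c. (c, d) \<in> E} = k * a"
    and pos: "a > 0" "k > 0" and conn: "bip_connected I \<Lambda> E"
  shows "\<exists>F\<subseteq>E. card F \<le> card I \<and> (\<forall>c\<in>I. \<forall>d\<in>\<Lambda>. alt_reach F E c d)"
proof -
  have finE: "finite E" using E fin finite_subset by blast
  have fs: "finite {d. (c, d) \<in> E}" "finite {c. (c, d) \<in> E}" for c d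
    using finite_imageI[OF finE, of snd] finite_imageI[OF finE, of fst]
    by (auto elim!: rev_finite_subset intro: rev_image_eqI)
  have cardI: "card {(c, d) \<in> E. c \<in> X} = a * card X" if "X \<subseteq> I" for X
  proof -
    have "{(c, d) \<in> E. c \<in> X} = (SIGMA c:X. {d. (c, d) \<in> E})" by auto
    also have "card \<dots> = (\<Sum>c\<in>X. card {d. (c, d) \<in> E})"
      using that fin fs finite_subset by (intro card_SigmaI) auto
    also have "\<dots> = (\<Sum>c\<in>X. a)" using that degI by (intro sum.cong) auto
    finally show ?thesis by simp
  qed
  have cardL: "card {(c, d) \<in> E. d \<in> Z} = k * a * card Z" if "Z \<subseteq> \<Lambda>" for Z
  proof -
    have "{(c, d) \<in> E. d \<in> Z} = (\<lambda>(d, c). (c, d)) ` (SIGMA d:Z. {c. (c, d) \<in> E})" by force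
    also have "card \<dots> = card (SIGMA d:Z. {c. (c, d) \<in> E})"
      by (intro card_image) (auto simp: inj_on_def)
    also have "\<dots> = (\<Sum>d\<in>Z. card {c. (c, d) \<in> E})"
      using that fin fs finite_subset by (intro card_SigmaI) auto
    also have "\<dots> = (\<Sum>d\<in>Z. k * a)" using that degL by (intro sum.cong) auto
    finally show ?thesis by simp
  qed
  \<comment> \<open>Each right vertex is offered in k copies, so an injection amounts to a map along
    edges whose fibres have at most k elements.\<close>
  have "\<exists>f. inj_on f I \<and> (\<forall>c\<in>I. f c \<in> {d. (c, d) \<in> E} \<times> {..<k})"
  proof (rule hall_marriage)
    fix J assume J: "J \<subseteq> I"
    let ?N = "\<Union>c\<in>J. {d. (c, d) \<in> E}"
    have "a * card J = card {(c, d) \<in> E. c \<in> J}" using cardI[OF J] by simp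
    also have "\<dots> \<le> card {(c, d) \<in> E. d \<in> ?N}"
      using finE by (intro card_mono) (auto elim: rev_finite_subset)
    also have "\<dots> = k * a * card ?N" using E by (intro cardL) auto
    finally have "card J \<le> card ?N * k" using pos by (simp add: ac_simps)
    also have "\<dots> = card (?N \<times> {..<k})" by (simp add: card_cartesian_product)
    also have "?N \<times> {..<k} = (\<Union>c\<in>J. {d. (c, d) \<in> E} \<times> {..<k})" by blast
    finally show "card J \<le> card (\<Union>c\<in>J. {d. (c, d) \<in> E} \<times> {..<k})" .
  qed (use fin fs in auto)
  then obtain f where f: "inj_on f I" "\<And>c. c \<in> I \<Longrightarrow> (c, fst (f c)) \<in> E \<and> snd (f c) < k"
    by (fastforce simp: mem_Times_iff)
  define p where "p c = fst (f c)" for c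
  define F where "F = (\<lambda>c. (c, p c)) ` I"
  have FE: "F \<subseteq> E" using f by (auto simp: F_def p_def)
  have pE: "(c, p c) \<in> E" if "c \<in> I" for c using f that by (simp add: p_def)
  have pL: "p c \<in> \<Lambda>" if "c \<in> I" for c using pE[OF that] E by auto
  have fibre: "card X \<le> k * card (p ` X)" if "X \<subseteq> I" for X
  proof -
    have "card X = card (f ` X)" using f(1) that by (metis card_image inj_on_subset)
    also have "\<dots> \<le> card (p ` X \<times> {..<k})"
    proof (rule card_mono)
      show "finite (p ` X \<times> {..<k})" using that fin finite_subset by blast
      show "f ` X \<subseteq> p ` X \<times> {..<k}"
      proof (rule image_subsetI)
        fix x assume "x \<in> X"
        then show "f x \<in> p ` X \<times> {..<k}" using f(2) that by (auto simp: p_def mem_Times_iff)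
      qed
    qed
    finally show ?thesis by (simp add: card_cartesian_product mult.commute)
  qed
  have "alt_reach F E c0 d" if c0: "c0 \<in> I" and d: "d \<in> \<Lambda>" for c0 d
  proof -
    define X where "X = {c \<in> I. alt_reach F E c0 (p c)}"
    let ?Z = "p ` X"
    have XI: "X \<subseteq> I" and ZL: "?Z \<subseteq> \<Lambda>" using pL by (auto simp: X_def)
    have edge: "alt_reach F E c (p c)" if "c \<in> I" for c
      using that by (intro alt_reach.edge) (auto simp: F_def)
    have c0X: "c0 \<in> X" using edge c0 by (simp add: X_def)
    have closed: "c \<in> X" if "(c, p c') \<in> E" "c' \<in> X" for c c'
      using that E alt_reach.comp[of F E c0 "p c'" c "p c"] edge by (auto simp: X_def)
    have sub: "{(c, d) \<in> E. d \<in> ?Z} \<subseteq> {(c, d) \<in> E. c \<in> X}" using closed by auto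
    have "a * card X \<le> k * a * card ?Z" using fibre[OF XI] pos by (simp add: ac_simps)
    then have "card {(c, d) \<in> E. c \<in> X} \<le> card {(c, d) \<in> E. d \<in> ?Z}"
      using cardI[OF XI] cardL[OF ZL] by simp
    then have eq: "{(c, d) \<in> E. d \<in> ?Z} = {(c, d) \<in> E. c \<in> X}"
      using sub finE by (intro card_seteq) (auto elim: rev_finite_subset)
    then have "\<forall>(c, d)\<in>E. c \<in> X \<longleftrightarrow> d \<in> ?Z" by blast
    then have "?Z = \<Lambda>" using conn XI ZL c0X unfolding bip_connected_def by blast
    then show ?thesis using d by (auto simp: X_def)
  qed
  moreover have "card F \<le> card I" unfolding F_def using fin by (intro card_image_le)
  ultimately show ?thesis using FE by blast
qed

text \<open>Counting edges from both sides shows that the side of smaller degree is the larger one.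
  The cover takes one edge at each vertex of that side, and the second case is the first for the
  converse graph.\<close>

theorem alternating_cover:
  fixes I :: "'i set" and \<Lambda> :: "'l set"
  assumes fin: "finite I" "finite \<Lambda>" and E: "E \<subseteq> I \<times> \<Lambda>"
    and degI: "\<And>c. c \<in> I \<Longrightarrow> card {d. (c, d) \<in> E} = a"
    and degL: "\<And>d. d \<in> \<Lambda> \<Longrightarrow> card {c. (c, d) \<in> E} = b"
    and pos: "a > 0" "b > 0" and dvd: "a dvd b \<or> b dvd a" and conn: "bip_connected I \<Lambda> E"
  shows "\<exists>F\<subseteq>E. card F \<le> max (card I) (card \<Lambda>) \<and> (\<forall>c\<in>I. \<forall>d\<in>\<Lambda>. alt_reach F E c d)"
  using dvd
proof
  assume "a dvd b"
  then obtain k where k: "b = k * a" by (metis dvdE mult.commute)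
  have "\<exists>F\<subseteq>E. card F \<le> card I \<and> (\<forall>c\<in>I. \<forall>d\<in>\<Lambda>. alt_reach F E c d)"
    by (rule alternating_cover_aux[OF fin E, where a = a and k = k]) (use degI degL k pos conn in auto)
  then show ?thesis by (meson max.coboundedI1)
next
  assume "b dvd a"
  then obtain k where k: "a = k * b" by (metis dvdE mult.commute)
  have "\<exists>F\<subseteq>E\<inverse>. card F \<le> card \<Lambda> \<and> (\<forall>d\<in>\<Lambda>. \<forall>c\<in>I. alt_reach F (E\<inverse>) d c)"
    by (rule alternating_cover_aux[OF fin(2,1), where a = b and k = k])
      (use E degI degL k pos bip_connected_converse[OF conn] in auto)
  then obtain F where F: "F \<subseteq> E\<inverse>" "card F \<le> card \<Lambda>"
    "\<And>c d. d \<in> \<Lambda> \<Longrightarrow> c \<in> I \<Longrightarrow> alt_reach F (E\<inverse>) d c" by blast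
  have "F\<inverse> \<subseteq> E" "card (F\<inverse>) \<le> card \<Lambda>" using F by auto
  moreover have "alt_reach (F\<inverse>) E c d" if "c \<in> I" "d \<in> \<Lambda>" for c d
    using alt_reach_converse[of "F\<inverse>" E d c] F(3)[OF that(2,1)] by simp
  ultimately show ?thesis by (meson max.coboundedI2)
qed

section \<open>Counting matrices over a finite field\<close>

lemma bij_betw_mat:
  "bij_betw (mat a b) (({0..<a} \<times> {0..<b}) \<rightarrow>\<^sub>E UNIV) (carrier_mat a b)"
proof (rule bij_betwI')
  fix f g :: "nat \<times> nat \<Rightarrow> 'b"
  assume fg: "f \<in> ({0..<a} \<times> {0..<b}) \<rightarrow>\<^sub>E UNIV" "g \<in> ({0..<a} \<times> {0..<b}) \<rightarrow>\<^sub>E UNIV"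
  show "mat a b f = mat a b g \<longleftrightarrow> f = g"
  proof
    assume eq: "mat a b f = mat a b g"
    show "f = g"
    proof (rule PiE_ext[OF fg])
      fix x assume "x \<in> {0..<a} \<times> {0..<b}"
      then obtain i j where "x = (i, j)" "i < a" "j < b" by auto
      then show "f x = g x" using arg_cong[OF eq, of "\<lambda>M. M $$ (i, j)"] by simp
    qed
  qed simp
next
  fix M :: "'b mat" assume M: "M \<in> carrier_mat a b"
  show "\<exists>f\<in>({0..<a} \<times> {0..<b}) \<rightarrow>\<^sub>E UNIV. M = mat a b f"
    by (rule bexI[of _ "restrict (\<lambda>ij. M $$ ij) ({0..<a} \<times> {0..<b})"])
      (use M in \<open>auto intro!: eq_matI\<close>)
qed simp

lemma finite_carrier_mat:
  assumes "finite (UNIV :: 'a set)"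
  shows "finite (carrier_mat a b :: 'a mat set)"
  using bij_betw_finite[OF bij_betw_mat[where ?'a = 'a, of a b]] assms
  by (simp add: finite_PiE)

lemma card_carrier_mat:
  assumes "finite (UNIV :: 'a set)"
  shows "card (carrier_mat a b :: 'a mat set) = card (UNIV :: 'a set) ^ (a * b)"
  using bij_betw_same_card[OF bij_betw_mat[where ?'a = 'a, of a b]] by (simp add: card_PiE)

lemma card_fibres:
  assumes "finite S" "\<And>x. x \<in> S \<Longrightarrow> card {y \<in> S. f y = f x} = k"
  shows "card S = card (f ` S) * k"
proof -
  have "card S = (\<Sum>c\<in>f ` S. card {y \<in> S. f y = c})"
    using sum.image_gen[OF assms(1), of "\<lambda>_. 1 :: nat" f] by simp
  also have "\<dots> = (\<Sum>c\<in>f ` S. k)" using assms(2) by (intro sum.cong) auto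
  finally show ?thesis by simp
qed

text \<open>W has the right inverse K, so X = K (W X) + (X - K W X) splits X into its image under W
  and an element of the kernel.\<close>

lemma card_left_mult_preimage:
  fixes W K :: "'a::field mat"
  assumes fin: "finite (UNIV :: 'a set)"
    and W: "W \<in> carrier_mat p m" and K: "K \<in> carrier_mat m p" and WK: "W * K = 1\<^sub>m p"
    and A: "A \<subseteq> carrier_mat p s"
  shows "card {X \<in> carrier_mat m s. W * X \<in> A} * card (UNIV :: 'a set) ^ (p * s)
    = card A * card (UNIV :: 'a set) ^ (m * s)"
proof -
  define N where "N = {X \<in> carrier_mat m s. W * X = 0\<^sub>m p s}"
  have bij: "bij_betw (\<lambda>(B, Z). K * B + Z) (B \<times> N) {X \<in> carrier_mat m s. W * X \<in> B}"
    if B: "B \<subseteq> carrier_mat p s" for B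
  proof (rule bij_betw_byWitness[where f' = "\<lambda>X. (W * X, X - K * (W * X))"])
    have WKB: "W * (K * b + z) = b" "K * b + z \<in> carrier_mat m s" if "b \<in> B" "z \<in> N" for b z
    proof -
      have c: "b \<in> carrier_mat p s" "z \<in> carrier_mat m s" "K * b \<in> carrier_mat m s" "W * z = 0\<^sub>m p s"
        using that B K by (auto simp: N_def)
      show "K * b + z \<in> carrier_mat m s" using c by (intro add_carrier_mat)
      have "W * (K * b) = b" using W K c by (intro mult_cancel_one[OF WK]) auto
      then show "W * (K * b + z) = b"
        using mult_add_distrib_mat[OF W c(3,2)] c by simp
    qed
    show "\<forall>x\<in>B \<times> N. (\<lambda>X. (W * X, X - K * (W * X))) (case x of (B, Z) \<Rightarrow> K * B + Z) = x"
    proof (clarsimp simp: WKB)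
      fix b z assume "b \<in> B" "z \<in> N"
      then have "b \<in> carrier_mat p s" "z \<in> carrier_mat m s" using B by (auto simp: N_def)
      then show "K * b + z - K * b = z" using K by (intro eq_matI) auto
    qed
    have WX: "K * (W * X) \<in> carrier_mat m s" if "X \<in> carrier_mat m s" for X
      using K mult_carrier_mat[OF W that] by (rule mult_carrier_mat)
    show "\<forall>X\<in>{X \<in> carrier_mat m s. W * X \<in> B}.
        (case (W * X, X - K * (W * X)) of (B, Z) \<Rightarrow> K * B + Z) = X"
    proof (clarsimp)
      fix X :: "'a mat" assume X: "X \<in> carrier_mat m s"
      have "a + (x - a) = x" if "a \<in> carrier_mat m s" "x \<in> carrier_mat m s" for a x :: "'a mat"
        using that by (intro eq_matI) simp_all
      then show "K * (W * X) + (X - K * (W * X)) = X" using WX[OF X] X by blast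
    qed
    show "(\<lambda>(B, Z). K * B + Z) ` (B \<times> N) \<subseteq> {X \<in> carrier_mat m s. W * X \<in> B}"
      using WKB by auto
    show "(\<lambda>X. (W * X, X - K * (W * X))) ` {X \<in> carrier_mat m s. W * X \<in> B} \<subseteq> B \<times> N"
    proof (clarsimp simp: N_def)
      fix X assume X: "X \<in> carrier_mat m s" "W * X \<in> B"
      have "W * (K * (W * X)) = W * X" using W K X by (intro mult_cancel_one[OF WK]) auto
      then have "W * (X - K * (W * X)) = W * X - W * X"
        using mult_minus_distrib_mat[OF W X(1) WX[OF X(1)]] by simp
      also have "\<dots> = 0\<^sub>m p s" using W X by (intro eq_matI) auto
      finally show "X - K * (W * X) \<in> carrier_mat m s \<and> W * (X - K * (W * X)) = 0\<^sub>m p s"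
        using minus_carrier_mat[OF WX[OF X(1)]] by simp
    qed
  qed
  have *: "card {X \<in> carrier_mat m s. W * X \<in> B} = card B * card N" if "B \<subseteq> carrier_mat p s" for B
    using bij_betw_same_card[OF bij[OF that]] by (simp add: card_cartesian_product)
  \<comment> \<open>Taking B to be all p x s matrices determines the size of the kernel N.\<close>
  have "{X \<in> carrier_mat m s. W * X \<in> carrier_mat p s} = carrier_mat m s"
    using W by auto
  then have "card (UNIV :: 'a set) ^ (m * s) = card (UNIV :: 'a set) ^ (p * s) * card N"
    using *[of "carrier_mat p s"] by (simp add: card_carrier_mat[OF fin])
  then show ?thesis using *[OF A] by simp
qed

lemma card_transpose_image: "card (transpose_mat ` S) = card S"
  by (rule card_image) (metis inj_onI transpose_transpose)

text \<open>Transposition reduces this to left multiplication.\<close>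

lemma card_right_mult_preimage:
  fixes W K :: "'a::field mat"
  assumes fin: "finite (UNIV :: 'a set)"
    and W: "W \<in> carrier_mat m p" and K: "K \<in> carrier_mat p m" and KW: "K * W = 1\<^sub>m p"
    and A: "A \<subseteq> carrier_mat s p"
  shows "card {X \<in> carrier_mat s m. X * W \<in> A} * card (UNIV :: 'a set) ^ (p * s)
    = card A * card (UNIV :: 'a set) ^ (m * s)"
proof -
  have T: "W\<^sup>T * X\<^sup>T \<in> transpose_mat ` A \<longleftrightarrow> X * W \<in> A" if "X \<in> carrier_mat s m" for X
  proof -
    have "W\<^sup>T * X\<^sup>T = (X * W)\<^sup>T" using transpose_mult[OF that W] ..
    moreover have "Y\<^sup>T \<in> transpose_mat ` A \<longleftrightarrow> Y \<in> A" for Y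
      by (metis image_iff transpose_transpose)
    ultimately show ?thesis by metis
  qed
  have "transpose_mat ` {X \<in> carrier_mat s m. X * W \<in> A}
      = {X \<in> carrier_mat m s. W\<^sup>T * X \<in> transpose_mat ` A}"
  proof (intro equalityI subsetI)
    fix X assume "X \<in> {X \<in> carrier_mat m s. W\<^sup>T * X \<in> transpose_mat ` A}"
    then have "X\<^sup>T \<in> {X \<in> carrier_mat s m. X * W \<in> A}" using T[of "X\<^sup>T"] by simp
    then have "X\<^sup>T\<^sup>T \<in> transpose_mat ` {X \<in> carrier_mat s m. X * W \<in> A}" by (rule imageI)
    then show "X \<in> transpose_mat ` {X \<in> carrier_mat s m. X * W \<in> A}" by simp
  next
    fix X assume "X \<in> transpose_mat ` {X \<in> carrier_mat s m. X * W \<in> A}"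
    then obtain Y where "X = Y\<^sup>T" "Y \<in> carrier_mat s m" "Y * W \<in> A" by blast
    then show "X \<in> {X \<in> carrier_mat m s. W\<^sup>T * X \<in> transpose_mat ` A}" using T[of Y] by simp
  qed
  then have "card {X \<in> carrier_mat s m. X * W \<in> A} = card {X \<in> carrier_mat m s. W\<^sup>T * X \<in> transpose_mat ` A}"
    using card_transpose_image[of "{X \<in> carrier_mat s m. X * W \<in> A}"] by simp
  moreover have "W\<^sup>T * K\<^sup>T = 1\<^sub>m p" using transpose_mult[OF K W] unfolding KW by simp
  moreover have "W\<^sup>T \<in> carrier_mat p m" "K\<^sup>T \<in> carrier_mat m p" using W K by simp_all
  moreover have "transpose_mat ` A \<subseteq> carrier_mat p s" using A by auto
  ultimately show ?thesis
    using card_left_mult_preimage[OF fin, of "W\<^sup>T" p m "K\<^sup>T" "transpose_mat ` A" s]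
    by (simp only: card_transpose_image)
qed

section \<open>The number of matrices of full column rank, that is, of linearly independent s-tuples
  in F^p\<close>

definition frames :: "nat \<Rightarrow> nat \<Rightarrow> 'a::field mat set" where
  "frames p s = {G \<in> carrier_mat p s. \<exists>C\<in>carrier_mat s p. C * G = 1\<^sub>m s}"

lemma frames_square: "frames s s = GL s"
  unfolding frames_def GL_def
  using mat_mult_left_right_inverse[of _ s] by (intro Collect_cong conj_cong refl) blast

lemma frames_0: "frames p 0 = {0\<^sub>m p 0}"
proof -
  have "G = 0\<^sub>m p 0" if "G \<in> carrier_mat p 0" for G :: "'a mat" using that by (intro eq_matI) auto
  moreover have "0\<^sub>m 0 p * (0\<^sub>m p 0 :: 'a mat) = 1\<^sub>m 0" by (intro eq_matI) auto
  ultimately show ?thesis unfolding frames_def by (auto intro!: bexI[of _ "0\<^sub>m 0 p"])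
qed

lemma frames_GL_mult:
  fixes S :: "'a::field mat"
  assumes S: "S \<in> GL p" and G: "G \<in> frames p s"
  shows "S * G \<in> frames p s"
proof -
  obtain S' where S': "dim_row S = p" "dim_col S = p" "dim_row S' = p" "dim_col S' = p" "S' * S = 1\<^sub>m p"
    using S by (rule GL_E)
  obtain C where C: "C \<in> carrier_mat s p" "C * G = 1\<^sub>m s" and Gc: "G \<in> carrier_mat p s"
    using G by (auto simp: frames_def)
  have "C * S' * (S * G) = 1\<^sub>m s"
    using S' C Gc by (simp add: mat_assoc mult_cancel_one[OF S'(5)])
  moreover have "C * S' \<in> carrier_mat s p" "S * G \<in> carrier_mat p s"
    using S' C Gc by (intro carrier_matI; simp)+
  ultimately show ?thesis unfolding frames_def by blast
qed

definition unit_block :: "'a::field mat \<Rightarrow> 'a mat \<Rightarrow> 'a mat" where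
  "unit_block y G = four_block_mat (1\<^sub>m 1) y (0\<^sub>m (dim_row G) 1) G"

text \<open>The lower right block of a left inverse of the large matrix is a left inverse of G,
  because its lower left block has to vanish. Conversely a left inverse C of G extends by the top
  row (1, - y C).\<close>

lemma unit_block_frames:
  fixes G :: "'a::field mat"
  assumes y: "y \<in> carrier_mat 1 s" and G: "G \<in> carrier_mat p s"
  shows "unit_block y G \<in> frames (Suc p) (Suc s) \<longleftrightarrow> G \<in> frames p s"
proof
  have B: "unit_block y G = four_block_mat (1\<^sub>m 1) y (0\<^sub>m p 1) G"
    using G by (simp add: unit_block_def)
  have cB: "unit_block y G \<in> carrier_mat (Suc p) (Suc s)"
    unfolding B using four_block_carrier_mat[of "1\<^sub>m 1 :: 'a mat" 1 1 G p s] G by simp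
  {
    assume "unit_block y G \<in> frames (Suc p) (Suc s)"
    then obtain C where C: "C \<in> carrier_mat (Suc s) (Suc p)" "C * unit_block y G = 1\<^sub>m (Suc s)"
      by (auto simp: frames_def)
    obtain c d e f where sp: "split_block C 1 1 = (c, d, e, f)" by (cases "split_block C 1 1")
    have cc: "c \<in> carrier_mat 1 1" "d \<in> carrier_mat 1 p" "e \<in> carrier_mat s 1" "f \<in> carrier_mat s p"
      and Ceq: "C = four_block_mat c d e f"
      using split_block[OF sp, of s p] C by auto
    have "four_block_mat (c * 1\<^sub>m 1 + d * 0\<^sub>m p 1) (c * y + d * G) (e * 1\<^sub>m 1 + f * 0\<^sub>m p 1) (e * y + f * G)
        = 1\<^sub>m (Suc s)"
      using C(2) mult_four_block_mat[OF cc one_carrier_mat y zero_carrier_mat G] unfolding Ceq B by simp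
    also have "\<dots> = four_block_mat (1\<^sub>m 1) (0\<^sub>m 1 s) (0\<^sub>m s 1) (1\<^sub>m s)" by simp
    finally have blk: "four_block_mat (c * 1\<^sub>m 1 + d * 0\<^sub>m p 1) (c * y + d * G) (e * 1\<^sub>m 1 + f * 0\<^sub>m p 1) (e * y + f * G)
        = four_block_mat (1\<^sub>m 1) (0\<^sub>m 1 s) (0\<^sub>m s 1) (1\<^sub>m s)" .
    have entry: "four_block_mat a1 b1 c1 d1 $$ (Suc i, 0) = c1 $$ (i, 0)"
      "j < s \<Longrightarrow> four_block_mat a1 b1 c1 d1 $$ (Suc i, Suc j) = d1 $$ (i, j)"
      if "a1 \<in> carrier_mat 1 1" "d1 \<in> carrier_mat s s" "i < s" for a1 b1 c1 d1 :: "'a mat" and i j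
      using that by auto
    have k1: "c * 1\<^sub>m 1 + d * 0\<^sub>m p 1 \<in> carrier_mat 1 1" "e * y + f * G \<in> carrier_mat s s"
      using cc y G by auto
    have e0: "e = 0\<^sub>m s 1"
    proof (rule eq_matI)
      fix i j assume "i < dim_row (0\<^sub>m s 1 :: 'a mat)" "j < dim_col (0\<^sub>m s 1 :: 'a mat)"
      then have i: "i < s" "j = 0" by auto
      have "(e * 1\<^sub>m 1 + f * 0\<^sub>m p 1) $$ (i, 0) = 0\<^sub>m s 1 $$ (i, 0)"
        using arg_cong[OF blk, of "\<lambda>M. M $$ (Suc i, 0)"]
          entry(1)[OF k1 i(1)] entry(1)[OF one_carrier_mat one_carrier_mat i(1)] i by simp
      also have "e * 1\<^sub>m 1 + f * 0\<^sub>m p 1 = e" using cc by simp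
      finally show "e $$ (i, j) = 0\<^sub>m s 1 $$ (i, j)" using i by simp
    qed (use cc in auto)
    have "f * G = 1\<^sub>m s"
    proof (rule eq_matI)
      fix i j assume "i < dim_row (1\<^sub>m s :: 'a mat)" "j < dim_col (1\<^sub>m s :: 'a mat)"
      then have i: "i < s" "j < s" by auto
      have "(e * y + f * G) $$ (i, j) = 1\<^sub>m s $$ (i, j)"
        using arg_cong[OF blk, of "\<lambda>M. M $$ (Suc i, Suc j)"]
          entry(2)[OF k1 i] entry(2)[OF one_carrier_mat one_carrier_mat i] i by simp
      also have "e * y + f * G = f * G" unfolding e0 using y cc G by simp
      finally show "(f * G) $$ (i, j) = 1\<^sub>m s $$ (i, j)" .
    qed (use cc G in auto)
    then show "G \<in> frames p s" using cc(4) G by (auto simp: frames_def)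
  next
    assume "G \<in> frames p s"
    then obtain C where C: "C \<in> carrier_mat s p" "C * G = 1\<^sub>m s" by (auto simp: frames_def)
    have yC: "y * C \<in> carrier_mat 1 p" using y C by auto
    have "four_block_mat (1\<^sub>m 1) (- (y * C)) (0\<^sub>m s 1) C * unit_block y G
        = four_block_mat (1\<^sub>m 1) (y + - (y * C) * G) (0\<^sub>m s 1) (1\<^sub>m s)"
      unfolding B using y C G yC
      by (subst mult_four_block_mat[of _ 1 1 _ p _ s]) auto
    also have "- (y * C) * G = - (y * C * G)" using yC G by (intro uminus_mult_left_mat[symmetric, THEN sym]) auto
    also have "y * C * G = y" using y C G by (simp add: mat_assoc)
    also have "y + - y = 0\<^sub>m 1 s" using y by (intro eq_matI) auto
    finally have "four_block_mat (1\<^sub>m 1) (- (y * C)) (0\<^sub>m s 1) C * unit_block y G = 1\<^sub>m (Suc s)" by simp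
    moreover have "four_block_mat (1\<^sub>m 1) (- (y * C)) (0\<^sub>m s 1) C \<in> carrier_mat (Suc s) (Suc p)"
      using four_block_carrier_mat[of "1\<^sub>m 1 :: 'a mat" 1 1 C s p] C by simp
    ultimately show "unit_block y G \<in> frames (Suc p) (Suc s)" using cB unfolding frames_def by blast
  }
qed

lemma card_frames_unit_col:
  assumes fin: "finite (UNIV :: 'a::field set)"
  shows "card {G \<in> (frames (Suc p) (Suc s) :: 'a mat set). col G 0 = unit_vec (Suc p) 0}
    = card (UNIV :: 'a set) ^ s * card (frames p s :: 'a mat set)"
proof -
  have "bij_betw (\<lambda>(y, G). unit_block y G) ((carrier_mat 1 s :: 'a mat set) \<times> frames p s)
    {G \<in> frames (Suc p) (Suc s). col G 0 = unit_vec (Suc p) 0}"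
  proof (rule bij_betwI')
    fix u v :: "'a mat \<times> 'a mat"
    assume "u \<in> carrier_mat 1 s \<times> frames p s" "v \<in> carrier_mat 1 s \<times> frames p s"
    then obtain y G y' G' where uv: "u = (y, G)" "v = (y', G')"
      and c: "y \<in> carrier_mat 1 s" "y' \<in> carrier_mat 1 s" "G \<in> carrier_mat p s" "G' \<in> carrier_mat p s"
      by (auto simp: frames_def)
    have "y = y' \<and> G = G'" if eq: "unit_block y G = unit_block y' G'"
    proof
      show "y = y'"
      proof (rule eq_matI)
        fix i j assume "i < dim_row y'" "j < dim_col y'"
        then show "y $$ (i, j) = y' $$ (i, j)"
          using arg_cong[OF eq, of "\<lambda>M. M $$ (0, Suc j)"] c by (simp add: unit_block_def)
      qed (use c in auto)
      show "G = G'"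
      proof (rule eq_matI)
        fix i j assume "i < dim_row G'" "j < dim_col G'"
        then show "G $$ (i, j) = G' $$ (i, j)"
          using arg_cong[OF eq, of "\<lambda>M. M $$ (Suc i, Suc j)"] c by (simp add: unit_block_def)
      qed (use c in auto)
    qed
    then show "(case u of (y, G) \<Rightarrow> unit_block y G) = (case v of (y, G) \<Rightarrow> unit_block y G) \<longleftrightarrow> u = v"
      using uv by auto
  next
    fix u :: "'a mat \<times> 'a mat"
    assume "u \<in> carrier_mat 1 s \<times> frames p s"
    then obtain y G where u: "u = (y, G)" "y \<in> carrier_mat 1 s" "G \<in> frames p s" by auto
    then have G: "G \<in> carrier_mat p s" by (simp add: frames_def)
    have "unit_block y G \<in> frames (Suc p) (Suc s)" using unit_block_frames[OF u(2) G] u by simp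
    moreover have "col (unit_block y G) 0 = unit_vec (Suc p) 0"
      using u G by (intro eq_vecI) (auto simp: unit_block_def)
    ultimately show "(case u of (y, G) \<Rightarrow> unit_block y G) \<in> {G \<in> frames (Suc p) (Suc s). col G 0 = unit_vec (Suc p) 0}"
      using u by simp
  next
    fix F :: "'a mat" assume "F \<in> {G \<in> frames (Suc p) (Suc s). col G 0 = unit_vec (Suc p) 0}"
    then have F: "F \<in> frames (Suc p) (Suc s)" "col F 0 = unit_vec (Suc p) 0" by auto
    then have Fc: "F \<in> carrier_mat (Suc p) (Suc s)" by (simp add: frames_def)
    define y where "y = mat 1 s (\<lambda>(i, j). F $$ (0, Suc j))"
    define G where "G = mat p s (\<lambda>(i, j). F $$ (Suc i, Suc j))"
    have c: "y \<in> carrier_mat 1 s" "G \<in> carrier_mat p s" by (auto simp: y_def G_def)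
    have F0: "F $$ (i, 0) = (if i = 0 then 1 else 0)" if "i < Suc p" for i
      using arg_cong[OF F(2), of "\<lambda>v. v $ i"] that Fc by simp
    have FB: "F = unit_block y G"
    proof (rule eq_matI)
      fix i j assume "i < dim_row (unit_block y G)" "j < dim_col (unit_block y G)"
      then have ij: "i < Suc p" "j < Suc s" by (auto simp: unit_block_def G_def)
      show "F $$ (i, j) = unit_block y G $$ (i, j)"
        using ij F0 by (cases i; cases j) (simp_all add: unit_block_def y_def G_def)
    qed (use Fc in \<open>simp_all add: unit_block_def G_def\<close>)
    then have "G \<in> frames p s" using unit_block_frames[OF c] F by simp
    then show "\<exists>u\<in>carrier_mat 1 s \<times> frames p s. F = (case u of (y, G) \<Rightarrow> unit_block y G)"
      using c(1) FB by (intro bexI[of _ "(y, G)"]) auto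
  qed
  then have "card {G \<in> (frames (Suc p) (Suc s) :: 'a mat set). col G 0 = unit_vec (Suc p) 0}
      = card ((carrier_mat 1 s :: 'a mat set) \<times> (frames p s :: 'a mat set))"
    by (rule bij_betw_same_card[symmetric])
  then show ?thesis by (simp add: card_cartesian_product card_carrier_mat[OF fin])
qed

text \<open>Choose j with nonzero j-th entry of x: a swap moves the first unit vector to the j-th,
  and replacing column j moves that one to x.\<close>

lemma GL_first_col:
  fixes x :: "'a::field vec"
  assumes x: "x \<in> carrier_vec p" "x \<noteq> 0\<^sub>v p"
  obtains S where "S \<in> GL p" "S *\<^sub>v unit_vec p 0 = x"
proof -
  obtain j where j: "j < p" "x $ j \<noteq> 0"
    using x by (metis carrier_vecD eq_vecI index_zero_vec)
  have "replace_col p j x \<in> GL p" using replace_col_inverse[OF j] GL_I[of "replace_col p j x" p] replace_col_dim(3) by metis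
  moreover have "swaprows_mat p 0 j \<in> (GL p :: 'a mat set)" using j by (intro swaprows_mat_GL) auto
  moreover have "replace_col p j x * swaprows_mat p 0 j *\<^sub>v unit_vec p 0 = x"
  proof -
    have "(swaprows_mat p 0 j :: 'a mat) *\<^sub>v unit_vec p 0 = unit_vec p j"
      using j by (intro eq_vecI) (auto simp: scalar_prod_right_unit)
    moreover have "replace_col p j x *\<^sub>v unit_vec p j = x"
      using j x by (intro eq_vecI) (auto simp: scalar_prod_right_unit replace_col_def)
    ultimately show ?thesis
      using assoc_mult_mat_vec[OF replace_col_dim(3) swaprows_mat_carrier unit_vec_carrier, of p j x 0 j 0] by simp
  qed
  ultimately show ?thesis using that GL_mult by blast
qed

lemma frames_col_nonzero:
  fixes G :: "'a::field mat"
  assumes "G \<in> frames p (Suc s)"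
  shows "col G 0 \<noteq> 0\<^sub>v p"
proof
  assume 0: "col G 0 = 0\<^sub>v p"
  obtain C where C: "C \<in> carrier_mat (Suc s) p" "C * G = 1\<^sub>m (Suc s)" and G: "G \<in> carrier_mat p (Suc s)"
    using assms by (auto simp: frames_def)
  have "row C 0 \<in> carrier_vec p" using C(1) by auto
  then have "(C * G) $$ (0, 0) = 0" using C(1) G 0 by simp
  then show False unfolding C(2) by simp
qed

lemma card_carrier_vec:
  assumes "finite (UNIV :: 'a set)"
  shows "finite (carrier_vec p :: 'a vec set)" "card (carrier_vec p :: 'a vec set) = card (UNIV :: 'a set) ^ p"
proof -
  have "bij_betw (\<lambda>A. col A 0) (carrier_mat p 1 :: 'a mat set) (carrier_vec p)"
  proof (rule bij_betw_byWitness[where f' = "\<lambda>v. mat p 1 (\<lambda>(i, j). v $ i)"])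
    show "\<forall>A\<in>carrier_mat p 1. mat p 1 (\<lambda>(i, j). col A 0 $ i) = (A :: 'a mat)"
      by (auto intro!: eq_matI)
  qed (auto intro!: eq_vecI)
  from bij_betw_same_card[OF this] bij_betw_finite[OF this]
  show "finite (carrier_vec p :: 'a vec set)" "card (carrier_vec p :: 'a vec set) = card (UNIV :: 'a set) ^ p"
    using card_carrier_mat[OF assms, of p 1] finite_carrier_mat[OF assms, of p 1] by auto
qed

text \<open>The first column ranges over the nonzero vectors. Since the general linear group is
  transitive on these, all fibres have the size of the one over the first unit vector.\<close>

lemma card_frames_Suc:
  assumes fin: "finite (UNIV :: 'a::field set)"
  shows "card (frames (Suc p) (Suc s) :: 'a mat set)
    = (card (UNIV :: 'a set) ^ Suc p - 1) * (card (UNIV :: 'a set) ^ s * card (frames p s :: 'a mat set))"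
proof -
  let ?F = "frames (Suc p) (Suc s) :: 'a mat set" and ?V = "carrier_vec (Suc p) :: 'a vec set"
  let ?k = "card (UNIV :: 'a set) ^ s * card (frames p s :: 'a mat set)"
  have F_fin: "finite ?F" using finite_carrier_mat[OF fin] unfolding frames_def by auto
  have fib: "card {G \<in> ?F. col G 0 = x} = ?k" if x: "x \<in> ?V" "x \<noteq> 0\<^sub>v (Suc p)" for x
  proof -
    obtain S where S: "S \<in> GL (Suc p)" "S *\<^sub>v unit_vec (Suc p) 0 = x" using GL_first_col[OF x] .
    obtain S' where S': "S' \<in> GL (Suc p)" "S * S' = 1\<^sub>m (Suc p)" "S' * S = 1\<^sub>m (Suc p)"
      using S(1) by (rule GL_E)
    note Sc = GL_carrier[OF S(1)] GL_carrier[OF S'(1)]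
    have S'x: "S' *\<^sub>v x = unit_vec (Suc p) 0"
      unfolding S(2)[symmetric]
      using assoc_mult_mat_vec[OF Sc(2,1) unit_vec_carrier, of 0] S'(3) by simp
    have colm: "col (T * G) 0 = T *\<^sub>v col G 0" if "T \<in> GL (Suc p)" "G \<in> ?F" for T G
      using that by (intro col_mult2[OF GL_carrier[OF that(1)], of _ "Suc s"]) (auto simp: frames_def)
    have cancel: "A * (B * G) = G" if "A * B = 1\<^sub>m (Suc p)" "A \<in> GL (Suc p)" "B \<in> GL (Suc p)" "G \<in> ?F"
      for A B G
      using that by (intro mult_cancel_one[OF that(1)]) (auto simp: frames_def GL_dim)
    have "bij_betw (\<lambda>G. S * G) {G \<in> ?F. col G 0 = unit_vec (Suc p) 0} {G \<in> ?F. col G 0 = x}"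
      by (rule bij_betw_byWitness[where f' = "\<lambda>G. S' * G"])
        (use S S' S'x cancel in \<open>auto simp: colm frames_GL_mult\<close>)
    from bij_betw_same_card[OF this] show ?thesis using card_frames_unit_col[OF fin, of p s] by simp
  qed
  have colV: "col G 0 \<in> ?V - {0\<^sub>v (Suc p)}" if "G \<in> ?F" for G
  proof -
    have "dim_row G = Suc p" using that by (auto simp: frames_def)
    then have "col G 0 \<in> ?V" by (metis col_dim)
    then show ?thesis using frames_col_nonzero[OF that] by simp
  qed
  have "card ?F = (\<Sum>x\<in>?V - {0\<^sub>v (Suc p)}. card {G \<in> ?F. col G 0 = x})"
  proof -
    have "card ?F = card (\<Union>x\<in>?V - {0\<^sub>v (Suc p)}. {G \<in> ?F. col G 0 = x})"
      using colV by (intro arg_cong[of _ _ card]) auto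
    also have "\<dots> = (\<Sum>x\<in>?V - {0\<^sub>v (Suc p)}. card {G \<in> ?F. col G 0 = x})"
      using card_carrier_vec[OF fin] F_fin by (intro card_UN_disjoint) auto
    finally show ?thesis .
  qed
  also have "\<dots> = (\<Sum>x\<in>?V - {0\<^sub>v (Suc p)}. ?k)" using fib by (intro sum.cong) auto
  also have "\<dots> = card (?V - {0\<^sub>v (Suc p)}) * ?k" by simp
  also have "card (?V - {0\<^sub>v (Suc p)}) = card (UNIV :: 'a set) ^ Suc p - 1"
    using card_carrier_vec[OF fin, of "Suc p"] by (subst card_Diff_singleton) auto
  finally show ?thesis .
qed

lemma q_fact_Suc: "q_fact q (Suc s) = q_fact q s * (\<Sum>j<Suc s. q ^ j)"
  by (simp add: q_fact_def)

text \<open>Frames modulo changes of basis are s-dimensional subspaces of F^p, counted by the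
  q-binomial; the equation is multiplied out to stay in the natural numbers. The recursion for
  frames is applied both to p and, as \<open>GL s\<close> is \<open>frames s s\<close>, to s
  itself.\<close>

lemma card_frames_ratio:
  assumes fin: "finite (UNIV :: 'a::field set)" and q: "q = card (UNIV :: 'a set)" and le: "s \<le> p"
  shows "card (frames p s :: 'a mat set) * (q_fact q s * q_fact q (p - s))
    = card (GL s :: 'a mat set) * q_fact q p"
  using le
proof (induction s arbitrary: p)
  case 0
  then show ?case by (simp add: frames_square[symmetric] frames_0 q_fact_def)
next
  case (Suc s)
  then obtain p' where p: "p = Suc p'" "s \<le> p'" by (cases p) auto
  have "q > 0" using fin unfolding q by (intro card_gt_0_iff[THEN iffD2]) auto
  then obtain q' where q': "q = Suc q'" by (cases q) auto
  \<comment> \<open>The geometric sum, with q' for q - 1 so that truncated subtraction stays out of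
    the induction.\<close>
  have "q' * (\<Sum>j<k. q ^ j) + 1 = q ^ k" for k
    by (induction k) (auto simp: q' algebra_simps)
  then have geo: "q ^ k - 1 = (q - 1) * (\<Sum>j<k. q ^ j)" for k
    by (metis q' diff_Suc_1 diff_add_inverse2)
  have F: "card (frames (Suc a) (Suc s) :: 'a mat set)
      = (q - 1) * (\<Sum>j<Suc a. q ^ j) * q ^ s * card (frames a s :: 'a mat set)" for a
    using card_frames_Suc[OF fin, of a s] unfolding q[symmetric] geo by (simp add: mult.assoc)
  show ?case
    using Suc.IH[OF p(2)] F[of p'] F[of s]
    unfolding p frames_square[symmetric] q_fact_Suc by (simp del: sum.lessThan_Suc add: ac_simps)
qed

section \<open>R-classes, L-classes and ranks\<close>

context sandwich_dims
begin

section \<open>Factorizations G H of the regular elements of rank s\<close>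

definition col_frames :: "nat \<Rightarrow> 'a::field mat set" where
  "col_frames s = {G \<in> carrier_mat m s. V * G \<in> frames r s}"

text \<open>Transposed, so that \<open>frames\<close> and its cardinality serve for both
  factors.\<close>

definition row_frames :: "nat \<Rightarrow> 'a::field mat set" where
  "row_frames s = {H \<in> carrier_mat s n. (H * U)\<^sup>T \<in> frames r s}"

text \<open>This is H J G with J = U V written out, nested as the simplifier normalizes
  products.\<close>

definition middle :: "'a::field mat \<Rightarrow> 'a mat \<Rightarrow> 'a mat" where
  "middle H G = H * (U * (V * G))"

lemma middle_dim [simp]: "dim_row (middle H G) = dim_row H" "dim_col (middle H G) = dim_col G"
  by (simp_all add: middle_def)

lemma col_frames_I:
  assumes "G \<in> carrier_mat m s" "C \<in> carrier_mat s r" "C * (V * G) = 1\<^sub>m s"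
  shows "G \<in> col_frames s"
  using assms mult_carrier_mat[OF partial_id_dim(3) assms(1)] unfolding col_frames_def frames_def by blast

lemma col_frames_E:
  fixes G :: "'a::field mat"
  assumes "G \<in> col_frames s"
  obtains C where "dim_row G = m" "dim_col G = s" "dim_row C = s" "dim_col C = r" "C * (V * G) = 1\<^sub>m s"
  using assms unfolding col_frames_def frames_def by auto

lemma row_frames_I:
  fixes H :: "'a::field mat"
  assumes H: "H \<in> carrier_mat s n" and D: "D \<in> carrier_mat r s" and HD: "H * (U * D) = 1\<^sub>m s"
  shows "H \<in> row_frames s"
proof -
  have HU: "H * U \<in> carrier_mat s r" using H by (rule mult_carrier_mat) simp
  have "D\<^sup>T * (H * U)\<^sup>T = (H * U * D)\<^sup>T" using transpose_mult[OF HU D] ..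
  also have "H * U * D = 1\<^sub>m s" using H D HD by (simp add: mat_assoc)
  finally have "D\<^sup>T * (H * U)\<^sup>T = 1\<^sub>m s" by simp
  moreover have "D\<^sup>T \<in> carrier_mat s r" "(H * U)\<^sup>T \<in> carrier_mat r s" using D HU by simp_all
  ultimately show ?thesis using H unfolding row_frames_def frames_def by blast
qed

lemma row_frames_E:
  fixes H :: "'a::field mat"
  assumes "H \<in> row_frames s"
  obtains D where "dim_row H = s" "dim_col H = n" "dim_row D = r" "dim_col D = s" "H * (U * D) = 1\<^sub>m s"
proof -
  obtain C where H: "H \<in> carrier_mat s n" and C: "C \<in> carrier_mat s r" "C * (H * U)\<^sup>T = 1\<^sub>m s"
    using assms by (auto simp: row_frames_def frames_def)
  have HU: "(H * U)\<^sup>T \<in> carrier_mat r s" using H by (intro carrier_matI) simp_all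
  have "H * U * C\<^sup>T = (C * (H * U)\<^sup>T)\<^sup>T" using transpose_mult[OF C(1) HU] by simp
  then have "H * (U * C\<^sup>T) = 1\<^sub>m s" using C H by (simp add: mat_assoc)
  then show ?thesis using that[of "C\<^sup>T"] H C by simp
qed

lemma col_frames_dim: "G \<in> col_frames s \<Longrightarrow> dim_row G = m" "G \<in> col_frames s \<Longrightarrow> dim_col G = s"
  by (auto simp: col_frames_def)

lemma row_frames_dim: "H \<in> row_frames s \<Longrightarrow> dim_row H = s" "H \<in> row_frames s \<Longrightarrow> dim_col H = n"
  by (auto simp: row_frames_def)

lemma col_frames_mult_GL:
  fixes G :: "'a::field mat"
  assumes G: "G \<in> col_frames s" and Z: "Z \<in> GL s"
  shows "G * Z \<in> col_frames s"
proof -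
  obtain C where C: "dim_row G = m" "dim_col G = s" "dim_row C = s" "dim_col C = r" "C * (V * G) = 1\<^sub>m s"
    using G by (rule col_frames_E)
  obtain Z' where Z': "dim_row Z = s" "dim_col Z = s" "dim_row Z' = s" "dim_col Z' = s" "Z' * Z = 1\<^sub>m s"
    using Z by (rule GL_E)
  have CVG: "C * (V * (G * Y)) = Y" if "dim_row Y = s" for Y
    using mult_cancel_one[OF C(5), of Y] C that by (simp add: mat_assoc)
  show ?thesis
    by (rule col_frames_I[where C = "Z' * C"]) ((use C Z' in \<open>intro carrier_matI; simp\<close>) | (use C Z' in \<open>simp add: mat_assoc CVG\<close>))+
qed

lemma row_frames_mult_GL:
  fixes H :: "'a::field mat"
  assumes H: "H \<in> row_frames s" and Z: "Z \<in> GL s"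
  shows "Z * H \<in> row_frames s"
proof -
  obtain D where D: "dim_row H = s" "dim_col H = n" "dim_row D = r" "dim_col D = s" "H * (U * D) = 1\<^sub>m s"
    using H by (rule row_frames_E)
  obtain Z' where Z': "dim_row Z = s" "dim_col Z = s" "dim_row Z' = s" "dim_col Z' = s" "Z * Z' = 1\<^sub>m s"
    using Z by (rule GL_E)
  have HUD: "H * (U * (D * Y)) = Y" if "dim_row Y = s" for Y
    using mult_cancel_one[OF D(5), of Y] D that by (simp add: mat_assoc)
  show ?thesis
    by (rule row_frames_I[where D = "D * Z'"]) ((use D Z' in \<open>intro carrier_matI; simp\<close>) | (use D Z' in \<open>simp add: mat_assoc HUD\<close>))+
qed

lemma star_GH:
  assumes "G \<in> col_frames s" "H \<in> row_frames s" "G' \<in> col_frames s" "H' \<in> row_frames s"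
  shows "(G * H) \<star> (G' * H') = G * (middle H G' * H')"
  using assms by (simp add: star_eq col_frames_dim row_frames_dim middle_def mat_assoc)

lemma rank_GH:
  fixes G :: "'a::field mat"
  assumes G: "G \<in> col_frames s" and H: "H \<in> row_frames s"
  shows "vec_space.rank m (G * H) = s"
proof -
  obtain C where C: "dim_row G = m" "dim_col G = s" "dim_row C = s" "dim_col C = r" "C * (V * G) = 1\<^sub>m s"
    using G by (rule col_frames_E)
  obtain D where D: "dim_row H = s" "dim_col H = n" "dim_row D = r" "dim_col D = s" "H * (U * D) = 1\<^sub>m s"
    using H by (rule row_frames_E)
  show ?thesis
    by (rule rank_eq_inner_dim[where C = "C * V" and D = "U * D" and m = n])
      ((use C D in \<open>intro carrier_matI; simp\<close>) | (use C D in \<open>simp add: mat_assoc\<close>))+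
qed

lemma DJ_I:
  fixes G :: "'a::field mat"
  assumes G: "G \<in> col_frames s" and H: "H \<in> row_frames s"
  shows "G * H \<in> DJ m n r s"
proof -
  obtain C where C: "dim_row G = m" "dim_col G = s" "dim_row C = s" "dim_col C = r" "C * (V * G) = 1\<^sub>m s"
    using G by (rule col_frames_E)
  obtain D where D: "dim_row H = s" "dim_col H = n" "dim_row D = r" "dim_col D = s" "H * (U * D) = 1\<^sub>m s"
    using H by (rule row_frames_E)
  \<comment> \<open>D and C invert H U and V G from one side, and the standard embeddings cancel
    against V and U. Hence G H J Y J G H = G (H U D) (C V G) H = G H.\<close>
  let ?Y = "partial_id m r r * (D * (C * partial_id r n r))"
  have CVG: "C * (V * (G * Y)) = Y" if "dim_row Y = s" for Y
    using mult_cancel_one[OF C(5), of Y] C that by (simp add: mat_assoc)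
  have HUD: "H * (U * (D * Y)) = Y" if "dim_row Y = s" for Y
    using mult_cancel_one[OF D(5), of Y] D that by (simp add: mat_assoc)
  have "(G * H) \<star> ?Y \<star> (G * H) = G * H"
    using C(1-4) D(1-4)
    by (simp add: star_eq mat_assoc mult_cancel_one[OF VK[OF partial_id_top_unit]] mult_cancel_one[OF LU[OF partial_id_left_unit]] CVG HUD)
  moreover have "G * H \<in> carrier_mat m n" "?Y \<in> carrier_mat m n"
    using C(1-4) D(1-4) by (intro carrier_matI; simp)+
  ultimately have "G * H \<in> RegJ m n r"
    unfolding RegJ_def regular_elements_def by force
  then show ?thesis using rank_GH[OF G H] by (simp add: DJ_def)
qed

lemma DJ_E:
  fixes X :: "'a::field mat"
  assumes "X \<in> DJ m n r s"
  obtains G H where "G \<in> col_frames s" "H \<in> row_frames s" "X = G * H"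
proof -
  have X: "X \<in> RegJ m n r" "vec_space.rank m X = s" using assms by (auto simp: DJ_def)
  obtain K A L where 1: "K \<in> top_unit" "L \<in> left_unit" "A \<in> carrier_mat r r" "X = K * A * L" using RegJ_E[OF X(1)] .
  then have "vec_space.rank r A = s" using X by (simp add: rank_KAL)
  then obtain G H C D where f: "dim_row G = r" "dim_col G = s" "dim_row H = s" "dim_col H = r"
    "dim_row C = s" "dim_col C = r" "dim_row D = r" "dim_col D = s"
    "A = G * H" "C * G = 1\<^sub>m s" "H * D = (1\<^sub>m s :: 'a mat)"
    using rank_factor[OF 1(3)] by blast
  have "K * G \<in> col_frames s"
    by (rule col_frames_I[where C = C])
      ((use f(1-8) 1 in \<open>intro carrier_matI; simp\<close>) | (use f(1-8) 1 in \<open>simp add: top_unit_dim mult_cancel_one[OF VK] f(10)\<close>))+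
  moreover have "H * L \<in> row_frames s"
    by (rule row_frames_I[where D = D])
      ((use f(1-8) 1 in \<open>intro carrier_matI; simp\<close>) | (use f(1-8) 1 in \<open>simp add: left_unit_dim mat_assoc mult_cancel_one[OF LU] f(11)\<close>))+
  moreover have "X = (K * G) * (H * L)"
    unfolding 1(4) f(9) using f(1-8) 1(1,2) by (simp add: mat_assoc top_unit_dim left_unit_dim)
  ultimately show ?thesis using that by blast
qed

lemma col_frames_nonempty: "s \<le> r \<Longrightarrow> col_frames s \<noteq> {}"
  and row_frames_nonempty: "s \<le> r \<Longrightarrow> row_frames s \<noteq> {}"
  using DJ_nonempty[of s] by (auto elim!: DJ_E)

lemma GH_unique:
  fixes G :: "'a::field mat"
  assumes G: "G \<in> col_frames s" "G' \<in> col_frames s" and H: "H \<in> row_frames s" "H' \<in> row_frames s" and eq: "G * H = G' * H'"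
  obtains Z where "Z \<in> GL s" "G' = G * Z" "H = Z * H'"
proof -
  obtain C where C: "dim_row G = m" "dim_col G = s" "dim_row C = s" "dim_col C = r" "C * (V * G) = 1\<^sub>m s"
    using G(1) by (rule col_frames_E)
  obtain C' where C': "dim_row G' = m" "dim_col G' = s" "dim_row C' = s" "dim_col C' = r" "C' * (V * G') = 1\<^sub>m s"
    using G(2) by (rule col_frames_E)
  obtain D where D: "dim_row H' = s" "dim_col H' = n" "dim_row D = r" "dim_col D = s" "H' * (U * D) = 1\<^sub>m s"
    using H(2) by (rule row_frames_E)
  have d: "dim_row H = s" "dim_col H = n" using H by (simp_all add: row_frames_dim)
  \<comment> \<open>Multiplying G H = G' H' by U D on the right turns it into G Z = G', so no other
    choice is possible.\<close>
  define Z where "Z = H * (U * D)"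
  have dZ: "dim_row Z = s" "dim_col Z = s" using d D by (simp_all add: Z_def)
  have "G * Z = (G * H) * (U * D)" unfolding Z_def using C(1,2) d D(1-4) by (simp add: mat_assoc)
  also have "\<dots> = G'" unfolding eq using C'(1,2) D(1-4) by (simp add: mat_assoc D(5))
  finally have GZ: "G' = G * Z" ..
  have "(C' * (V * G)) * Z = 1\<^sub>m s"
    using C'(3-5) C(1,2) dZ unfolding GZ by (simp add: mat_assoc)
  then have Z: "Z \<in> GL s"
    by (rule GL_I2[rotated 2]) (use dZ C C' in \<open>intro carrier_matI; simp\<close>)+
  have CVG: "C * (V * (G * Y)) = Y" if "dim_row Y = s" for Y
    using mult_cancel_one[OF C(5), of Y] C that by (simp add: mat_assoc)
  have "H = C * (V * (G * H))" using CVG d by simp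
  also have "\<dots> = C * (V * (G * (Z * H')))" unfolding eq GZ using C(1,2) dZ D(1) by (simp add: mat_assoc)
  also have "\<dots> = Z * H'" using CVG dZ by simp
  finally show ?thesis using that Z GZ by blast
qed

section \<open>Labels of R-classes and L-classes, and the graph of group H-classes\<close>

definition col_class :: "nat \<Rightarrow> 'a::field mat \<Rightarrow> 'a mat set" where
  "col_class s G = (\<lambda>Z. G * Z) ` GL s"

definition row_class :: "nat \<Rightarrow> 'a::field mat \<Rightarrow> 'a mat set" where
  "row_class s H = (\<lambda>Z. Z * H) ` GL s"

lemma col_class_self: "G \<in> col_frames s \<Longrightarrow> G \<in> col_class s G"
  unfolding col_class_def by (rule image_eqI[OF _ one_GL]) (simp add: col_frames_dim mat_assoc)

lemma row_class_self: "H \<in> row_frames s \<Longrightarrow> H \<in> row_class s H"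
  unfolding row_class_def by (rule image_eqI[OF _ one_GL]) (simp add: row_frames_dim mat_assoc)

lemma col_class_mult:
  fixes G :: "'a::field mat"
  assumes "G \<in> col_frames s" "Z \<in> GL s"
  shows "col_class s (G * Z) = col_class s G"
proof -
  have sub: "col_class s (G * Z) \<subseteq> col_class s G" if "G \<in> col_frames s" "Z \<in> GL s" for G Z :: "'a mat"
    unfolding col_class_def using that GL_mult[OF that(2)]
    by (auto simp: mat_assoc col_frames_dim GL_dim)
  obtain Z' where Z': "Z' \<in> GL s" "Z * Z' = 1\<^sub>m s" using assms(2) by (rule GL_E)
  have "G * Z * Z' = G" using assms Z' by (simp add: mat_assoc col_frames_dim GL_dim)
  then show ?thesis using sub[OF assms] sub[OF col_frames_mult_GL[OF assms] Z'(1)] by simp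
qed

lemma row_class_mult:
  fixes H :: "'a::field mat"
  assumes "H \<in> row_frames s" "Z \<in> GL s"
  shows "row_class s (Z * H) = row_class s H"
proof -
  have sub: "row_class s (Z * H) \<subseteq> row_class s H" if "H \<in> row_frames s" "Z \<in> GL s" for H Z :: "'a mat"
  proof
    fix Y assume "Y \<in> row_class s (Z * H)"
    then obtain W where W: "W \<in> GL s" "Y = W * (Z * H)" by (auto simp: row_class_def)
    then have "Y = W * Z * H" using that by (simp add: mat_assoc row_frames_dim GL_dim)
    then show "Y \<in> row_class s H" using GL_mult[OF W(1) that(2)] by (auto simp: row_class_def)
  qed
  obtain Z' where Z': "Z' \<in> GL s" "Z' * Z = 1\<^sub>m s" using assms(2) by (rule GL_E)
  have "Z' * (Z * H) = H" using assms Z' by (intro mult_cancel_one[OF Z'(2)]) (simp_all add: row_frames_dim GL_dim)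
  then show ?thesis using sub[OF assms] sub[OF row_frames_mult_GL[OF assms] Z'(1)] by simp
qed

lemma col_class_eqD:
  assumes "G \<in> col_frames s" "G' \<in> col_frames s" "col_class s G' = col_class s G"
  obtains Z where "Z \<in> GL s" "G' = G * Z"
  using col_class_self[OF assms(2)] unfolding assms(3) by (auto simp: col_class_def)

lemma row_class_eqD:
  assumes "H \<in> row_frames s" "H' \<in> row_frames s" "row_class s H' = row_class s H"
  obtains Z where "Z \<in> GL s" "H' = Z * H"
  using row_class_self[OF assms(2)] unfolding assms(3) by (auto simp: row_class_def)

lemma GH_cls_unique:
  assumes "G \<in> col_frames s" "G' \<in> col_frames s" "H \<in> row_frames s" "H' \<in> row_frames s" "G * H = G' * H'"
  shows "col_class s G = col_class s G'" "row_class s H = row_class s H'"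
  using GH_unique[OF assms] col_class_mult[OF assms(1)] row_class_mult[OF assms(4)] by metis+

text \<open>Labels of the R-class and of the L-class; they are meaningful only on \<open>DJ m n r s\<close>.\<close>

definition R_label :: "nat \<Rightarrow> 'a::field mat \<Rightarrow> 'a mat set" where
  "R_label s X = (THE c. \<exists>G\<in>col_frames s. \<exists>H\<in>row_frames s. X = G * H \<and> c = col_class s G)"

definition L_label :: "nat \<Rightarrow> 'a::field mat \<Rightarrow> 'a mat set" where
  "L_label s X = (THE d. \<exists>G\<in>col_frames s. \<exists>H\<in>row_frames s. X = G * H \<and> d = row_class s H)"

lemma R_label_GH: "G \<in> col_frames s \<Longrightarrow> H \<in> row_frames s \<Longrightarrow> R_label s (G * H) = col_class s G"
  unfolding R_label_def by (rule the_equality) (auto dest: GH_cls_unique(1))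

lemma L_label_GH: "G \<in> col_frames s \<Longrightarrow> H \<in> row_frames s \<Longrightarrow> L_label s (G * H) = row_class s H"
  unfolding L_label_def by (rule the_equality) (auto dest: GH_cls_unique(2))

text \<open>The pairs of an R-class and an L-class whose intersection contains an idempotent.\<close>

definition group_classes :: "nat \<Rightarrow> ('a::field mat set \<times> 'a mat set) set" where
  "group_classes s = {(col_class s G, row_class s H) | G H. G \<in> col_frames s \<and> H \<in> row_frames s \<and> middle H G \<in> GL s}"

text \<open>Other representatives change \<open>middle\<close> only by invertible factors on either
  side.\<close>

lemma group_classes_iff:
  fixes G :: "'a::field mat"
  assumes G: "G \<in> col_frames s" and H: "H \<in> row_frames s"
  shows "(col_class s G, row_class s H) \<in> group_classes s \<longleftrightarrow> middle H G \<in> GL s"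
proof
  assume "(col_class s G, row_class s H) \<in> group_classes s"
  then obtain G' H' where 1: "G' \<in> col_frames s" "H' \<in> row_frames s" "middle H' G' \<in> GL s"
    "col_class s G = col_class s G'" "row_class s H = row_class s H'"
    by (auto simp: group_classes_def)
  obtain Z where Z: "Z \<in> GL s" "G = G' * Z" using col_class_eqD[OF 1(1) G 1(4)] .
  obtain W where W: "W \<in> GL s" "H = W * H'" using row_class_eqD[OF 1(2) H 1(5)] .
  have "middle H G = W * middle H' G' * Z"
    unfolding Z(2) W(2) middle_def using 1(1,2) Z(1) W(1)
    by (simp add: mat_assoc col_frames_dim row_frames_dim GL_dim)
  then show "middle H G \<in> GL s" using 1(3) Z W GL_mult by metis
next
  assume "middle H G \<in> GL s"
  then show "(col_class s G, row_class s H) \<in> group_classes s" using G H by (auto simp: group_classes_def)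
qed

text \<open>The product is G * middle H G' * H', so its rank is at most that of the s x s matrix in
  the middle; rank s forces the latter to be invertible.\<close>

lemma star_DJ:
  fixes G :: "'a::field mat"
  assumes G: "G \<in> col_frames s" "G' \<in> col_frames s" and H: "H \<in> row_frames s" "H' \<in> row_frames s"
  shows "(G * H) \<star> (G' * H') \<in> DJ m n r s \<longleftrightarrow> middle H G' \<in> GL s"
proof
  assume "middle H G' \<in> GL s"
  then show "(G * H) \<star> (G' * H') \<in> DJ m n r s"
    unfolding star_GH[OF G(1) H(1) G(2) H(2)] using G H row_frames_mult_GL by (intro DJ_I) auto
next
  assume D: "(G * H) \<star> (G' * H') \<in> DJ m n r s"
  have c: "middle H G' \<in> carrier_mat s s" "G \<in> carrier_mat m s" "H' \<in> carrier_mat s n"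
    using G H by (intro carrier_matI; simp add: col_frames_dim row_frames_dim)+
  have "(G * H) \<star> (G' * H') = G * middle H G' * H'"
    using star_GH[OF G(1) H(1) G(2) H(2)] c by (simp add: mat_assoc)
  then have "s \<le> vec_space.rank s (middle H G')"
    using D rank_mult_le[OF c] by (simp add: DJ_def)
  then show "middle H G' \<in> GL s" using full_rank_GL[OF c(1)] by simp
qed

text \<open>If M = \<open>middle H G'\<close> is invertible, then G * (M * H') is again a
  factorization, with G unchanged and H' moved only within its orbit. This is all that the graph
  argument uses of the multiplication.\<close>

lemma star_DJ_labels:
  fixes X Y :: "'a::field mat"
  assumes X: "X \<in> DJ m n r s" and Y: "Y \<in> DJ m n r s"
  shows "X \<star> Y \<in> DJ m n r s \<longleftrightarrow> (R_label s Y, L_label s X) \<in> group_classes s"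
    and "X \<star> Y \<in> DJ m n r s \<Longrightarrow> R_label s (X \<star> Y) = R_label s X"
    and "X \<star> Y \<in> DJ m n r s \<Longrightarrow> L_label s (X \<star> Y) = L_label s Y"
proof -
  obtain G H where 1: "G \<in> col_frames s" "H \<in> row_frames s" "X = G * H" using DJ_E[OF X] .
  obtain G' H' where 2: "G' \<in> col_frames s" "H' \<in> row_frames s" "Y = G' * H'" using DJ_E[OF Y] .
  show iff: "X \<star> Y \<in> DJ m n r s \<longleftrightarrow> (R_label s Y, L_label s X) \<in> group_classes s"
    unfolding 1(3) 2(3) R_label_GH[OF 2(1,2)] L_label_GH[OF 1(1,2)] group_classes_iff[OF 2(1) 1(2)]
    by (rule star_DJ[OF 1(1) 2(1) 1(2) 2(2)])
  assume XY: "X \<star> Y \<in> DJ m n r s"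
  then have M: "middle H G' \<in> GL s"
    unfolding 1(3) 2(3) star_DJ[OF 1(1) 2(1) 1(2) 2(2)] .
  have "X \<star> Y = G * (middle H G' * H')" unfolding 1(3) 2(3) by (rule star_GH[OF 1(1,2) 2(1,2)])
  then show "R_label s (X \<star> Y) = R_label s X" "L_label s (X \<star> Y) = L_label s Y"
    using R_label_GH[OF 1(1) row_frames_mult_GL[OF 2(2) M]] L_label_GH[OF 1(1) row_frames_mult_GL[OF 2(2) M]]
      R_label_GH[OF 1(1,2)] L_label_GH[OF 2(1,2)] row_class_mult[OF 2(2) M] 1(3) 2(3) by simp_all
qed

lemma idempotent_label:
  assumes "X \<in> idempotents_in star (DJ m n r s)"
  shows "(R_label s X, L_label s X) \<in> group_classes s"
proof -
  have "X \<in> DJ m n r s" "X \<star> X \<in> DJ m n r s" using assms by (auto simp: idempotents_in_def)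
  then show ?thesis using star_DJ_labels(1) by blast
qed

lemma DJ_star_cases:
  fixes X Y :: "'a::field mat"
  assumes "X \<in> IJ m n r s" "Y \<in> IJ m n r s" "X \<star> Y \<in> DJ m n r s"
  shows "X \<in> DJ m n r s" "Y \<in> DJ m n r s"
  using assms rank_star_left[of X Y] rank_star_right[of X Y]
  by (auto simp: IJ_eq DJ_def RegJ_carrier)

lemma idempotent_exists:
  fixes c d :: "'a::field mat set"
  assumes "(c, d) \<in> group_classes s"
  shows "\<exists>X\<in>idempotents_in star (DJ m n r s). R_label s X = c \<and> L_label s X = d"
proof -
  obtain G H where 1: "G \<in> col_frames s" "H \<in> row_frames s" "middle H G \<in> GL s" "c = col_class s G" "d = row_class s H"
    using assms by (auto simp: group_classes_def)
  obtain N where N: "N \<in> GL s" "N * middle H G = 1\<^sub>m s" using 1(3) by (rule GL_E)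
  \<comment> \<open>Absorbing the inverse N of \<open>middle H G\<close> into H leaves the L-class
    alone and makes the new middle factor the identity.\<close>
  let ?X = "G * (N * H)"
  have NH: "N * H \<in> row_frames s" using row_frames_mult_GL 1 N by blast
  have "middle (N * H) G = 1\<^sub>m s"
    using N 1 by (simp add: middle_def mat_assoc col_frames_dim row_frames_dim GL_dim)
  then have "?X \<star> ?X = ?X"
    using star_GH[OF 1(1) NH 1(1) NH] N(1) 1(2) by (simp add: mat_assoc row_frames_dim GL_dim)
  then have "?X \<in> idempotents_in star (DJ m n r s)"
    using DJ_I[OF 1(1) NH] by (simp add: idempotents_in_def)
  moreover have "R_label s ?X = c" "L_label s ?X = d"
    using R_label_GH[OF 1(1) NH] L_label_GH[OF 1(1) NH] row_class_mult[OF 1(2) N(1)] 1(4,5) by simp_all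
  ultimately show ?thesis by blast
qed

lemma group_classes_sub: "group_classes s \<subseteq> (col_class s ` col_frames s) \<times> (row_class s ` row_frames s)"
  by (auto simp: group_classes_def)

lemma R_label_mem: "X \<in> DJ m n r s \<Longrightarrow> R_label s X \<in> col_class s ` col_frames s"
  by (elim DJ_E) (simp add: R_label_GH)

lemma L_label_mem: "X \<in> DJ m n r s \<Longrightarrow> L_label s X \<in> row_class s ` row_frames s"
  by (elim DJ_E) (simp add: L_label_GH)

lemma DJ_subset_IJ: "DJ m n r s \<subseteq> IJ m n r s"
  by (auto simp: IJ_def)

text \<open>A union of components contains the R-class of an idempotent of \<open>DJ m n r s\<close> iff it contains its
  L-class. This passes on to products inside \<open>DJ m n r s\<close>, hence to all of its elements.\<close>

lemma group_classes_connected: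
  assumes s: "s < r"
  shows "bip_connected (col_class s ` col_frames s) (row_class s ` row_frames s) (group_classes s :: ('a::field mat set \<times> 'a mat set) set)"
  unfolding bip_connected_def
proof (intro allI impI)
  let ?I = "col_class s ` col_frames s :: 'a mat set set" and ?L = "row_class s ` row_frames s :: 'a mat set set"
  fix Y Z assume a: "Y \<subseteq> ?I \<and> Z \<subseteq> ?L \<and> (\<forall>(c, d)\<in>group_classes s. c \<in> Y \<longleftrightarrow> d \<in> Z)"
  then have YZ: "Y \<subseteq> ?I" "Z \<subseteq> ?L" and cl: "\<And>c d. (c, d) \<in> group_classes s \<Longrightarrow> c \<in> Y \<longleftrightarrow> d \<in> Z" by auto
  have key: "X \<in> DJ m n r s \<Longrightarrow> R_label s X \<in> Y \<longleftrightarrow> L_label s X \<in> Z"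
    if "X \<in> sg_generated star (idempotents_in star (DJ m n r s))" for X
    using that
  proof induction
    case (base X)
    then show ?case using cl idempotent_label by blast
  next
    case (mult X1 X2)
    have "X1 \<in> IJ m n r s" "X2 \<in> IJ m n r s"
      using mult.hyps unfolding idempotents_generate[OF s] .
    then have D: "X1 \<in> DJ m n r s" "X2 \<in> DJ m n r s"
      using DJ_star_cases mult.prems by blast+
    show ?case
      using mult.IH D star_DJ_labels[OF D] mult.prems cl by metis
  qed
  have all: "c \<in> Y \<longleftrightarrow> d \<in> Z" if cd: "c \<in> ?I" "d \<in> ?L" for c d
  proof -
    obtain G H where 1: "G \<in> col_frames s" "H \<in> row_frames s" "c = col_class s G" "d = row_class s H" using cd by blast
    have D: "G * H \<in> DJ m n r s" using DJ_I[OF 1(1,2)] .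
    then have "G * H \<in> sg_generated star (idempotents_in star (DJ m n r s))"
      unfolding idempotents_generate[OF s] using DJ_subset_IJ by blast
    from key[OF this D] show ?thesis using R_label_GH[OF 1(1,2)] L_label_GH[OF 1(1,2)] 1(3,4) by simp
  qed
  have ne: "?I \<noteq> {}" "?L \<noteq> {}" using col_frames_nonempty[of s] row_frames_nonempty[of s] s by auto
  show "(Y \<noteq> {} \<longrightarrow> Y = ?I) \<and> (Z \<noteq> {} \<longrightarrow> Z = ?L)"
  proof (intro conjI impI)
    assume "Y \<noteq> {}"
    then obtain c where "c \<in> Y" by blast
    then have Z: "d \<in> Z" if "d \<in> ?L" for d using all[OF _ that] YZ(1) by blast
    obtain d where "d \<in> ?L" using ne(2) by blast
    then have "c \<in> Y" if "c \<in> ?I" for c using all[OF that] Z by blast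
    then show "Y = ?I" using YZ(1) by blast
  next
    assume "Z \<noteq> {}"
    then obtain d where "d \<in> Z" by blast
    then have Y: "c \<in> Y" if "c \<in> ?I" for c using all[OF that] YZ(2) by blast
    obtain c where "c \<in> ?I" using ne(1) by blast
    then have "d \<in> Z" if "d \<in> ?L" for d using all[OF _ that] Y by blast
    then show "Z = ?L" using YZ(2) by blast
  qed
qed

text \<open>With X = G H, the matrices W such that G W H is generated by A form a finite set closed under
  multiplication; left multiplication by one of them permutes this set, so it contains the identity.\<close>

lemma same_label_generated:
  fixes X Y :: "'a::field mat"
  assumes fin: "finite (UNIV :: 'a set)"
    and X: "X \<in> idempotents_in star (DJ m n r s)"
    and Y: "Y \<in> DJ m n r s" "Y \<in> sg_generated star A"
    and lab: "R_label s Y = R_label s X" "L_label s Y = L_label s X"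
  shows "X \<in> sg_generated star A"
proof -
  have XD: "X \<in> DJ m n r s" "X \<star> X = X" using X by (auto simp: idempotents_in_def)
  obtain G H where 1: "G \<in> col_frames s" "H \<in> row_frames s" "X = G * H" using DJ_E[OF XD(1)] .
  obtain G' H' where 2: "G' \<in> col_frames s" "H' \<in> row_frames s" "Y = G' * H'" using DJ_E[OF Y(1)] .
  have e: "col_class s G' = col_class s G" "row_class s H' = row_class s H"
    using lab R_label_GH L_label_GH 1 2 by metis+
  obtain Z1 where Z1: "Z1 \<in> GL s" "G' = G * Z1" using col_class_eqD[OF 1(1) 2(1) e(1)] .
  obtain Z2 where Z2: "Z2 \<in> GL s" "H' = Z2 * H" using row_class_eqD[OF 1(2) 2(2) e(2)] .
  have dG: "dim_row G = m" "dim_col G = s" "dim_row H = s" "dim_col H = n"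
    using 1 by (simp_all add: col_frames_dim row_frames_dim)
  \<comment> \<open>Idempotency gives two factorizations of X with the same G. The transition matrix
    between them is the identity since G is left cancellable, so H = \<open>middle H G\<close> * H,
    and H is right cancellable.\<close>
  have mid1: "middle H G = 1\<^sub>m s"
  proof -
    have "G * H = G * (middle H G * H)" using XD(2) star_GH[OF 1(1,2) 1(1,2)] unfolding 1(3) by simp
    moreover have M: "middle H G \<in> GL s"
      using star_DJ[OF 1(1,1,2,2)] XD unfolding 1(3) by simp
    ultimately obtain Z where Z: "Z \<in> GL s" "G = G * Z" "H = Z * (middle H G * H)"
      using GH_unique[OF 1(1,1) 1(2) row_frames_mult_GL[OF 1(2) M]] by blast
    obtain C where C: "dim_row C = s" "dim_col C = r" "C * (V * G) = 1\<^sub>m s"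
      using 1(1) by (rule col_frames_E)
    obtain D where D: "dim_row D = r" "dim_col D = s" "H * (U * D) = 1\<^sub>m s"
      using 1(2) by (rule row_frames_E)
    have "Z = C * (V * G) * Z" using C(3) Z(1) by (simp add: mat_assoc GL_dim)
    also have "\<dots> = C * (V * (G * Z))" using C(1,2) dG Z(1) by (simp add: mat_assoc GL_dim)
    also have "\<dots> = 1\<^sub>m s" unfolding Z(2)[symmetric] by (rule C(3))
    finally have "Z = 1\<^sub>m s" .
    then have HM: "H = middle H G * H" using Z(3) dG by (simp add: mat_assoc)
    have "middle H G = middle H G * (H * (U * D))" using D(3) dG by (simp add: mat_assoc)
    also have "\<dots> = (middle H G * H) * (U * D)" using D(1,2) dG by (simp add: mat_assoc)
    also have "\<dots> = 1\<^sub>m s" unfolding HM[symmetric] by (rule D(3))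
    finally show ?thesis .
  qed
  define \<W> where "\<W> = {W \<in> GL s. G * W * H \<in> sg_generated star A}"
  have "GL s \<subseteq> (carrier_mat s s :: 'a mat set)" by (auto simp: GL_def)
  then have fW: "finite \<W>" using finite_carrier_mat[OF fin] finite_subset unfolding \<W>_def by fastforce
  have W0: "Z1 * Z2 \<in> \<W>"
  proof -
    have "Y = G * (Z1 * Z2) * H"
      unfolding 2(3) Z1(2) Z2(2) using dG Z1(1) Z2(1) by (simp add: mat_assoc GL_dim)
    then show ?thesis using Y(2) GL_mult[OF Z1(1) Z2(1)] by (simp add: \<W>_def)
  qed
  have closed: "W * W' \<in> \<W>" if "W \<in> \<W>" "W' \<in> \<W>" for W W'
  proof -
    have g: "W \<in> GL s" "W' \<in> GL s" using that by (auto simp: \<W>_def)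
    have "(G * W * H) \<star> (G * W' * H) = (G * (W * H)) \<star> (G * (W' * H))"
      using g dG by (simp add: mat_assoc GL_dim)
    also have "\<dots> = G * (middle (W * H) G * (W' * H))"
      using g 1 row_frames_mult_GL by (intro star_GH) auto
    also have "middle (W * H) G = W * middle H G" using g dG by (simp add: middle_def mat_assoc GL_dim)
    also have "G * (W * middle H G * (W' * H)) = G * (W * W') * H"
      unfolding mid1 using g dG by (simp add: mat_assoc GL_dim)
    finally have "G * (W * W') * H \<in> sg_generated star A"
      using that sg_generated.mult[of "G * W * H" star A "G * W' * H"] by (simp add: \<W>_def)
    then show ?thesis using GL_mult[OF g] by (simp add: \<W>_def)
  qed
  let ?W = "Z1 * Z2"
  have Wg: "?W \<in> GL s" using GL_mult[OF Z1(1) Z2(1)] .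
  obtain Wi where Wi: "dim_row Wi = s" "dim_col Wi = s" "Wi * ?W = 1\<^sub>m s" using Wg by (rule GL_E)
  have canc: "Wi * (?W * W) = W" if "W \<in> GL s" for W
    using Wi(2) Wg that by (intro mult_cancel_one[OF Wi(3)]) (simp_all only: GL_dim)
  have "inj_on (\<lambda>W. ?W * W) \<W>"
    by (rule inj_on_inverseI[where g = "\<lambda>W. Wi * W"]) (use canc in \<open>auto simp: \<W>_def\<close>)
  then have "(\<lambda>W. ?W * W) ` \<W> = \<W>"
    using closed[OF W0] fW by (intro endo_inj_surj) auto
  then obtain W where W: "W \<in> \<W>" "?W * W = ?W" using W0 by (metis imageE)
  have "W = Wi * (?W * W)" using canc W(1) by (simp add: \<W>_def)
  also have "\<dots> = 1\<^sub>m s" unfolding W(2) by (rule Wi(3))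
  finally have "G * 1\<^sub>m s * H \<in> sg_generated star A" using W(1) by (simp add: \<W>_def)
  then show ?thesis unfolding 1(3) using dG by (simp add: mat_assoc)
qed

section \<open>Generating sets: the upper and the lower bound\<close>

lemma sg_generated_least:
  assumes "A \<subseteq> sg_generated f B"
  shows "sg_generated f A \<subseteq> sg_generated f B"
proof
  fix X assume "X \<in> sg_generated f A"
  then show "X \<in> sg_generated f B"
  proof induction
    case (base X)
    then show ?case using assms by blast
  next
    case (mult X Y)
    show ?case using mult.IH by (rule sg_generated.mult)
  qed
qed

text \<open>One idempotent is chosen for each edge. A walk becomes a product of chosen idempotents
  that never drops out of the top class, so every H-class of this class is met;
  \<open>same_label_generated\<close> then replaces the element found in an H-class by the
  idempotent, if there is one.\<close>

lemma cover_generates: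
  fixes F :: "('a::field mat set \<times> 'a mat set) set"
  assumes s: "s < r" and fin: "finite (UNIV :: 'a set)" and F: "F \<subseteq> group_classes s"
    and reach: "\<And>c d. c \<in> col_class s ` col_frames s \<Longrightarrow> d \<in> row_class s ` row_frames s \<Longrightarrow> alt_reach F (group_classes s) c d"
  shows "\<exists>e :: _ \<Rightarrow> 'a mat. e ` F \<subseteq> idempotents_in star (DJ m n r s) \<and> sg_generated star (e ` F) = IJ m n r s"
proof -
  have "\<forall>p\<in>group_classes s :: ('a mat set \<times> 'a mat set) set. \<exists>X :: 'a mat. X \<in> idempotents_in star (DJ m n r s) \<and> R_label s X = fst p \<and> L_label s X = snd p"
  proof
    fix p :: "'a mat set \<times> 'a mat set" assume "p \<in> group_classes s"
    then have "(fst p, snd p) \<in> group_classes s" by simp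
    from idempotent_exists[OF this]
    show "\<exists>X :: 'a mat. X \<in> idempotents_in star (DJ m n r s) \<and> R_label s X = fst p \<and> L_label s X = snd p" by blast
  qed
  from bchoice[OF this] obtain e :: "'a mat set \<times> 'a mat set \<Rightarrow> 'a mat" where e: "\<And>p. p \<in> group_classes s \<Longrightarrow>
      e p \<in> idempotents_in star (DJ m n r s) \<and> R_label s (e p) = fst p \<and> L_label s (e p) = snd p"
    by blast
  let ?A = "e ` F" and ?E = "idempotents_in star (DJ m n r s) :: 'a mat set"
  have sub: "?A \<subseteq> ?E" using e F by blast
  have walk: "\<exists>Y\<in>sg_generated star ?A. Y \<in> DJ m n r s \<and> R_label s Y = c \<and> L_label s Y = d"
    if "alt_reach F (group_classes s) c d" for c d
    using that
  proof induction
    case (edge c d)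
    then have "(c, d) \<in> group_classes s" using F by blast
    from e[OF this] edge show ?case
      by (intro bexI[of _ "e (c, d)"]) (auto intro: sg_generated.base simp: idempotents_in_def)
  next
    case (comp c d c' d')
    then obtain Y Y' where Y: "Y \<in> sg_generated star ?A" "Y \<in> DJ m n r s" "R_label s Y = c" "L_label s Y = d"
      and Y': "Y' \<in> sg_generated star ?A" "Y' \<in> DJ m n r s" "R_label s Y' = c'" "L_label s Y' = d'" by blast
    have D: "Y \<star> Y' \<in> DJ m n r s"
      using star_DJ_labels(1)[OF Y(2) Y'(2)] comp.hyps(2) Y(4) Y'(3) by simp
    show ?case
      using star_DJ_labels(2,3)[OF Y(2) Y'(2) D] D Y Y' sg_generated.mult[OF Y(1) Y'(1)] by blast
  qed
  have "?E \<subseteq> sg_generated star ?A"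
  proof
    fix X assume X: "X \<in> ?E"
    then have D: "X \<in> DJ m n r s" by (simp add: idempotents_in_def)
    obtain Y where "Y \<in> sg_generated star ?A" "Y \<in> DJ m n r s" "R_label s Y = R_label s X" "L_label s Y = L_label s X"
      using walk[OF reach[OF R_label_mem[OF D] L_label_mem[OF D]]] by blast
    then show "X \<in> sg_generated star ?A" using same_label_generated[OF fin X] by blast
  qed
  from sg_generated_least[OF this] have "IJ m n r s \<subseteq> sg_generated star ?A"
    unfolding idempotents_generate[OF s] .
  moreover have "?A \<subseteq> sg_generated star ?E"
    using sub sg_generated.base by (rule subset_trans[OF _ subsetI])
  from sg_generated_least[OF this] have "sg_generated star ?A \<subseteq> IJ m n r s"
    unfolding idempotents_generate[OF s] .
  ultimately have "sg_generated star ?A = IJ m n r s" by (intro equalityI)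
  with sub show ?thesis by (intro exI[of _ e] conjI)
qed

text \<open>A product inside the top class inherits its R-label from the left factor and its L-label
  from the right one, and both factors lie in the class. Elements of A of smaller rank may carry
  arbitrary labels, which does not affect the inclusions.\<close>

lemma generating_set_labels:
  fixes A :: "'a::field mat set"
  assumes A: "A \<subseteq> IJ m n r s" "sg_generated star A = IJ m n r s" and X: "X \<in> DJ m n r s"
  shows "R_label s X \<in> R_label s ` A" "L_label s X \<in> L_label s ` A"
proof -
  have "X \<in> sg_generated star A" using X A(2) DJ_subset_IJ by blast
  then have "R_label s X \<in> R_label s ` A \<and> L_label s X \<in> L_label s ` A" using X
  proof induction
    case (base X)
    then show ?case by blast
  next
    case (mult Y Z)
    have "Y \<in> IJ m n r s" "Z \<in> IJ m n r s" using mult.hyps unfolding A(2) .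
    then have D: "Y \<in> DJ m n r s" "Z \<in> DJ m n r s" using DJ_star_cases mult.prems by blast+
    then show ?case using star_DJ_labels(2,3)[OF D mult.prems] mult.IH by simp
  qed
  then show "R_label s X \<in> R_label s ` A" "L_label s X \<in> L_label s ` A" by blast+
qed

lemma generating_set_card:
  fixes A :: "'a::field mat set"
  assumes s: "s \<le> r" and A: "A \<subseteq> IJ m n r s" "sg_generated star A = IJ m n r s" "finite A"
  shows "max (card (col_class s ` col_frames s :: 'a mat set set)) (card (row_class s ` row_frames s :: 'a mat set set)) \<le> card A"
proof -
  obtain G0 H0 where 0: "G0 \<in> (col_frames s :: 'a mat set)" "H0 \<in> (row_frames s :: 'a mat set)"
    using col_frames_nonempty[OF s] row_frames_nonempty[OF s] by blast
  have "col_class s ` col_frames s \<subseteq> R_label s ` A"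
  proof (rule image_subsetI)
    fix G :: "'a mat" assume "G \<in> col_frames s"
    then show "col_class s G \<in> R_label s ` A"
      using generating_set_labels(1)[OF A(1,2) DJ_I[OF _ 0(2)]] R_label_GH[OF _ 0(2)] by metis
  qed
  moreover have "row_class s ` row_frames s \<subseteq> L_label s ` A"
  proof (rule image_subsetI)
    fix H :: "'a mat" assume "H \<in> row_frames s"
    then show "row_class s H \<in> L_label s ` A"
      using generating_set_labels(2)[OF A(1,2) DJ_I[OF 0(1)]] L_label_GH[OF 0(1)] by metis
  qed
  ultimately show ?thesis using A(3) by (simp add: surj_card_le)
qed

section \<open>Counting classes and degrees over a finite field\<close>

lemma col_class_card:
  fixes G :: "'a::field mat"
  assumes "G \<in> col_frames s"
  shows "card (col_class s G) = card (GL s :: 'a mat set)"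
proof -
  obtain C where C: "dim_row G = m" "dim_col G = s" "dim_row C = s" "dim_col C = r" "C * (V * G) = 1\<^sub>m s"
    using assms by (rule col_frames_E)
  have "C * (V * (G * Z)) = Z" if "Z \<in> GL s" for Z
    using mult_cancel_one[OF C(5), of Z] C that by (simp add: mat_assoc GL_dim)
  then have "inj_on (\<lambda>Z. G * Z) (GL s)" by (rule inj_on_inverseI[where g = "\<lambda>Y. C * (V * Y)"])
  then show ?thesis unfolding col_class_def by (rule card_image)
qed

lemma row_class_card:
  fixes H :: "'a::field mat"
  assumes "H \<in> row_frames s"
  shows "card (row_class s H) = card (GL s :: 'a mat set)"
proof -
  obtain D where D: "dim_row H = s" "dim_col H = n" "dim_row D = r" "dim_col D = s" "H * (U * D) = 1\<^sub>m s"
    using assms by (rule row_frames_E)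
  have "(Z * H) * (U * D) = Z" if "Z \<in> GL s" for Z
    using D that by (simp add: mat_assoc GL_dim)
  then have "inj_on (\<lambda>Z. Z * H) (GL s)" by (rule inj_on_inverseI[where g = "\<lambda>Y. Y * (U * D)"])
  then show ?thesis unfolding row_class_def by (rule card_image)
qed

text \<open>The general linear group acts freely on frames, so a stable set splits into orbits of
  its size. Besides all frames, S will be the set of those G that form a group H-class with a given
  H.\<close>

lemma card_col_class_image:
  fixes S :: "'a::field mat set"
  assumes "finite S" and S: "S \<subseteq> col_frames s" and cl: "\<And>G Z. G \<in> S \<Longrightarrow> Z \<in> GL s \<Longrightarrow> G * Z \<in> S"
  shows "card S = card (col_class s ` S) * card (GL s :: 'a mat set)"
proof (rule card_fibres[OF assms(1)])
  fix G assume G: "G \<in> S"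
  have "{G' \<in> S. col_class s G' = col_class s G} = col_class s G"
  proof (intro equalityI subsetI)
    fix G' assume "G' \<in> {G' \<in> S. col_class s G' = col_class s G}"
    then show "G' \<in> col_class s G" using col_class_self S by blast
  next
    fix G' assume "G' \<in> col_class s G"
    then obtain Z where "Z \<in> GL s" "G' = G * Z" by (auto simp: col_class_def)
    then show "G' \<in> {G' \<in> S. col_class s G' = col_class s G}" using cl col_class_mult G S by blast
  qed
  then show "card {G' \<in> S. col_class s G' = col_class s G} = card (GL s :: 'a mat set)"
    using col_class_card G S by (metis subsetD)
qed

lemma card_row_class_image:
  fixes S :: "'a::field mat set"
  assumes "finite S" and S: "S \<subseteq> row_frames s" and cl: "\<And>H Z. H \<in> S \<Longrightarrow> Z \<in> GL s \<Longrightarrow> Z * H \<in> S"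
  shows "card S = card (row_class s ` S) * card (GL s :: 'a mat set)"
proof (rule card_fibres[OF assms(1)])
  fix H assume H: "H \<in> S"
  have "{H' \<in> S. row_class s H' = row_class s H} = row_class s H"
  proof (intro equalityI subsetI)
    fix H' assume "H' \<in> {H' \<in> S. row_class s H' = row_class s H}"
    then show "H' \<in> row_class s H" using row_class_self S by blast
  next
    fix H' assume "H' \<in> row_class s H"
    then obtain Z where "Z \<in> GL s" "H' = Z * H" by (auto simp: row_class_def)
    then show "H' \<in> {H' \<in> S. row_class s H' = row_class s H}" using cl row_class_mult H S by blast
  qed
  then show "card {H' \<in> S. row_class s H' = row_class s H} = card (GL s :: 'a mat set)"
    using row_class_card H S by (metis subsetD)
qed

context
  fixes q :: nat
  assumes fin: "finite (UNIV :: 'a::field set)" and q: "q = card (UNIV :: 'a set)"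
begin

lemma q_pos: "q > 0"
  using fin unfolding q by (intro card_gt_0_iff[THEN iffD2]) auto

lemma card_GL_pos: "card (GL s :: 'a mat set) > 0"
proof -
  have "finite (GL s :: 'a mat set)" using finite_carrier_mat[OF fin] unfolding GL_def by auto
  then show ?thesis using one_GL by (auto simp: card_gt_0_iff)
qed

text \<open>The neighbours of G are the orbits of those H with H (U V G) invertible. Right
  multiplication by U V G is a surjective linear map onto s x s matrices, so there are |GL| q^(ns -
  ss) such H, in orbits of size |GL|.\<close>

lemma degree_F:
  fixes G :: "'a mat"
  assumes s: "s \<le> r" and G: "G \<in> col_frames s"
  shows "card {d. (col_class s G, d) \<in> group_classes s} = q ^ (s * (n - s))"
proof -
  obtain C where C: "dim_row G = m" "dim_col G = s" "dim_row C = s" "dim_col C = r" "C * (V * G) = 1\<^sub>m s"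
    using G by (rule col_frames_E)
  \<comment> \<open>Being a row frame is left out here because invertibility implies it; this makes
    S the full preimage of \<open>GL s\<close> under a linear map.\<close>
  define S where "S = {H \<in> carrier_mat s n. H * (U * (V * G)) \<in> GL s}"
  have S_row_frames: "S \<subseteq> row_frames s"
  proof
    fix H assume H: "H \<in> S"
    then have Hc: "H \<in> carrier_mat s n" and M: "H * (U * (V * G)) \<in> GL s" by (auto simp: S_def)
    obtain N where N: "dim_row N = s" "dim_col N = s" "H * (U * (V * G)) * N = 1\<^sub>m s" using M by (rule GL_E)
    show "H \<in> row_frames s"
      by (rule row_frames_I[OF Hc, where D = "V * (G * N)"]) ((use C N Hc in \<open>intro carrier_matI; simp\<close>) | (use C N Hc in \<open>simp add: mat_assoc\<close>))+
  qed
  have S_middle: "H \<in> S \<longleftrightarrow> H \<in> row_frames s \<and> middle H G \<in> GL s" for H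
    using S_row_frames by (auto simp: S_def middle_def row_frames_def)
  have "{d. (col_class s G, d) \<in> group_classes s} = row_class s ` S"
  proof (intro equalityI subsetI)
    fix d assume "d \<in> {d. (col_class s G, d) \<in> group_classes s}"
    then have d: "(col_class s G, d) \<in> group_classes s" by simp
    then obtain H where H: "H \<in> row_frames s" "d = row_class s H" using group_classes_sub by blast
    then have "middle H G \<in> GL s" using d group_classes_iff[OF G H(1)] by simp
    then show "d \<in> row_class s ` S" using H S_middle by blast
  next
    fix d assume "d \<in> row_class s ` S"
    then obtain H where "H \<in> row_frames s" "middle H G \<in> GL s" "d = row_class s H" using S_middle by blast
    then show "d \<in> {d. (col_class s G, d) \<in> group_classes s}" using group_classes_iff[OF G] by simp
  qed
  moreover have "card S = card (row_class s ` S) * card (GL s :: 'a mat set)"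
  proof (rule card_row_class_image[OF _ S_row_frames])
    show "finite S" using finite_carrier_mat[OF fin] unfolding S_def by auto
    show "Z * H \<in> S" if "H \<in> S" "Z \<in> GL s" for H Z
    proof -
      have H: "H \<in> row_frames s" "middle H G \<in> GL s" using that S_middle by auto
      have "middle (Z * H) G = Z * middle H G"
        using H that(2) C by (simp add: middle_def mat_assoc row_frames_dim GL_dim)
      then show ?thesis using S_middle row_frames_mult_GL[OF H(1) that(2)] GL_mult[OF that(2) H(2)] by simp
    qed
  qed
  moreover have "card S * q ^ (s * s) = card (GL s :: 'a mat set) * q ^ (n * s)"
    unfolding S_def q
  proof (rule card_right_mult_preimage[OF fin, where K = "C * partial_id r n r"])
    show "C * partial_id r n r * (U * (V * G)) = 1\<^sub>m s"
      using C by (simp add: mat_assoc mult_cancel_one[OF LU[OF partial_id_left_unit]])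
    show "GL s \<subseteq> (carrier_mat s s :: 'a mat set)" by (auto simp: GL_def)
  qed (use C in \<open>intro carrier_matI; simp\<close>)+
  moreover have "q ^ (n * s) = q ^ (s * (n - s)) * q ^ (s * s)"
    using s r_le by (simp add: power_add[symmetric] algebra_simps diff_mult_distrib2)
  ultimately show ?thesis using q_pos card_GL_pos[of s] by auto
qed

lemma degree_H:
  fixes H :: "'a mat"
  assumes s: "s \<le> r" and H: "H \<in> row_frames s"
  shows "card {c. (c, row_class s H) \<in> group_classes s} = q ^ (s * (m - s))"
proof -
  obtain D where D: "dim_row H = s" "dim_col H = n" "dim_row D = r" "dim_col D = s" "H * (U * D) = 1\<^sub>m s"
    using H by (rule row_frames_E)
  define S where "S = {G \<in> carrier_mat m s. (H * U * V) * G \<in> GL s}"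
  have S_col_frames: "S \<subseteq> col_frames s"
  proof
    fix G assume G: "G \<in> S"
    then have Gc: "G \<in> carrier_mat m s" and M: "(H * U * V) * G \<in> GL s" by (auto simp: S_def)
    obtain N where N: "dim_row N = s" "dim_col N = s" "N * ((H * U * V) * G) = 1\<^sub>m s" using M by (rule GL_E)
    show "G \<in> col_frames s"
      by (rule col_frames_I[OF Gc, where C = "N * (H * U)"]) ((use D N Gc in \<open>intro carrier_matI; simp\<close>) | (use D N Gc in \<open>simp add: mat_assoc\<close>))+
  qed
  have S_middle: "G \<in> S \<longleftrightarrow> G \<in> col_frames s \<and> middle H G \<in> GL s" for G
  proof -
    have "(H * U * V) * G = middle H G" if "dim_row G = m"
      using D(1-4) that by (simp add: middle_def mat_assoc)
    then have "G \<in> S \<longleftrightarrow> G \<in> carrier_mat m s \<and> middle H G \<in> GL s" by (auto simp: S_def)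
    then show ?thesis using S_col_frames by (auto simp: col_frames_def)
  qed
  have "{c. (c, row_class s H) \<in> group_classes s} = col_class s ` S"
  proof (intro equalityI subsetI)
    fix c assume "c \<in> {c. (c, row_class s H) \<in> group_classes s}"
    then have c: "(c, row_class s H) \<in> group_classes s" by simp
    then obtain G where G: "G \<in> col_frames s" "c = col_class s G" using group_classes_sub by blast
    then have "middle H G \<in> GL s" using c group_classes_iff[OF G(1) H] by simp
    then show "c \<in> col_class s ` S" using G S_middle by blast
  next
    fix c assume "c \<in> col_class s ` S"
    then obtain G where "G \<in> col_frames s" "middle H G \<in> GL s" "c = col_class s G" using S_middle by blast
    then show "c \<in> {c. (c, row_class s H) \<in> group_classes s}" using group_classes_iff[OF _ H] by simp
  qed
  moreover have "card S = card (col_class s ` S) * card (GL s :: 'a mat set)"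
  proof (rule card_col_class_image[OF _ S_col_frames])
    show "finite S" using finite_carrier_mat[OF fin] unfolding S_def by auto
    show "G * Z \<in> S" if "G \<in> S" "Z \<in> GL s" for G Z
    proof -
      have G: "G \<in> col_frames s" "middle H G \<in> GL s" using that S_middle by auto
      have "middle H (G * Z) = middle H G * Z"
        using G that(2) D by (simp add: middle_def mat_assoc col_frames_dim GL_dim)
      then show ?thesis using S_middle col_frames_mult_GL[OF G(1) that(2)] GL_mult[OF G(2) that(2)] by simp
    qed
  qed
  moreover have "card S * q ^ (s * s) = card (GL s :: 'a mat set) * q ^ (m * s)"
    unfolding S_def q
  proof (rule card_left_mult_preimage[OF fin, where K = "partial_id m r r * D"])
    show "H * U * V * (partial_id m r r * D) = 1\<^sub>m s"
      using D by (simp add: mat_assoc mult_cancel_one[OF VK[OF partial_id_top_unit]])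
    show "GL s \<subseteq> (carrier_mat s s :: 'a mat set)" by (auto simp: GL_def)
  qed (use D in \<open>intro carrier_matI; simp\<close>)+
  moreover have "q ^ (m * s) = q ^ (s * (m - s)) * q ^ (s * s)"
    using s r_le by (simp add: power_add[symmetric] algebra_simps diff_mult_distrib2)
  ultimately show ?thesis using q_pos card_GL_pos[of s] by auto
qed

lemma finite_col_frames: "finite (col_frames s :: 'a mat set)"
  using finite_carrier_mat[OF fin] unfolding col_frames_def by auto

lemma finite_row_frames: "finite (row_frames s :: 'a mat set)"
  using finite_carrier_mat[OF fin] unfolding row_frames_def by auto

lemma q_fact_pos: "q_fact q k > 0"
  unfolding q_fact_def prod_pos_nat_iff[OF finite_atLeastAtMost]
proof
  fix i assume "i \<in> {1..k}"
  then have "q ^ 0 \<le> (\<Sum>j<i. q ^ j)" by (intro member_le_sum) auto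
  then show "0 < (\<Sum>j<i. q ^ j)" by simp
qed

text \<open>The parameter l is m for the R-classes and n for the L-classes. The ratio of frames to
  |GL| is the q-binomial, and q^(l s) splits into q^(s(l - r)) and q^(r s).\<close>

lemma q_binomial_count:
  assumes s: "s \<le> r" "r \<le> l"
    and count: "c * card (GL s :: 'a mat set) * q ^ (r * s) = card (frames r s :: 'a mat set) * q ^ (l * s)"
  shows "rat_of_nat c = of_nat (q ^ (s * (l - r))) * q_binomial q r s"
proof -
  let ?g = "card (GL s :: 'a mat set)" and ?d = "q_fact q s * q_fact q (r - s)"
  have ql: "q ^ (l * s) = q ^ (s * (l - r)) * q ^ (r * s)"
    using s by (simp add: power_add[symmetric] algebra_simps diff_mult_distrib2)
  have "(c * ?d) * (?g * q ^ (r * s)) = (card (frames r s :: 'a mat set) * ?d) * q ^ (l * s)"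
    using count by (simp add: ac_simps)
  also have "\<dots> = (q ^ (s * (l - r)) * q_fact q r) * (?g * q ^ (r * s))"
    unfolding card_frames_ratio[OF fin q s(1)] ql by (simp add: ac_simps)
  finally have "c * ?d = q ^ (s * (l - r)) * q_fact q r"
    using q_pos card_GL_pos[of s] by simp
  then have "rat_of_nat c * of_nat ?d = of_nat (q ^ (s * (l - r))) * of_nat (q_fact q r)"
    by (metis of_nat_mult)
  moreover have "rat_of_nat ?d \<noteq> 0" using q_fact_pos[of s] q_fact_pos[of "r - s"] by simp
  ultimately show ?thesis unfolding q_binomial_def by (simp add: field_simps)
qed

lemma card_col_class:
  assumes s: "s \<le> r"
  shows "rat_of_nat (card (col_class s ` col_frames s :: 'a mat set set)) = of_nat (q ^ (s * (m - r))) * q_binomial q r s"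
proof (rule q_binomial_count[OF s r_le(1)])
  have "card (col_frames s :: 'a mat set) = card (col_class s ` col_frames s :: 'a mat set set) * card (GL s :: 'a mat set)"
    using finite_col_frames col_frames_mult_GL by (intro card_col_class_image) auto
  \<comment> \<open>The column frames are the preimage of \<open>frames r s\<close> under V, which
    reads off the top r rows and leaves the others free.\<close>
  moreover have "card (col_frames s :: 'a mat set) * q ^ (r * s) = card (frames r s :: 'a mat set) * q ^ (m * s)"
    unfolding col_frames_def q
    using card_left_mult_preimage[OF fin partial_id_dim(3) partial_id_dim(3) VK[OF partial_id_top_unit], of "frames r s" s]
    by (auto simp: frames_def)
  ultimately show "card (col_class s ` col_frames s :: 'a mat set set) * card (GL s :: 'a mat set) * q ^ (r * s)
      = card (frames r s :: 'a mat set) * q ^ (m * s)" by simp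
qed

lemma card_row_class:
  assumes s: "s \<le> r"
  shows "rat_of_nat (card (row_class s ` row_frames s :: 'a mat set set)) = of_nat (q ^ (s * (n - r))) * q_binomial q r s"
proof (rule q_binomial_count[OF s r_le(2)])
  have "card (row_frames s :: 'a mat set) = card (row_class s ` row_frames s :: 'a mat set set) * card (GL s :: 'a mat set)"
    using finite_row_frames row_frames_mult_GL by (intro card_row_class_image) auto
  moreover have "card (row_frames s :: 'a mat set) * q ^ (r * s) = card (frames r s :: 'a mat set) * q ^ (n * s)"
  proof -
    have tr: "Y\<^sup>T \<in> frames r s \<longleftrightarrow> Y \<in> transpose_mat ` frames r s" for Y :: "'a mat"
      by (metis image_iff transpose_transpose)
    have "transpose_mat ` frames r s \<subseteq> (carrier_mat s r :: 'a mat set)" by (auto simp: frames_def)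
    from card_right_mult_preimage[OF fin partial_id_dim(3) partial_id_dim(3) LU[OF partial_id_left_unit] this]
    show ?thesis unfolding row_frames_def q tr by (simp add: card_transpose_image)
  qed
  ultimately show "card (row_class s ` row_frames s :: 'a mat set set) * card (GL s :: 'a mat set) * q ^ (r * s)
      = card (frames r s :: 'a mat set) * q ^ (n * s)" by simp
qed

lemma idempotent_generating_set:
  assumes s: "s < r"
  obtains A :: "'a mat set" where "A \<subseteq> idempotents_in star (DJ m n r s)" "sg_generated star A = IJ m n r s"
    "finite A" "card A \<le> max (card (col_class s ` col_frames s :: 'a mat set set)) (card (row_class s ` row_frames s :: 'a mat set set))"
proof -
  let ?I = "col_class s ` col_frames s :: 'a mat set set" and ?L = "row_class s ` row_frames s :: 'a mat set set"
  have fI: "finite ?I" "finite ?L" using finite_col_frames finite_row_frames by auto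
  have "\<exists>F\<subseteq>group_classes s. card F \<le> max (card ?I) (card ?L) \<and> (\<forall>c\<in>?I. \<forall>d\<in>?L. alt_reach F (group_classes s) c d)"
  proof (rule alternating_cover[OF fI group_classes_sub])
    show "card {d. (c, d) \<in> group_classes s} = q ^ (s * (n - s))" if "c \<in> ?I" for c
      using that degree_F s by auto
    show "card {c. (c, d) \<in> group_classes s} = q ^ (s * (m - s))" if "d \<in> ?L" for d
      using that degree_H s by auto
    \<comment> \<open>The two degrees are powers of the same q, so they are comparable under
      divisibility.\<close>
    show "q ^ (s * (n - s)) dvd q ^ (s * (m - s)) \<or> q ^ (s * (m - s)) dvd q ^ (s * (n - s))"
      by (metis le_imp_power_dvd linear)
  qed (use q_pos group_classes_connected[OF s] in auto)
  then obtain F where F: "F \<subseteq> group_classes s" "card F \<le> max (card ?I) (card ?L)"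
    and all: "\<forall>c\<in>?I. \<forall>d\<in>?L. alt_reach F (group_classes s) c d" by (elim exE conjE)
  have reach: "alt_reach F (group_classes s) c d" if "c \<in> ?I" "d \<in> ?L" for c d
    using bspec[OF bspec[OF all that(1)] that(2)] .
  have "\<exists>e :: _ \<Rightarrow> 'a mat. e ` F \<subseteq> idempotents_in star (DJ m n r s) \<and> sg_generated star (e ` F) = IJ m n r s"
    by (rule cover_generates[OF s fin F(1)]) (rule reach)
  then obtain e :: "'a mat set \<times> 'a mat set \<Rightarrow> 'a mat"
    where e: "e ` F \<subseteq> idempotents_in star (DJ m n r s)" "sg_generated star (e ` F) = IJ m n r s"
    by (elim exE conjE)
  have "finite F"
    using F(1) group_classes_sub finite_cartesian_product[OF fI] by (metis finite_subset)
  then have "finite (e ` F)" by (rule finite_imageI)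
  moreover have "card (e ` F) \<le> max (card ?I) (card ?L)"
    using card_image_le[OF \<open>finite F\<close>, of e] F(2) by (rule order_trans)
  ultimately show ?thesis by (rule that[OF e])
qed

text \<open>The lower bound holds for arbitrary finite generating sets and is attained by a set of
  idempotents, so one set A settles both minima.\<close>

lemma rank_IJ:
  assumes s: "s < r"
  shows "sg_rank (IJ m n r s :: 'a mat set) star = sg_idrank (IJ m n r s :: 'a mat set) star"
    and "rat_of_nat (sg_idrank (IJ m n r s :: 'a mat set) star)
      = of_nat (q ^ (s * (max m n - r))) * q_binomial q r s"
proof -
  let ?M = "max (card (col_class s ` col_frames s :: 'a mat set set)) (card (row_class s ` row_frames s :: 'a mat set set))"
  let ?S = "IJ m n r s :: 'a mat set"
  have s': "s \<le> r" using s by simp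
  obtain A :: "'a mat set" where A: "A \<subseteq> idempotents_in star (DJ m n r s)"
    "sg_generated star A = ?S" "finite A" "card A \<le> ?M"
    using idempotent_generating_set[OF s] .
  have AI: "A \<subseteq> idempotents_in star ?S" using A(1) DJ_subset_IJ by (auto simp: idempotents_in_def)
  then have AS: "A \<subseteq> ?S" by (auto simp: idempotents_in_def)
  have card: "card A = ?M" using A(4) generating_set_card[OF s' AS A(2,3)] by simp
  have "sg_rank ?S star = ?M"
    unfolding sg_rank_def
    by (rule Least_equality) (use AS A(2,3) card generating_set_card[OF s'] in blast)+
  moreover have id: "sg_idrank ?S star = ?M"
    unfolding sg_idrank_def
  proof (rule Least_equality)
    show "\<exists>G\<subseteq>idempotents_in star ?S. finite G \<and> card G = ?M \<and> sg_generated star G = ?S"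
      using AI A(2,3) card by blast
    fix k assume "\<exists>G\<subseteq>idempotents_in star ?S. finite G \<and> card G = k \<and> sg_generated star G = ?S"
    then obtain G where G: "G \<subseteq> idempotents_in star ?S" "finite G" "card G = k" "sg_generated star G = ?S"
      by blast
    then have "G \<subseteq> ?S" by (auto simp: idempotents_in_def)
    then show "?M \<le> k" using generating_set_card[OF s' _ G(4,2)] G(3) by blast
  qed
  ultimately show "sg_rank ?S star = sg_idrank ?S star" by simp
  have pos: "q_binomial q r s \<ge> 0" by (simp add: q_binomial_def)
  \<comment> \<open>Since q is at least 1, the count increases with the dimension, so the larger of
    the two counts is the one for max m n.\<close>
  have mono: "rat_of_nat (q ^ (s * (a - r))) * q_binomial q r s \<le> of_nat (q ^ (s * (b - r))) * q_binomial q r s"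
    if "a \<le> b" for a b
    using q_pos that pos
    by (intro mult_right_mono of_nat_mono power_increasing mult_le_mono2 diff_le_mono) auto
  have "rat_of_nat ?M = max (rat_of_nat (card (col_class s ` col_frames s :: 'a mat set set)))
      (rat_of_nat (card (row_class s ` row_frames s :: 'a mat set set)))"
    by (simp add: max_def)
  also have "\<dots> = of_nat (q ^ (s * (max m n - r))) * q_binomial q r s"
    unfolding card_col_class[OF s'] card_row_class[OF s'] using mono[of m n] mono[of n m]
    by (cases "m \<le> n") (auto simp: max_def)
  finally show "rat_of_nat (sg_idrank ?S star) = of_nat (q ^ (s * (max m n - r))) * q_binomial q r s"
    unfolding id .
qed

end

end

theorem theorem8p1:
  fixes m n r :: nat and P :: "'a::field mat set" and D I :: "nat \<Rightarrow> 'a mat set"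
    and star :: "'a mat \<Rightarrow> 'a mat \<Rightarrow> 'a mat"
  assumes "m \<ge> 1" and "n \<ge> 1" and "r \<le> min m n"
    and "star = sandwich m n r" and "P = RegJ m n r" and "D = DJ m n r" and "I = IJ m n r"
  shows "{A. sg_ideal P star A} = {I s | s. s \<le> r}
    \<and> (\<forall>s\<le>r. I s = {X \<in> P. vec_space.rank m X \<le> s})
    \<and> (\<forall>s t. s \<le> t \<and> t \<le> r \<longrightarrow> I s \<subseteq> I t)
    \<and> (\<forall>s<r. top_D_class P star (I s) (D s)
          \<and> sg_generated star (idempotents_in star (D s)) = I s
          \<and> (\<forall>q. finite (UNIV :: 'a set) \<and> card (UNIV :: 'a set) = q \<longrightarrow>
              sg_rank (I s) star = sg_idrank (I s) star
              \<and> rat_of_nat (sg_idrank (I s) star)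
                  = of_nat (q ^ (s * (max m n - r))) * q_binomial q r s))"
proof -
  interpret sandwich_dims m n r
    using \<open>r \<le> min m n\<close> by unfold_locales auto
  have ideals: "{A. sg_ideal P star A} = {I s | s. s \<le> r}"
  proof (intro equalityI subsetI)
    fix A assume "A \<in> {A. sg_ideal P star A}"
    then have "sg_ideal (RegJ m n r) (sandwich m n r) A" by (simp add: assms(4,5))
    then obtain s where "s \<le> r" "A = IJ m n r s" by (rule sg_ideal_eq_IJ)
    then show "A \<in> {I s | s. s \<le> r}" unfolding assms(7) by blast
  next
    fix A assume "A \<in> {I s | s. s \<le> r}"
    then obtain s where "s \<le> r" "A = IJ m n r s" unfolding assms(7) by blast
    then show "A \<in> {A. sg_ideal P star A}" using sg_ideal_IJ by (simp add: assms(4,5))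
  qed
  have chain: "I s \<subseteq> I t" if "s \<le> t" for s t
    unfolding assms(7) using that by (auto simp: IJ_eq)
  have top: "top_D_class P star (I s) (D s)" if "s < r" for s
    unfolding assms(4-7) using that by (intro top_D_class_DJ) simp
  have gen: "sg_generated star (idempotents_in star (D s)) = I s" if "s < r" for s
    unfolding assms(4,6,7) using that by (rule idempotents_generate)
  have rank: "sg_rank (I s) star = sg_idrank (I s) star"
      "rat_of_nat (sg_idrank (I s) star) = of_nat (q ^ (s * (max m n - r))) * q_binomial q r s"
    if "s < r" "finite (UNIV :: 'a set) \<and> card (UNIV :: 'a set) = q" for s q
  proof -
    have q: "finite (UNIV :: 'a set)" "q = card (UNIV :: 'a set)" using that(2) by auto
    show "sg_rank (I s) star = sg_idrank (I s) star"
      unfolding assms(4,7) by (rule rank_IJ(1)[OF q that(1)])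
    show "rat_of_nat (sg_idrank (I s) star) = of_nat (q ^ (s * (max m n - r))) * q_binomial q r s"
      unfolding assms(4,7) by (rule rank_IJ(2)[OF q that(1)])
  qed
  have ranks: "I s = {X \<in> P. vec_space.rank m X \<le> s}" for s
    unfolding assms(5,7) by (rule IJ_eq)
  show ?thesis
  proof (intro conjI allI impI ideals ranks)
    show "I s \<subseteq> I t" if "s \<le> t \<and> t \<le> r" for s t
      using that by (intro chain) simp
  qed (simp_all only: top gen rank)
qed

end
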